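(* Let $N\ge0$ be an integer and let $\theta=\arg\nu$. (i) Suppose $\frac{\pi}{4}<|\theta|<\pi$. Let $\varphi^\ast,\varphi^{\ast\ast},\varphi^{\ast\ast\ast}$ be the unique solutions in the interval $I_\theta$ of $$(2N+7)\cos(3\varphi^\ast-2\theta)=(2N-5)\cos(\varphi^\ast-2\theta),$$ $$(2N+9)\cos(3\varphi^{\ast\ast}-2\theta)=(2N-3)\cos(\varphi^{\ast\ast}-2\theta),$$ $$(2N+11)\cos(3\varphi^{\ast\ast\ast}-2\theta)=(2N-1)\cos(\varphi^{\ast\ast\ast}-2\theta).$$ Put $$E_1=\frac{|\csc(2(\theta-\varphi^\ast))|}{\cos^{\frac{2N+1}{3}}\varphi^\ast}\frac{b_N(\nu)}{2\sqrt3\pi},\quad E_2=\frac{|\csc(2(\theta-\varphi^{\ast\ast}))|}{\cos^{\frac{2N+3}{3}}\varphi^{\ast\ast}}\frac{b_{N+1}(\nu)}{2\sqrt3\pi},\quad E_3=\frac{|\csc(2(\theta-\varphi^{\ast\ast\ast}))|}{\cos^{\frac{2N+5}{3}}\varphi^{\ast\ast\ast}}\frac{b_{N+2}(\nu)}{2\sqrt3\pi}.$$ Then $|R_N^{(J)}(\nu)|\le E_1+E_3$ if $N\equiv0\bmod3$; $|R_N^{(J)}(\nu)|\le E_2+E_3$ if $N\equiv1\bmod3$; and $|R_N^{(J)}(\nu)|\le E_1+E_2$ if $N\equiv2\bmod3$. (ii) Suppose $\frac{\pi}{4}<|\theta|\le\frac{\pi}{2}$ and $N\ge4$. Put $$F_1=\frac12\sqrt{\tfrac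 e3\left(2N+\tfrac{11}2\right)}\frac{b_N(\nu)}{2\sqrt3\pi},\quad F_2=\frac12\sqrt{\tfrac e3\left(2N+\tfrac{15}2\right)}\frac{b_{N+1}(\nu)}{2\sqrt3\pi},\quad F_3=\frac12\sqrt{\tfrac e3\left(2N+\tfrac{19}2\right)}\frac{b_{N+2}(\nu)}{2\sqrt3\pi}.$$ Then $|R_N^{(J)}(\nu)|\le F_1+F_3$ if $N\equiv0\bmod3$; $|R_N^{(J)}(\nu)|\le F_2+F_3$ if $N\equiv1\bmod3$; and $|R_N^{(J)}(\nu)|\le F_1+F_2$ if $N\equiv2\bmod3$.
   Context: $\nu\ne0$ is a complex number with $|\arg\nu|<\pi$, powers $\nu^{k/3}$ being principal. The remainder $R_N^{(J)}(\nu)$ in the expansion of the Bessel function of the first kind with order equal to its argument is defined by $$J_\nu(\nu)=\frac{1}{3\pi}\sum_{n=0}^{N-1}6^{\frac{2n+1}{3}}B_{2n}(0)\sin\left(\frac{(2n+1)\pi}{3}\right)\frac{\Gamma\left(\frac{2n+1}{3}\right)}{\nu^{\frac{2n+1}{3}}}+R_N^{(J)}(\nu),$$ where $B_n(0)=\frac{1}{n!}\left[\frac{d^n}{dt^n}\left(\frac16\frac{t^3}{\sinh t-t}\right)^{\frac{n+1}{3}}\right]_{t=0}$ (branch of the power equal to $1$ at $t=0$). Notation: $$b_n(\nu)=6^{\frac{2n+1}{3}}|B_{2n}(0)|\frac{\Gamma\left(\frac{2n+1}{3}\right)}{|\nu|^{\frac{2n+1}{3}}}.$$ The interval $I_\theta$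 is: $\left(-\frac{\pi}{2}+\theta,\frac{\pi}{2}\right)$ if $\frac{3\pi}{4}\le\theta<\pi$; $\left(-\frac{\pi}{2}+\theta,-\frac{\pi}{4}+\theta\right)$ if $\frac{\pi}{2}\le\theta<\frac{3\pi}{4}$; $\left(0,-\frac{\pi}{4}+\theta\right)$ if $\frac{\pi}{4}<\theta<\frac{\pi}{2}$; $\left(-\frac{\pi}{2},\frac{\pi}{2}+\theta\right)$ if $-\pi<\theta\le-\frac{3\pi}{4}$; $\left(\frac{\pi}{4}+\theta,\frac{\pi}{2}+\theta\right)$ if $-\frac{3\pi}{4}<\theta\le-\frac{\pi}{2}$; $\left(\frac{\pi}{4}+\theta,0\right)$ if $-\frac{\pi}{2}<\theta<-\frac{\pi}{4}$. *)

theory Defs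
  imports "HOL-Complex_Analysis.Complex_Analysis"
begin

text \<open>The Bessel function of the first kind of complex order, on its principal branch.
  The use of \<^const>\<open>rGamma\<close> (the entire function 1/Gamma) covers orders that are negative integers.\<close>

definition bessel_J :: "complex \<Rightarrow> complex \<Rightarrow> complex" where
  "bessel_J \<nu> z =
     (z / 2) powr \<nu> * (\<Sum>k. (- 1) ^ k * (z\<^sup>2 / 4) ^ k * rGamma (\<nu> + of_nat k + 1) / fact k)"

text \<open>The value at 0 fills the removable singularity; close to 0 the base is close to 1, so there
  the principal power is the holomorphic branch that equals 1 at 0.\<close>

definition B0 :: "nat \<Rightarrow> complex" where
  "B0 n = (deriv ^^ n)
     (\<lambda>t. (if t = 0 then 1 else 1 / 6 * (t ^ 3 / (sinh t - t))) powr (of_nat (n + 1) / 3)) 0 / fact n"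

definition remainder_J :: "nat \<Rightarrow> complex \<Rightarrow> complex" where
  "remainder_J N \<nu> = bessel_J \<nu> \<nu> -
     1 / (3 * of_real pi) *
     (\<Sum>n<N. of_real (6 powr (real (2 * n + 1) / 3)) * B0 (2 * n)
            * of_real (sin (real (2 * n + 1) * pi / 3))
            * (of_real (Gamma (real (2 * n + 1) / 3)) / \<nu> powr (of_nat (2 * n + 1) / 3)))"

definition b :: "nat \<Rightarrow> complex \<Rightarrow> real" where
  "b n \<nu> = 6 powr (real (2 * n + 1) / 3) * norm (B0 (2 * n))
     * (Gamma (real (2 * n + 1) / 3) / norm \<nu> powr (real (2 * n + 1) / 3))"

text \<open>Only used for \<open>\<pi>/4 < \<bar>\<theta>\<bar> < \<pi>\<close>.\<close>

definition I :: "real \<Rightarrow> real set" where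
  "I \<theta> =
    (if 3 * pi / 4 \<le> \<theta> \<and> \<theta> < pi then {- pi / 2 + \<theta> <..< pi / 2}
     else if pi / 2 \<le> \<theta> \<and> \<theta> < 3 * pi / 4 then {- pi / 2 + \<theta> <..< - pi / 4 + \<theta>}
     else if pi / 4 < \<theta> \<and> \<theta> < pi / 2 then {0 <..< - pi / 4 + \<theta>}
     else if - pi < \<theta> \<and> \<theta> \<le> - 3 * pi / 4 then {- pi / 2 <..< pi / 2 + \<theta>}
     else if - 3 * pi / 4 < \<theta> \<and> \<theta> \<le> - pi / 2 then {pi / 4 + \<theta> <..< pi / 2 + \<theta>}
     else if - pi / 2 < \<theta> \<and> \<theta> < - pi / 4 then {pi / 4 + \<theta> <..< 0}
     else {})"

end

theory Submission
  imports Defs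
begin

text \<open>
  Let \<open>p(t) = sinh t - t\<close>. Up to the saddles \<open>\<plusminus>2\<pi>i\<close> its cube root \<open>W\<close> is holomorphic and invertible, and the
  inverse \<open>y\<close> is holomorphic off the cuts where \<open>w = \<plusminus>i r\<close>, \<open>r \<ge> (2\<pi>)\<^sup>1\<^sup>/\<^sup>3\<close>. The values of \<open>y\<close> on the two sides
  of a cut differ by the sign of the real part \<open>x\<close>, so Cauchy's formula for \<open>y'\<close> is a Stieltjes integral
  \<open>y'(w) = (2/\<pi>) \<integral> \<rho> / (\<rho>\<^sup>2 + w\<^sup>2) dx\<close> over \<open>x > 0\<close> with a positive measure; its moments are the
  numbers \<open>6\<^bsup>(2n+1)/3\<^esup> \<bar>B\<^bsub>2n\<^esub>(0)\<bar>\<close>, whose signs alternate.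

  The path of steepest descent turns Schlaefli's integral into
  \<open>\<pi> J\<^sub>\<nu>(\<nu>) = \<integral> e\<^bsup>-\<nu>s\<^esup> Im (dt/ds) ds\<close> with \<open>t = y(w)\<close>, \<open>w\<^sup>3 = - s\<close>, \<open>arg w = \<pi>/3\<close>. Expanding
  \<open>1 / (\<rho>\<^sup>2 + w\<^sup>2)\<close> with remainder \<open>(\<rho>\<^sup>4 - \<rho>\<^sup>2 w\<^sup>2 + w\<^sup>4) / (\<rho>\<^sup>6 + s\<^sup>2)\<close> leaves three Laplace integrals, one of which has
  coefficient 0. They continue to \<open>\<bar>arg \<nu>\<bar> < \<pi>\<close> by rotating the path of integration by \<open>\<theta> - \<phi>\<close>, where
  \<open>\<bar>1 + s\<^sup>2/\<rho>\<^sup>6\<bar> \<ge> \<bar>sin (2(\<theta> - \<phi>))\<bar>\<close>. The equations for \<open>\<phi>\<close> say that \<open>\<bar>csc (2(\<theta> - \<phi>))\<bar> / cos\<^sup>a \<phi>\<close> is stationary; it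
  is logarithmically convex on the interval. The choice \<open>tan\<^sup>2 \<phi> = 1 / (a + 1)\<close>, optimal for \<open>\<theta> = \<pi>/2\<close>, gives the
  second estimate.
\<close>

section \<open>Integrals over a half-line\<close>

text \<open>The inverse \<open>y\<close> is never constructed. Residues are computed in the t-plane,
  between the curves lying over the cuts, where y' appears as 1 / W'; injectivity of W matters only
  over 0 and over the points of the descent path. Contour integrals are differences of primitives
  with explicit limits at the ends.

  The remainder collects three consecutive terms because w^6 = s^2: the denominator
  \<open>rho^2 + w^2\<close> involves a cube root of s, whereas \<open>rho^6 + s^2\<close> is
  polynomial in s with zeros only on the imaginary axis. So the path may be turned by any \<alpha>
  of modulus below \<pi>/2, while convergence asks that arg \<nu> - \<alpha> be below \<pi>/2 in
  modulus; together these reach exactly the slit plane. Of three consecutive values of sin ((2n+1)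
  \<pi> / 3) one vanishes and two have modulus sqrt 3 / 2, which with the prefactor 1 / (3 \<pi>)
  gives 1 / (2 sqrt 3 \<pi>).

  The Bessel series is matched with the integral for 0 < \<nu> < 1 only, where Hankel's loop of
  lowest order collapses onto the negative axis; the identity theorem does the rest.\<close>

lemma absolutely_integrable_on_Ici:
  fixes f :: "real \<Rightarrow> 'a::euclidean_space"
  assumes "f absolutely_integrable_on {0<..}"
  shows "f absolutely_integrable_on {0..}"
  using assms
  by (subst absolutely_integrable_spike_set_eq[of "{0..}" "{0<..}"])
     (auto intro: negligible_subset[of "{0}"])

lemma integral_Icc_tendsto:
  fixes f :: "real \<Rightarrow> 'a::euclidean_space"
  assumes f: "f absolutely_integrable_on {0<..}"
  shows "((\<lambda>x. integral {0..x} f) \<longlongrightarrow> integral {0<..} f) at_top"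
proof -
  note f0 = absolutely_integrable_on_Ici[OF f]
  have int: "f absolutely_integrable_on {0..x}" for x
    by (rule set_integrable_subset[OF f0]) auto
  have "((\<lambda>x. LINT t:{0..x}|lebesgue. f t) \<longlongrightarrow> (LINT t:{0..}|lebesgue. f t)) at_top"
    by (rule tendsto_set_lebesgue_integral_at_top[OF _ f0]) auto
  also have "(\<lambda>x. LINT t:{0..x}|lebesgue. f t) = (\<lambda>x. integral {0..x} f)"
    by (intro ext set_lebesgue_integral_eq_integral(2) int)
  also have "(LINT t:{0..}|lebesgue. f t) = integral {0..} f"
    by (intro set_lebesgue_integral_eq_integral(2) f0)
  also have "integral {0..} f = integral {0<..} f"
    by (rule integral_spike_set) (auto intro: negligible_subset[of "{0}"])
  finally show ?thesis .
qed

text \<open>Integrands such as \<sigma>^(a - 1) e^(-c \<sigma>) with a < 1 blow up at 0. The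
  primitive is therefore described by its limits at the two ends of the open half-line.\<close>

lemma half_line_primitive:
  fixes f :: "real \<Rightarrow> 'a::euclidean_space"
  assumes f: "f absolutely_integrable_on {0<..}" and cont: "continuous_on {0<..} f"
  obtains G where "(G \<longlongrightarrow> 0) (at_right 0)" "(G \<longlongrightarrow> integral {0<..} f) at_top"
    "\<And>x. x > 0 \<Longrightarrow> (G has_vector_derivative f x) (at x)"
proof -
  define G where "G x = integral {0..x} f" for x
  have int: "f absolutely_integrable_on {0..x}" for x
    by (rule set_integrable_subset[OF absolutely_integrable_on_Ici[OF f]]) auto
  then have inth: "f integrable_on {0..x}" for x
    using set_lebesgue_integral_eq_integral(1) by blast
  have "(G \<longlongrightarrow> 0) (at_right 0)"
  proof -
    have "continuous_on {0..1} G" unfolding G_def by (rule indefinite_integral_continuous_1[OF inth])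
    then have "(G \<longlongrightarrow> G 0) (at 0 within {0..1})" by (auto simp: continuous_on_def)
    then show ?thesis by (simp add: G_def at_within_Icc_at_right)
  qed
  moreover have "(G \<longlongrightarrow> integral {0<..} f) at_top"
    unfolding G_def by (rule integral_Icc_tendsto[OF f])
  moreover have "(G has_vector_derivative f x) (at x)" if "x > 0" for x
  proof -
    have "continuous (at x) f"
      using cont that by (simp add: continuous_on_eq_continuous_at)
    then have "(G has_vector_derivative f x) (at x within {0..x+1} - {})"
      unfolding G_def using that
      by (intro integral_has_vector_derivative_continuous_at inth) (auto intro: continuous_at_imp_continuous_within)
    moreover have "at x within {0..x+1} = at x" using that by (intro at_within_interior) auto
    ultimately show ?thesis by simp
  qed
  ultimately show ?thesis using that by blast
qed

text \<open>Substitutions and changes of path are made with this: a candidate primitive is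
  differentiated for x > 0 and its limit at 0 is computed. It differs from the primitive above by a
  constant, which the limits at 0 identify.\<close>

lemma half_line_FTC:
  fixes f :: "real \<Rightarrow> 'a::euclidean_space"
  assumes f: "f absolutely_integrable_on {0<..}" "continuous_on {0<..} f"
    and F: "\<And>x. x > 0 \<Longrightarrow> (F has_vector_derivative f x) (at x)"
    and lim: "(F \<longlongrightarrow> A) (at_right 0)"
  shows "(F \<longlongrightarrow> A + integral {0<..} f) at_top"
proof -
  obtain G where G: "(G \<longlongrightarrow> 0) (at_right 0)" "(G \<longlongrightarrow> integral {0<..} f) at_top"
    "\<And>x. x > 0 \<Longrightarrow> (G has_vector_derivative f x) (at x)"
    using half_line_primitive[OF f] by blast
  have "((\<lambda>x. F x - G x) has_vector_derivative 0) (at x within {0<..})" if "x \<in> {0<..}" for x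
    using has_vector_derivative_diff[OF F G(3), of x] that
    by (auto intro: has_vector_derivative_at_within)
  then obtain c where "\<And>x. x \<in> {0<..} \<Longrightarrow> F x - G x = c"
    using has_vector_derivative_zero_constant[of "{0<..}" "\<lambda>x. F x - G x"] by (metis convex_real_interval(3))
  then have c: "F x = c + G x" if "x > 0" for x
    using that by (metis diff_add_cancel greaterThan_iff)
  have "(F \<longlongrightarrow> c + 0) (at_right 0)"
    by (rule Lim_transform_eventually[OF tendsto_add[OF tendsto_const G(1)]])
       (auto simp: eventually_at_right_less c intro: eventually_mono[OF eventually_at_right_less])
  then have "c = A" using tendsto_unique[OF _ lim] by force
  moreover have "(F \<longlongrightarrow> c + integral {0<..} f) at_top"
    by (rule Lim_transform_eventually[OF tendsto_add[OF tendsto_const G(2)]])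
       (auto simp: c intro: eventually_mono[OF eventually_gt_at_top[of 0]])
  ultimately show ?thesis by simp
qed

lemma half_line_FTC_eq:
  fixes f :: "real \<Rightarrow> 'a::euclidean_space"
  assumes "f absolutely_integrable_on {0<..}" "continuous_on {0<..} f"
    and "\<And>x. x > 0 \<Longrightarrow> (F has_vector_derivative f x) (at x)"
    and "(F \<longlongrightarrow> A) (at_right 0)" "(F \<longlongrightarrow> L) at_top"
  shows "integral {0<..} f = L - A"
proof -
  have "A + integral {0<..} f = L"
    using tendsto_unique[OF trivial_limit_at_top_linorder half_line_FTC[OF assms(1-4)] assms(5)] .
  then show ?thesis by (simp add: algebra_simps)
qed

lemma absolutely_integrable_continuous_dominated:
  fixes f :: "real \<Rightarrow> 'a::euclidean_space"
  assumes "continuous_on {0<..} f" "g integrable_on {0<..}" "\<And>x. x > 0 \<Longrightarrow> norm (f x) \<le> g x"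
  shows "f absolutely_integrable_on {0<..}"
  by (rule measurable_bounded_by_integrable_imp_absolutely_integrable[where g=g])
     (use assms in \<open>auto intro!: continuous_imp_measurable_on_sets_lebesgue\<close>)

lemma has_integral_greaterThan_iff:
  fixes f :: "real \<Rightarrow> 'a::euclidean_space"
  shows "(f has_integral y) {a<..} \<longleftrightarrow> (f has_integral y) {a..}"
  by (rule has_integral_spike_set_eq) (auto intro: negligible_subset[of "{a}"])

lemma has_absolute_integral_Gamma:
  assumes "a > 0" "c > (0::real)"
  shows "((\<lambda>t. t powr (a - 1) * exp (- c * t)) has_integral Gamma a / c powr a) {0<..}"
    "(\<lambda>t. t powr (a - 1) * exp (- c * t)) absolutely_integrable_on {0<..}"
proof -
  have abs: "(\<lambda>t. t powr (a - 1) * exp (- c * t)) absolutely_integrable_on {0<..}" if "c > 0" for c :: real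
  proof -
    have "(\<lambda>t. norm (complex_of_real t powr (complex_of_real a - 1) / of_real (exp (c * t)))) absolutely_integrable_on {0<..}"
      using absolutely_integrable_Gamma_integral[of "of_real a" c] assms that by (intro set_integrable_norm) auto
    then show ?thesis
      by (rule set_integrable_cong[THEN iffD1, rotated 3])
         (auto simp: norm_divide norm_powr_real_powr exp_minus field_simps)
  qed
  show "(\<lambda>t. t powr (a - 1) * exp (- c * t)) absolutely_integrable_on {0<..}" by (rule abs[OF assms(2)])
  let ?f = "\<lambda>t::real. t powr (a - 1) * exp (- 1 * t)"
  have c: "continuous_on {0<..} ?f" by (intro continuous_intros) auto
  obtain G where G: "(G \<longlongrightarrow> 0) (at_right 0)" "(G \<longlongrightarrow> integral {0<..} ?f) at_top"
    "\<And>x. x > 0 \<Longrightarrow> (G has_vector_derivative ?f x) (at x)"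
    using half_line_primitive[OF abs[OF zero_less_one] c] by blast
  have "integral {0<..} ?f = Gamma a"
    using Gamma_integral_real[OF assms(1)]
    by (intro integral_unique) (simp add: has_integral_greaterThan_iff exp_minus divide_inverse)
  with G(2) have G2: "(G \<longlongrightarrow> Gamma a) at_top" by simp
  have "integral {0<..} (\<lambda>t. t powr (a - 1) * exp (- c * t)) = Gamma a / c powr a - 0 / c powr a"
  proof (rule half_line_FTC_eq[OF abs[OF assms(2)]])
    show "((\<lambda>t. G (c * t) / c powr a) has_vector_derivative t powr (a - 1) * exp (- c * t)) (at t)" if "t > 0" for t
    proof -
      have "(G has_real_derivative ?f (c * t)) (at (c * t))"
        using G(3)[of "c * t"] that assms by (simp add: has_real_derivative_iff_has_vector_derivative)
      moreover have "((\<lambda>t. c * t) has_real_derivative c) (at t)"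
        by (auto intro!: derivative_eq_intros)
      ultimately have "((\<lambda>t. G (c * t) / c powr a) has_real_derivative (?f (c * t) * c) / c powr a) (at t)"
        using DERIV_cdivide[OF DERIV_chain2] by blast
      also have "(?f (c * t) * c) / c powr a = t powr (a - 1) * exp (- c * t)"
        using that assms by (simp add: powr_mult powr_diff field_simps)
      finally show ?thesis by (simp add: has_real_derivative_iff_has_vector_derivative)
    qed
    have "filterlim (\<lambda>t. c * t) (at_right 0) (at_right 0)"
      unfolding filterlim_at using assms
      by (auto intro!: tendsto_eq_intros intro: eventually_mono[OF eventually_at_right_less])
    then show "((\<lambda>t. G (c * t) / c powr a) \<longlongrightarrow> 0 / c powr a) (at_right 0)"
      by (intro tendsto_divide tendsto_const filterlim_compose[OF G(1)]) (use assms in auto)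
    have "filterlim (\<lambda>t. c * t) at_top at_top"
      using assms by (intro filterlim_tendsto_pos_mult_at_top[OF tendsto_const] filterlim_ident)
    then show "((\<lambda>t. G (c * t) / c powr a) \<longlongrightarrow> Gamma a / c powr a) at_top"
      by (intro tendsto_divide tendsto_const filterlim_compose[OF G2]) (use assms in auto)
  qed (auto intro!: continuous_intros)
  then show "((\<lambda>t. t powr (a - 1) * exp (- c * t)) has_integral Gamma a / c powr a) {0<..}"
    using integrable_integral[OF set_lebesgue_integral_eq_integral(1)[OF abs[OF assms(2)]]] by simp
qed

text \<open>Only the integrand itself has to be dominated. Cauchy's inequality turns a bound g on a
  ball of radius r into the bound 2 g / r for the derivative on the half ball, and by the mean value
  inequality this dominates the difference quotients.\<close>

lemma integral_holomorphic_on: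
  fixes f :: "complex \<Rightarrow> real \<Rightarrow> complex"
  assumes "open S"
    and int: "\<And>z. z \<in> S \<Longrightarrow> f z integrable_on A"
    and hol: "\<And>x. x \<in> A \<Longrightarrow> (\<lambda>z. f z x) holomorphic_on S"
    and dom: "\<And>z. z \<in> S \<Longrightarrow> \<exists>r>0. \<exists>g. g integrable_on A \<and> cball z r \<subseteq> S \<and> (\<forall>x\<in>A. \<forall>y\<in>cball z r. norm (f y x) \<le> g x)"
  shows "(\<lambda>z. integral A (f z)) holomorphic_on S"
  unfolding holomorphic_on_def field_differentiable_def
proof
  fix z0 assume z0: "z0 \<in> S"
  then obtain r g where r: "r > 0" and g: "g integrable_on A" and sub: "cball z0 r \<subseteq> S"
    and le: "\<And>x y. x \<in> A \<Longrightarrow> y \<in> cball z0 r \<Longrightarrow> norm (f y x) \<le> g x"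
    using dom by metis
  let ?F = "\<lambda>z. integral A (f z)"
  let ?D = "integral A (\<lambda>x. deriv (\<lambda>z. f z x) z0)"
  have diff: "((\<lambda>z. f z x) has_field_derivative deriv (\<lambda>z. f z x) y) (at y)" if "x \<in> A" "y \<in> S" for x y
    using hol[OF that(1)] that(2) \<open>open S\<close> holomorphic_derivI by blast
  have db: "norm (deriv (\<lambda>z. f z x) y) \<le> 2 * g x / r" if x: "x \<in> A" and y: "y \<in> cball z0 (r/2)" for x y
  proof -
    have s: "cball y (r/2) \<subseteq> cball z0 r"
      using y by (intro cball_subset_cball_iff[THEN iffD2]) (auto simp: dist_commute)
    have h: "(\<lambda>z. f z x) holomorphic_on cball y (r/2)"
      using hol[OF x] s sub by (meson holomorphic_on_subset subset_trans)
    have "norm ((deriv ^^ 1) (\<lambda>z. f z x) y) \<le> fact 1 * g x / (r/2) ^ 1"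
    proof (rule Cauchy_inequality)
      show "(\<lambda>z. f z x) holomorphic_on ball y (r/2)" using h by (rule holomorphic_on_subset) auto
      show "continuous_on (cball y (r/2)) (\<lambda>z. f z x)" using h by (rule holomorphic_on_imp_continuous_on)
      show "norm (f v x) \<le> g x" if "norm (y - v) = r / 2" for v
        using le[OF x] s that by (auto simp: dist_norm subset_iff)
    qed (use r in auto)
    then show ?thesis by (simp add: field_simps)
  qed
  have "((\<lambda>y. (?F y - ?F z0) / (y - z0)) \<longlongrightarrow> ?D) (at z0)"
    unfolding tendsto_at_iff_sequentially
  proof (intro allI impI)
    fix X :: "nat \<Rightarrow> complex" assume X: "\<forall>i. X i \<in> UNIV - {z0}" "X \<longlonglongrightarrow> z0"
    have "\<forall>\<^sub>F n in sequentially. X n \<in> ball z0 (r/2)"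
      using X(2) r by (intro topological_tendstoD) auto
    then obtain N where N: "\<And>n. n \<ge> N \<Longrightarrow> X n \<in> ball z0 (r/2)" by (auto simp: eventually_sequentially)
    \<comment> \<open>The shift by \<open>N\<close> puts every term of the sequence into the half
      ball, so that the domination holds for all indices.\<close>
    let ?q = "\<lambda>n x. (f (X (n + N)) x - f z0 x) / (X (n + N) - z0)"
    have XS: "X (n + N) \<in> S" for n using N[of "n+N"] sub r by (auto simp: subset_iff)
    have qi: "?q n integrable_on A" for n
      using int[OF XS] int[OF z0] by (auto simp: divide_inverse intro!: integrable_on_mult_left integrable_diff)
    have "(\<lambda>n. integral A (?q n)) \<longlonglongrightarrow> ?D"
    proof (rule dominated_convergence(2))
      show "?q n integrable_on A" for n by (rule qi)
      show "(\<lambda>x. 2 * g x / r) integrable_on A" using g by (simp add: integrable_on_divide integrable_on_mult_right)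
      show "norm (?q n x) \<le> 2 * g x / r" if "x \<in> A" for n x
      proof -
        have "norm (f (X (n + N)) x - f z0 x) \<le> 2 * g x / r * norm (X (n + N) - z0)"
        proof (rule field_differentiable_bound[of "cball z0 (r/2)" "\<lambda>z. f z x" "deriv (\<lambda>z. f z x)"])
          show "((\<lambda>z. f z x) has_field_derivative deriv (\<lambda>z. f z x) y) (at y within cball z0 (r/2))"
            if y: "y \<in> cball z0 (r/2)" for y
          proof -
            have "y \<in> S" using y sub r by (auto simp: subset_iff)
            then show ?thesis using diff[OF \<open>x \<in> A\<close>] has_field_derivative_at_within by blast
          qed
          show "norm (deriv (\<lambda>z. f z x) y) \<le> 2 * g x / r" if "y \<in> cball z0 (r/2)" for y
            using db \<open>x \<in> A\<close> that by blast
        qed (use N[of "n+N"] r in auto)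
        moreover have "X (n+N) \<noteq> z0" using X(1) by auto
        ultimately show ?thesis by (simp add: norm_divide divide_le_eq)
      qed
      show "(\<lambda>n. ?q n x) \<longlonglongrightarrow> deriv (\<lambda>z. f z x) z0" if "x \<in> A" for x
      proof -
        have "((\<lambda>y. (f y x - f z0 x) / (y - z0)) \<longlongrightarrow> deriv (\<lambda>z. f z x) z0) (at z0)"
          using diff[OF that z0] by (simp add: has_field_derivative_iff)
        moreover have "filterlim (\<lambda>n. X (n + N)) (at z0) sequentially"
          using X by (auto simp: filterlim_at LIMSEQ_ignore_initial_segment)
        ultimately show ?thesis by (rule filterlim_compose)
      qed
    qed
    also have "(\<lambda>n. integral A (?q n)) = (\<lambda>n. (?F (X (n + N)) - ?F z0) / (X (n + N) - z0))"
      using int[OF XS] int[OF z0]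
      by (simp add: divide_inverse integral_mult_left integral_diff integrable_diff)
    finally show "((\<lambda>y. (?F y - ?F z0) / (y - z0)) \<circ> X) \<longlonglongrightarrow> ?D"
      unfolding o_def by (rule LIMSEQ_offset)
  qed
  then have "(?F has_field_derivative ?D) (at z0)" by (simp add: has_field_derivative_iff)
  then show "\<exists>D. (?F has_field_derivative D) (at z0 within S)" by (blast intro: has_field_derivative_at_within)
qed

text \<open>Averaging a primitive with its conjugate reflection makes it real on the real axis. An
  integral between conjugate endpoints is then 2i times the imaginary part of the primitive at one
  of them.\<close>

lemma entire_real_primitive:
  assumes "f holomorphic_on UNIV" "\<And>t. f (cnj t) = cnj (f t)"
  obtains F where "\<And>t. (F has_field_derivative f t) (at t)" "\<And>t. F (cnj t) = cnj (F t)"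
proof -
  obtain G where G: "\<And>t. (G has_field_derivative f t) (at t)"
    using holomorphic_convex_primitive'[OF convex_UNIV open_UNIV assms(1)] by auto
  define F where "F t = (G t + cnj (G (cnj t))) / 2" for t
  have "(F has_field_derivative f t) (at t)" for t
  proof -
    have "((\<lambda>t. cnj (G (cnj t))) has_field_derivative f t) (at t)"
      using has_field_derivative_cnj_cnj[OF G[of "cnj t"]] assms(2) by (simp add: o_def)
    then show ?thesis
      unfolding F_def using G[of t] by (auto intro!: derivative_eq_intros)
  qed
  moreover have "F (cnj t) = cnj (F t)" for t
    by (simp add: F_def)
  ultimately show ?thesis using that by blast
qed

lemma norm_primitive_diff_le:
  fixes F f :: "complex \<Rightarrow> complex"
  assumes F: "\<And>t. t \<in> closed_segment a c \<Longrightarrow> (F has_field_derivative f t) (at t)"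
    and B: "\<And>t. t \<in> closed_segment a c \<Longrightarrow> norm (f t) \<le> B"
  shows "norm (F c - F a) \<le> B * norm (c - a)"
  by (rule field_differentiable_bound[of "closed_segment a c" F f B])
     (use assms in \<open>auto intro: has_field_derivative_at_within\<close>)

lemma closed_segment_vertical:
  assumes "t \<in> closed_segment (Complex x a) (Complex x d)"
  shows "Re t = x" "min a d \<le> Im t" "Im t \<le> max a d"
proof -
  obtain u where u: "0 \<le> u" "u \<le> 1" "t = (1 - u) *\<^sub>R Complex x a + u *\<^sub>R Complex x d"
    using assms by (auto simp: in_segment)
  show "Re t = x" unfolding u(3) by (simp add: algebra_simps)
  have i: "Im t = (1-u)*a + u*d" using u by simp
  show "Im t \<le> max a d" unfolding i using u
    by (intro convex_bound_le) auto
  have "(1-u)*(-a) + u*(-d) \<le> max (-a) (-d)" using u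
    by (intro convex_bound_le) auto
  then show "min a d \<le> Im t" unfolding i by (simp add: max_def min_def algebra_simps split: if_splits)
qed

lemma DERIV_horizontal:
  assumes "(F has_field_derivative D) (at (Complex x y))"
  shows "((\<lambda>x. Im (F (Complex x y))) has_real_derivative Im D) (at x)"
    "((\<lambda>x. F (Complex x y)) has_vector_derivative D) (at x)"
proof -
  have "((\<lambda>x. Complex x y) has_vector_derivative 1) (at x)"
    unfolding Complex_eq has_vector_derivative_def
    by (auto intro!: derivative_eq_intros simp: scaleR_conv_of_real)
  from field_vector_diff_chain_at[OF this assms]
  show *: "((\<lambda>x. F (Complex x y)) has_vector_derivative D) (at x)"
    by (simp add: o_def)
  show "((\<lambda>x. Im (F (Complex x y))) has_real_derivative Im D) (at x)"
    unfolding has_real_derivative_iff_has_vector_derivative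
    using bounded_linear.has_vector_derivative[OF bounded_linear_Im *] by simp
qed

lemma DERIV_vertical:
  assumes "(F has_field_derivative D) (at (Complex x y))"
  shows "((\<lambda>y. F (Complex x y)) has_vector_derivative \<i> * D) (at y)"
proof -
  have "((\<lambda>y. Complex x y) has_vector_derivative \<i>) (at y)"
    unfolding Complex_eq has_vector_derivative_def
    by (auto intro!: derivative_eq_intros simp: scaleR_conv_of_real)
  from field_vector_diff_chain_at[OF this assms]
  show ?thesis by (simp add: o_def)
qed

lemma vertical_integral_primitive:
  assumes F: "\<And>t. (F has_field_derivative f t) (at t)" and sym: "\<And>t. F (cnj t) = cnj (F t)"
  shows "((\<lambda>v. f (Complex X v)) has_integral of_real (2 * Im (F (Complex X pi)))) {-pi..pi}"
proof -
  have "((\<lambda>v. \<i> * f (Complex X v)) has_integral (F (Complex X pi) - F (Complex X (-pi)))) {-pi..pi}"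
    by (rule fundamental_theorem_of_calculus)
       (auto intro!: has_vector_derivative_at_within DERIV_vertical F)
  then have "((\<lambda>v. - \<i> * (\<i> * f (Complex X v))) has_integral - \<i> * (F (Complex X pi) - F (Complex X (-pi)))) {-pi..pi}"
    by (rule has_integral_mult_right)
  moreover have "F (Complex X (-pi)) = cnj (F (Complex X pi))"
    using sym[of "Complex X pi"] by (simp add: complex_cnj)
  moreover have "- \<i> * (z - cnj z) = of_real (2 * Im z)" for z
    by (simp add: complex_eq_iff)
  ultimately show ?thesis by (simp flip: mult.assoc)
qed

section \<open>Hankel's loop integral and the Bessel function\<close>

text \<open>With u = e^t this is e^u u^(-z) du. Hankel's loop round the negative u-axis becomes a
  path from infinity - i \<pi> to infinity + i \<pi>, so its value is read off from the imaginary
  part of a real primitive at X + i \<pi> as X grows.\<close>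

definition hankel_integrand :: "real \<Rightarrow> complex \<Rightarrow> complex" where
  "hankel_integrand z t = exp (exp t + of_real (1 - z) * t)"

lemma hankel_integrand_cnj: "hankel_integrand z (cnj t) = cnj (hankel_integrand z t)"
  by (simp add: hankel_integrand_def exp_cnj)

lemma hankel_integrand_holomorphic: "hankel_integrand z holomorphic_on A"
  unfolding hankel_integrand_def by (intro holomorphic_intros)

lemma norm_hankel_integrand_le:
  assumes "Re t = x"
  shows "norm (hankel_integrand z t) \<le> exp (exp x + (1 - z) * x)"
proof -
  have "exp x * cos (Im t) \<le> exp x" by (simp add: mult_left_le)
  then show ?thesis using assms
    by (simp add: hankel_integrand_def Re_exp)
qed

lemma Im_hankel_integrand:
  "Im (hankel_integrand z (Complex X pi)) = exp (- exp X + (1 - z) * X) * sin (pi * z)"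
proof -
  have "hankel_integrand z (Complex X pi)
      = exp (Complex (- exp X + (1 - z) * X) ((1 - z) * pi))"
    unfolding hankel_integrand_def by (intro arg_cong[of _ _ exp]) (simp add: complex_eq_iff Re_exp Im_exp)
  moreover have "sin ((1 - z) * pi) = sin (pi * z)"
    using sin_diff[of pi "pi * z"] by (simp add: algebra_simps)
  ultimately show ?thesis by (simp add: Im_exp)
qed

text \<open>Here the loop collapses onto the negative axis. As X tends to minus infinity the
  vertical segment contributes nothing, because 1 - z > 0; along Im t = \<pi> the substitution u =
  e^X leaves sin (\<pi> z) times the integral for Gamma (1 - z), and the reflection formula gives
  \<pi> / Gamma z.\<close>

lemma hankel_tendsto_base:
  assumes z: "0 < z" "z < (1::real)"
    and K: "\<And>t. (K has_field_derivative hankel_integrand z t) (at t)" "\<And>t. K (cnj t) = cnj (K t)"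
  shows "((\<lambda>X. Im (K (Complex X pi))) \<longlongrightarrow> pi * rGamma z) at_top"
proof -
  let ?h = "\<lambda>X. Im (K (Complex X pi))"
  let ?f = "\<lambda>u::real. sin (pi * z) * (u powr ((1 - z) - 1) * exp (- 1 * u))"
  have f: "?f absolutely_integrable_on {0<..}"
    using has_absolute_integral_Gamma(2)[of "1 - z" 1] z by (intro set_integrable_mult_right) auto
  have intf: "integral {0<..} ?f = sin (pi * z) * Gamma (1 - z)"
    using has_absolute_integral_Gamma(1)[of "1 - z" 1] z
    by (simp add: integral_unique)
  have d: "((\<lambda>u. ?h (ln u)) has_vector_derivative ?f u) (at u)" if "u > 0" for u
  proof -
    have "((\<lambda>u. ?h (ln u)) has_real_derivative Im (hankel_integrand z (Complex (ln u) pi)) * inverse u) (at u)"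
      by (intro DERIV_chain2[of ?h] DERIV_horizontal K DERIV_ln that)
    also have "Im (hankel_integrand z (Complex (ln u) pi)) * inverse u = ?f u"
      unfolding Im_hankel_integrand using that
      by (simp add: powr_def exp_add exp_diff exp_minus left_diff_distrib field_simps)
    finally show ?thesis by (simp add: has_real_derivative_iff_has_vector_derivative)
  qed
  have hb: "norm (?h X) \<le> exp (exp X + (1 - z) * X) * pi" for X
  proof -
    have "Im (K (Complex X 0)) = 0"
      using K(2)[of "Complex X 0"] by (simp add: complex_eq_iff complex_cnj)
    then have "norm (?h X) = \<bar>Im (K (Complex X pi) - K (Complex X 0))\<bar>" by simp
    also have "\<dots> \<le> norm (K (Complex X pi) - K (Complex X 0))" by (rule abs_Im_le_cmod)
    also have "\<dots> \<le> exp (exp X + (1 - z) * X) * norm (Complex X pi - Complex X 0)"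
      by (intro norm_primitive_diff_le[OF K(1)] norm_hankel_integrand_le closed_segment_vertical)
    also have "Complex X pi - Complex X 0 = \<i> * pi" by (simp add: complex_eq_iff)
    finally show ?thesis by (simp add: norm_mult)
  qed
  have "((\<lambda>u. exp u * u powr (1 - z) * pi) \<longlongrightarrow> 0) (at_right 0)"
  proof -
    have "((\<lambda>u. u powr (1 - z)) \<longlongrightarrow> 0 powr (1 - z)) (at_right 0)"
      by (rule tendsto_powr') (use z eventually_at_right_less[of "0::real"] in \<open>auto elim: eventually_mono\<close>)
    from tendsto_mult[OF tendsto_mult[OF tendsto_exp[OF tendsto_ident_at] this] tendsto_const[of pi]]
    show ?thesis by simp
  qed
  then have lim0: "((\<lambda>u. ?h (ln u)) \<longlongrightarrow> 0) (at_right 0)"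
  proof (rule Lim_null_comparison[rotated])
    show "\<forall>\<^sub>F u in at_right 0. norm (?h (ln u)) \<le> exp u * u powr (1 - z) * pi"
      using eventually_at_right_less[of 0]
    proof eventually_elim
      case (elim u)
      then show ?case using hb[of "ln u"] by (simp add: powr_def exp_add)
    qed
  qed
  have cont: "continuous_on {0<..} ?f" by (intro continuous_intros) auto
  from half_line_FTC[OF f cont d lim0]
  have "((\<lambda>u. ?h (ln u)) \<longlongrightarrow> sin (pi * z) * Gamma (1 - z)) at_top" by (simp only: intf add_0)
  from filterlim_compose[OF this exp_at_top]
  have "(?h \<longlongrightarrow> sin (pi * z) * Gamma (1 - z)) at_top" by simp
  moreover have "sin (pi * z) * Gamma (1 - z) = pi * rGamma z"
  proof -
    have "Gamma (complex_of_real z) * Gamma (1 - of_real z) = of_real pi / sin (of_real pi * of_real z)"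
      by (rule Gamma_reflection_complex)
    moreover have "complex_of_real (Gamma z * Gamma (1 - z)) = Gamma (of_real z) * Gamma (of_real (1 - z))"
      by (simp only: of_real_mult Gamma_complex_of_real)
    ultimately have "complex_of_real (Gamma z * Gamma (1 - z)) = of_real pi / sin (of_real (pi * z))"
      by simp
    then have "complex_of_real (Gamma z * Gamma (1 - z)) = of_real (pi / sin (pi * z))"
      by (simp only: sin_of_real of_real_divide)
    then have "Gamma z * Gamma (1 - z) = pi / sin (pi * z)" by (simp only: of_real_eq_iff)
    moreover have "sin (pi * z) > 0" using z by (intro sin_gt_zero) auto
    moreover have "Gamma z > 0" using z by (simp add: Gamma_real_pos)
    ultimately show ?thesis by (simp add: rGamma_inverse_Gamma field_simps)
  qed
  ultimately show ?thesis by simp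
qed

text \<open>Integration by parts mirrors Gamma (z + 1) = z Gamma z. The boundary term dies out
  doubly exponentially, since e^t = - e^X on the line Im t = \<pi>.\<close>

lemma hankel_tendsto:
  assumes \<nu>: "0 < \<nu>" "\<nu> < (1::real)"
    and K: "\<And>t. (K has_field_derivative hankel_integrand (\<nu> + real k) t) (at t)" "\<And>t. K (cnj t) = cnj (K t)"
  shows "((\<lambda>X. Im (K (Complex X pi))) \<longlongrightarrow> pi * rGamma (\<nu> + real k)) at_top"
  using K
proof (induction k arbitrary: K)
  case 0
  then show ?case using hankel_tendsto_base[of \<nu> K] \<nu> by simp
next
  case (Suc k)
  let ?z = "\<nu> + real k"
  obtain K0 where K0: "\<And>t. (K0 has_field_derivative hankel_integrand ?z t) (at t)" "\<And>t. K0 (cnj t) = cnj (K0 t)"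
    using entire_real_primitive[OF hankel_integrand_holomorphic hankel_integrand_cnj] by metis
  \<comment> \<open>\<open>exp (exp t - z * t)\<close> has derivative
    \<open>hankel_integrand z t - z * hankel_integrand (z + 1) t\<close>, so \<open>D\<close> is
    constant; being real at 0, it has imaginary part 0 everywhere.\<close>
  define D where "D t = K0 t - of_real ?z * K t - exp (exp t - of_real ?z * t)" for t
  have "(D has_field_derivative 0) (at t)" for t
  proof -
    have "(D has_field_derivative hankel_integrand ?z t - of_real ?z * hankel_integrand (\<nu> + real (Suc k)) t
        - exp (exp t - of_real ?z * t) * (exp t - of_real ?z)) (at t)"
      unfolding D_def by (auto intro!: derivative_eq_intros K0 Suc.prems(1)) 
    also have "hankel_integrand ?z t - of_real ?z * hankel_integrand (\<nu> + real (Suc k)) t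
        - exp (exp t - of_real ?z * t) * (exp t - of_real ?z) = 0"
      by (simp add: hankel_integrand_def exp_add exp_diff exp_minus field_simps)
    finally show ?thesis .
  qed
  then have Dc: "D t = D 0" for t
    using has_field_derivative_zero_constant[of UNIV D] by (metis UNIV_I convex_UNIV)
  have Im0: "Im (F 0) = 0" if "\<And>t. F (cnj t) = cnj (F t)" for F :: "complex \<Rightarrow> complex"
    using that[of 0] by (simp add: complex_eq_iff)
  have "Im (D 0) = 0" unfolding D_def using Im0[of K0] Im0[of K] K0(2) Suc.prems(2) by (simp add: Im_exp)
  then have ImD: "Im (D (Complex X pi)) = 0" for X using Dc by metis
  let ?r = "\<lambda>X. exp (- exp X - ?z * X) * sin (pi * ?z)"
  have eq: "Im (K (Complex X pi)) = (Im (K0 (Complex X pi)) + ?r X) / ?z" for X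
  proof -
    have "exp (exp (Complex X pi) - of_real ?z * Complex X pi) = exp (Complex (- exp X - ?z * X) (- (pi * ?z)))"
      by (intro arg_cong[of _ _ exp]) (simp add: complex_eq_iff Re_exp Im_exp)
    then have "Im (exp (exp (Complex X pi) - of_real ?z * Complex X pi)) = - ?r X" by (simp add: Im_exp)
    moreover have "Im (D (Complex X pi)) = Im (K0 (Complex X pi)) - ?z * Im (K (Complex X pi)) - Im (exp (exp (Complex X pi) - of_real ?z * Complex X pi))"
      by (simp add: D_def del: of_real_add)
    ultimately have "?z * Im (K (Complex X pi)) = Im (K0 (Complex X pi)) + ?r X"
      using ImD[of X] by linarith
    moreover have "?z \<noteq> 0" using \<nu> by linarith
    ultimately show ?thesis by (metis nonzero_mult_div_cancel_left)
  qed
  have "(?r \<longlongrightarrow> 0) at_top"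
  proof (rule Lim_null_comparison)
    show "\<forall>\<^sub>F X in at_top. norm (?r X) \<le> exp (- X)"
      using eventually_ge_at_top[of 0]
    proof eventually_elim
      case (elim X)
      have "exp (- exp X - ?z * X) \<le> exp (- X)"
      proof -
        have "X \<le> exp X" using exp_ge_add_one_self[of X] by linarith
        moreover have "?z * X \<ge> 0" using elim \<nu> by simp
        ultimately show ?thesis by simp
      qed
      moreover have "\<bar>sin (pi * ?z)\<bar> \<le> 1" by simp
      ultimately have "exp (- exp X - ?z * X) * \<bar>sin (pi * ?z)\<bar> \<le> exp (- X) * 1"
        by (intro mult_mono) auto
      then show ?case by (simp add: abs_mult)
    qed
    show "((\<lambda>X::real. exp (- X)) \<longlongrightarrow> 0) at_top"
      by (rule filterlim_compose[OF exp_at_bot filterlim_uminus_at_bot_at_top])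
  qed
  then have "((\<lambda>X. Im (K (Complex X pi))) \<longlongrightarrow> (pi * rGamma ?z + 0) / ?z) at_top"
    unfolding eq using Suc.IH[OF K0] \<nu> by (intro tendsto_intros) auto
  moreover have "(pi * rGamma ?z + 0) / ?z = pi * rGamma (\<nu> + real (Suc k))"
    using rGamma_plus1[of ?z] \<nu> by (simp add: field_simps add_ac)
  ultimately show ?case by simp
qed

text \<open>The error is later multiplied by the coefficients of the Bessel series and summed, so
  its rate must be the same for all orders. With orders from \<nu> + 1 on, the exponent (1 - z) X is
  at most 0 for X >= 0, and the derivative along Im t = \<pi> is at most e^(-X).\<close>

lemma hankel_error:
  assumes \<nu>: "0 < \<nu>" "\<nu> < (1::real)"
    and K: "\<And>t. (K has_field_derivative hankel_integrand (\<nu> + real (Suc k)) t) (at t)" "\<And>t. K (cnj t) = cnj (K t)"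
    and X: "X \<ge> 0"
  shows "\<bar>Im (K (Complex X pi)) - pi * rGamma (\<nu> + real (Suc k))\<bar> \<le> exp (- X)"
proof -
  let ?h = "\<lambda>X. Im (K (Complex X pi))"
  let ?z = "\<nu> + real (Suc k)"
  have d: "(?h has_real_derivative exp (- exp X + (1 - ?z) * X) * sin (pi * ?z)) (at X)" for X
    using DERIV_horizontal(1)[OF K(1), of pi X] by (simp only: Im_hankel_integrand)
  have db: "\<bar>exp (- exp Y + (1 - ?z) * Y) * sin (pi * ?z)\<bar> \<le> exp (- Y)" if "Y \<ge> 0" for Y
  proof -
    have "(\<nu> + real k) * Y \<ge> 0" using that \<nu> by simp
    moreover have "Y \<le> exp Y" using exp_ge_add_one_self[of Y] by linarith
    ultimately have "- exp Y + (1 - ?z) * Y \<le> - Y" by (simp add: algebra_simps)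
    then have "exp (- exp Y + (1 - ?z) * Y) \<le> exp (- Y)" by simp
    moreover have "\<bar>sin (pi * ?z)\<bar> \<le> 1" by simp
    ultimately have "exp (- exp Y + (1 - ?z) * Y) * \<bar>sin (pi * ?z)\<bar> \<le> exp (- Y) * 1"
      by (intro mult_mono) auto
    then show ?thesis by (simp only: abs_mult abs_exp_cancel mult_1_right)
  qed
  have "?h Y - ?h X \<le> exp (-X) - exp (-Y) \<and> ?h X - ?h Y \<le> exp (-X) - exp (-Y)" if "Y \<ge> X" for Y
  proof -
    have e: "((\<lambda>x. exp (- x)) has_real_derivative - exp (- x)) (at x)" for x :: real
      by (auto intro!: derivative_eq_intros)
    have "?h Y + exp (-Y) \<le> ?h X + exp (-X)"
    proof (rule DERIV_nonpos_imp_nonincreasing[OF that])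
      fix x assume "X \<le> x" "x \<le> Y"
      then show "\<exists>y. ((\<lambda>x. ?h x + exp (- x)) has_real_derivative y) (at x) \<and> y \<le> 0"
        using DERIV_add[OF d e, of x] db[of x] X by (intro exI conjI) (assumption, linarith)
    qed
    moreover have "?h X - exp (-X) \<le> ?h Y - exp (-Y)"
    proof (rule DERIV_nonneg_imp_nondecreasing[OF that])
      fix x assume "X \<le> x" "x \<le> Y"
      then show "\<exists>y. ((\<lambda>x. ?h x - exp (- x)) has_real_derivative y) (at x) \<and> y \<ge> 0"
        using DERIV_diff[OF d e, of x] db[of x] X by (intro exI conjI) (assumption, linarith)
    qed
    ultimately show ?thesis by linarith
  qed
  then have ev: "\<forall>\<^sub>F Y in at_top. \<bar>?h X - ?h Y\<bar> \<le> exp (- X)"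
    by (intro eventually_at_top_linorderI[of X]) (smt (verit) exp_gt_zero)
  have "((\<lambda>Y. \<bar>?h X - ?h Y\<bar>) \<longlongrightarrow> \<bar>?h X - pi * rGamma ?z\<bar>) at_top"
    by (intro tendsto_intros hankel_tendsto[OF \<nu> K])
  from tendsto_upperbound[OF this ev] show ?thesis by simp
qed

text \<open>Schlaefli's integral in terms of a primitive. Its integrand is expanded so that each
  term is a Hankel integrand of order \<nu> + k + 1, which reproduces the defining series of the
  Bessel function.\<close>

lemma bessel_J_tendsto:
  assumes \<nu>: "0 < \<nu>" "\<nu> < (1::real)"
    and P: "\<And>t. (P has_field_derivative exp (of_real \<nu> * (sinh t - t))) (at t)" "\<And>t. P (cnj t) = cnj (P t)"
  obtains J where "bessel_J (of_real \<nu>) (of_real \<nu>) = of_real J"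
    "((\<lambda>X. Im (P (Complex X pi)) / pi) \<longlongrightarrow> J) at_top"
proof -
  \<comment> \<open>Translation by \<open>L\<close> turns \<nu> sinh t into e^t - (\<nu>/2)^2
    e^(-t). The factor exp (- (\<nu>/2)^2 e^(-t)) is the one that is expanded.\<close>
  define L where "L = ln (\<nu> / 2)"
  have L: "exp L = \<nu> / 2" "exp (\<nu> * L) = (\<nu> / 2) powr \<nu>" using \<nu> by (simp_all add: L_def powr_def)
  have "\<exists>K. (\<forall>t. (K has_field_derivative hankel_integrand (\<nu> + real (Suc k)) t) (at t)) \<and> (\<forall>t. K (cnj t) = cnj (K t))" for k
    using entire_real_primitive[OF hankel_integrand_holomorphic hankel_integrand_cnj] by metis
  then obtain K where K: "\<And>k t. (K k has_field_derivative hankel_integrand (\<nu> + real (Suc k)) t) (at t)"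
      "\<And>k t. K k (cnj t) = cnj (K k t)"
    by metis
  define h where "h k X = Im (K k (Complex X pi))" for k X
  define c where "c k = (- ((\<nu> / 2)\<^sup>2)) ^ k / fact k" for k
  define g where "g k = rGamma (\<nu> + real (Suc k))" for k
  have hg: "\<bar>h k X - pi * g k\<bar> \<le> exp (- X)" if "X \<ge> 0" for k X
    unfolding h_def g_def by (rule hankel_error[OF \<nu> K that])
  have c_abs: "\<bar>c k\<bar> = ((\<nu> / 2)\<^sup>2) ^ k / fact k" for k
    using \<nu> by (simp add: c_def power_abs)
  have c_sum: "summable (\<lambda>k. \<bar>c k\<bar>)"
    unfolding c_abs using summable_exp[of "(\<nu> / 2)\<^sup>2"] by (simp only: divide_inverse mult.commute)
  \<comment> \<open>For fixed X the segment is compact and the expansion converges uniformly on it,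
    so sum and integral may be exchanged. The limit in X is taken only afterwards, with the error
    bound uniform in k.\<close>
  have ch: "(\<lambda>k. c k * h k (X + L)) sums (exp (- \<nu> * L) * Im (P (Complex X pi)))" for X
  proof -
    let ?A = "{-pi..pi}"
    let ?t = "\<lambda>v. Complex (X + L) v"
    let ?f = "\<lambda>k v. of_real (c k) * hankel_integrand (\<nu> + real (Suc k)) (?t v)"
    let ?s = "\<lambda>v. of_real (exp (- \<nu> * L)) * exp (of_real \<nu> * (sinh (Complex X v) - Complex X v))"
    have sums: "(\<lambda>k. ?f k v) sums ?s v" for v
    proof -
      have e: "hankel_integrand (\<nu> + real (Suc k)) (?t v) = exp (exp (?t v) - of_real \<nu> * ?t v) * exp (- ?t v) ^ k" for k
        by (simp add: hankel_integrand_def exp_add[symmetric] exp_of_nat_mult[symmetric] algebra_simps)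
      have "(\<lambda>k. (- of_real ((\<nu> / 2)\<^sup>2) * exp (- ?t v)) ^ k /\<^sub>R fact k) sums exp (- of_real ((\<nu> / 2)\<^sup>2) * exp (- ?t v))"
        by (rule exp_converges)
      from sums_mult[OF this, of "exp (exp (?t v) - of_real \<nu> * ?t v)"]
      have "(\<lambda>k. ?f k v) sums (exp (exp (?t v) - of_real \<nu> * ?t v) * exp (- of_real ((\<nu> / 2)\<^sup>2) * exp (- ?t v)))"
      proof (rule sums_cong[THEN iffD1, rotated])
        fix k
        have "complex_of_real (c k) = (- of_real ((\<nu> / 2)\<^sup>2)) ^ k / fact k"
          by (simp add: c_def)
        then show "exp (exp (?t v) - of_real \<nu> * ?t v) * ((- of_real ((\<nu> / 2)\<^sup>2) * exp (- ?t v)) ^ k /\<^sub>R fact k) = ?f k v"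
          unfolding e power_mult_distrib by (simp only: scaleR_conv_of_real of_real_inverse of_real_fact divide_inverse mult_ac)
      qed
      also have "exp (exp (?t v) - of_real \<nu> * ?t v) * exp (- of_real ((\<nu> / 2)\<^sup>2) * exp (- ?t v)) = ?s v"
      proof -
        have t: "?t v = Complex X v + of_real L" by (simp add: complex_eq_iff)
        have eL: "exp (complex_of_real L) = of_real \<nu> / 2" using L(1) by (metis exp_of_real of_real_divide of_real_numeral)
        have eL': "exp (- complex_of_real L) = 2 / of_real \<nu>" by (simp add: exp_minus eL)
        have e1: "exp (?t v) = of_real \<nu> / 2 * exp (Complex X v)"
          by (simp only: t exp_add eL mult.commute)
        have e2: "of_real ((\<nu> / 2)\<^sup>2) * exp (- ?t v) = of_real \<nu> / 2 * exp (- Complex X v)"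
          unfolding t minus_add_distrib exp_add eL' using \<nu> by (simp add: power2_eq_square field_simps)
        show ?thesis
          unfolding mult_minus_left exp_add[symmetric] e2 exp_of_real[symmetric]
          unfolding e1 unfolding t sinh_field_def
          by (intro arg_cong[of _ _ exp]) (simp add: algebra_simps)
      qed
      finally show ?thesis .
    qed
    define M where "M k = \<bar>c k\<bar> * (exp (exp (X + L) - \<nu> * (X + L)) * exp (- (X + L)) ^ k)" for k
    have Mb: "norm (?f k v) \<le> M k" for k v
    proof -
      have "norm (hankel_integrand (\<nu> + real (Suc k)) (?t v)) \<le> exp (exp (X + L) + (1 - (\<nu> + real (Suc k))) * (X + L))"
        by (rule norm_hankel_integrand_le) simp
      also have "\<dots> = exp (exp (X + L) - \<nu> * (X + L)) * exp (- (X + L)) ^ k"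
        unfolding exp_of_nat_mult[symmetric] exp_add[symmetric]
        by (intro arg_cong[of _ _ exp]) (simp add: algebra_simps)
      finally show ?thesis unfolding M_def norm_mult by (intro mult_mono) auto
    qed
    have Ms: "summable M"
    proof -
      have "summable (\<lambda>k. exp (exp (X + L) - \<nu> * (X + L)) * (inverse (fact k) * ((\<nu> / 2)\<^sup>2 * exp (- (X + L))) ^ k))"
        by (intro summable_mult summable_exp)
      then show ?thesis unfolding M_def c_abs by (simp only: power_mult_distrib divide_inverse mult_ac)
    qed
    have "uniform_limit ?A (\<lambda>n v. \<Sum>i<n. ?f i v) (\<lambda>v. \<Sum>i. ?f i v) sequentially"
      by (rule Weierstrass_m_test[where M=M]) (rule Mb, rule Ms)
    moreover have "(\<lambda>v. \<Sum>i. ?f i v) = ?s" by (intro ext) (rule sums_unique[OF sums, symmetric])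
    ultimately have ul: "uniform_limit ?A (\<lambda>n v. \<Sum>i<n. ?f i v) ?s sequentially" by simp
    have cont: "continuous_on ?A (\<lambda>v. \<Sum>i<n. ?f i v)" for n
      unfolding hankel_integrand_def Complex_eq by (intro continuous_intros)
    obtain I' J' where
      IJ: "\<And>n. ((\<lambda>v. \<Sum>i<n. ?f i v) has_integral I' n) ?A" "(?s has_integral J') ?A" "I' \<longlonglongrightarrow> J'"
      by (rule uniform_limit_integral[OF ul cont sequentially_bot]) (rule that)
    have hsum: "((\<lambda>v. \<Sum>i<n. ?f i v) has_integral (\<Sum>i<n. of_real (c i) * of_real (2 * h i (X + L)))) ?A" for n
      unfolding h_def by (intro has_integral_sum has_integral_mult_right vertical_integral_primitive K) auto
    then have I': "I' n = of_real (2 * (\<Sum>i<n. c i * h i (X + L)))" for n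
      using has_integral_unique[OF IJ(1) hsum] by (simp add: sum_distrib_left mult.left_commute)
    have "(?s has_integral of_real (exp (- \<nu> * L)) * of_real (2 * Im (P (Complex X pi)))) ?A"
      by (intro has_integral_mult_right vertical_integral_primitive P)
    then have J': "J' = of_real (2 * (exp (- \<nu> * L) * Im (P (Complex X pi))))"
      using has_integral_unique[OF IJ(2)] by simp
    have "(\<lambda>n. 2 * (\<Sum>i<n. c i * h i (X + L))) \<longlonglongrightarrow> 2 * (exp (- \<nu> * L) * Im (P (Complex X pi)))"
      using IJ(3) unfolding I' J' by (simp only: tendsto_of_real_iff)
    from tendsto_mult_left[OF this, of "1/2"] show ?thesis by (simp add: sums_def)
  qed
  have cg: "summable (\<lambda>k. c k * g k)"
  proof -
    \<comment> \<open>Summability of \<open>c k * g k\<close> is inherited from the exact identity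
      at X + L = 0: replacing \<open>h k 0\<close> by its limit costs at most 1 in each
      order.\<close>
    have s1: "summable (\<lambda>k. c k * h k 0)" using sums_summable[OF ch[of "- L"]] by simp
    have s2: "summable (\<lambda>k. c k * (h k 0 - pi * g k))"
    proof (rule summable_comparison_test')
      show "summable (\<lambda>k. \<bar>c k\<bar> * 1)" using c_sum by simp
      show "norm (c k * (h k 0 - pi * g k)) \<le> \<bar>c k\<bar> * 1" for k
        unfolding norm_mult using hg[of 0 k] by (intro mult_mono) auto
    qed
    have "summable (\<lambda>k. c k * h k 0 - c k * (h k 0 - pi * g k))" by (rule summable_diff[OF s1 s2])
    also have "(\<lambda>k. c k * h k 0 - c k * (h k 0 - pi * g k)) = (\<lambda>k. pi * (c k * g k))"
      by (simp add: algebra_simps)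
    finally show ?thesis by simp
  qed
  have lim: "((\<lambda>X. exp (- \<nu> * L) * Im (P (Complex X pi))) \<longlongrightarrow> pi * (\<Sum>k. c k * g k)) at_top"
  proof (rule Lim_transform2[OF tendsto_const])
    show "((\<lambda>X. pi * (\<Sum>k. c k * g k) - exp (- \<nu> * L) * Im (P (Complex X pi))) \<longlongrightarrow> 0) at_top"
    proof (rule Lim_null_comparison)
      show "\<forall>\<^sub>F X in at_top. norm (pi * (\<Sum>k. c k * g k) - exp (- \<nu> * L) * Im (P (Complex X pi))) \<le> (\<Sum>k. \<bar>c k\<bar>) * exp (- (X + L))"
        using eventually_ge_at_top[of "- L"]
      proof eventually_elim
        case (elim X)
        have s: "(\<lambda>k. pi * (c k * g k) - c k * h k (X + L)) sums (pi * (\<Sum>k. c k * g k) - exp (- \<nu> * L) * Im (P (Complex X pi)))"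
          by (intro sums_diff sums_mult summable_sums cg ch)
        have b1: "norm (pi * (c k * g k) - c k * h k (X + L)) \<le> \<bar>c k\<bar> * exp (- (X + L))" for k
        proof -
          have "pi * (c k * g k) - c k * h k (X + L) = - c k * (h k (X + L) - pi * g k)" by (simp add: algebra_simps)
          then show ?thesis using hg[of "X + L" k] elim by (simp add: abs_mult mult_left_mono)
        qed
        have ss: "summable (\<lambda>k. \<bar>c k\<bar> * exp (- (X + L)))" using c_sum by (rule summable_mult2)
        have sn: "summable (\<lambda>k. norm (pi * (c k * g k) - c k * h k (X + L)))"
          by (rule summable_comparison_test'[OF ss]) (use b1 in auto)
        have "norm (\<Sum>k. pi * (c k * g k) - c k * h k (X + L)) \<le> (\<Sum>k. norm (pi * (c k * g k) - c k * h k (X + L)))"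
          by (rule summable_norm[OF sn])
        also have "\<dots> \<le> (\<Sum>k. \<bar>c k\<bar> * exp (- (X + L)))" by (rule suminf_le[OF b1 sn ss])
        also have "\<dots> = (\<Sum>k. \<bar>c k\<bar>) * exp (- (X + L))" by (rule suminf_mult2[OF c_sum, symmetric])
        finally show ?case using sums_unique[OF s] by simp
      qed
      have "((\<lambda>X. exp (- X) * exp (- L)) \<longlongrightarrow> 0 * exp (- L)) at_top"
        by (intro tendsto_mult tendsto_const filterlim_compose[OF exp_at_bot] filterlim_uminus_at_bot_at_top)
      then have "((\<lambda>X. exp (- (X + L))) \<longlongrightarrow> 0) at_top" by (simp add: exp_add[symmetric])
      then show "((\<lambda>X. (\<Sum>k. \<bar>c k\<bar>) * exp (- (X + L))) \<longlongrightarrow> 0) at_top"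
        by (rule tendsto_mult_right_zero)
    qed
  qed
  define J where "J = exp (\<nu> * L) * (\<Sum>k. c k * g k)"
  have "((\<lambda>X. Im (P (Complex X pi)) / pi) \<longlongrightarrow> J) at_top"
    using tendsto_mult_left[OF lim, of "exp (\<nu> * L) / pi"]
    by (simp add: J_def exp_minus mult.assoc[symmetric])
  moreover have "bessel_J (of_real \<nu>) (of_real \<nu>) = of_real J"
  proof -
    have "(\<lambda>k. complex_of_real (c k * g k)) sums of_real (\<Sum>k. c k * g k)"
      by (intro sums_of_real summable_sums cg)
    moreover have "complex_of_real (c k * g k) = (- 1) ^ k * ((of_real \<nu>)\<^sup>2 / 4) ^ k * rGamma (of_real \<nu> + of_nat k + 1) / fact k" for k
    proof -
      have "complex_of_real (g k) = rGamma (of_real \<nu> + of_nat k + 1)"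
        unfolding g_def rGamma_complex_of_real[symmetric] by (simp add: add_ac)
      moreover have "complex_of_real (c k) = (- 1) ^ k * ((of_real \<nu>)\<^sup>2 / 4) ^ k / fact k"
        unfolding c_def power_minus[of "(\<nu> / 2)\<^sup>2" k] by (simp add: power_divide)
      ultimately show ?thesis by simp
    qed
    ultimately have "(\<Sum>k. (- 1) ^ k * ((of_real \<nu>)\<^sup>2 / 4) ^ k * rGamma (of_real \<nu> + of_nat k + 1) / fact k) = complex_of_real (\<Sum>k. c k * g k)"
      by (simp add: sums_iff)
    moreover have "(complex_of_real \<nu> / 2) powr of_real \<nu> = of_real ((\<nu> / 2) powr \<nu>)"
      using \<nu> powr_of_real[of "\<nu> / 2" \<nu>] by simp
    ultimately show ?thesis unfolding bessel_J_def J_def L(2) by simp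
  qed
  ultimately show ?thesis using that by blast
qed

section \<open>The phase function and its cube root\<close>

lemma Re_sinh: "Re (sinh t) = sinh (Re t) * cos (Im t)"
  by (simp add: sinh_field_def Re_exp algebra_simps diff_divide_distrib)

lemma Im_sinh: "Im (sinh t) = cosh (Re t) * sin (Im t)"
  by (simp add: sinh_field_def cosh_field_def Im_exp algebra_simps add_divide_distrib)

lemma cnj_sinh: "cnj (sinh t) = sinh (cnj t)"
  by (simp add: complex_eq_iff Re_sinh Im_sinh)

definition phase :: "complex \<Rightarrow> complex" where
  "phase t = sinh t - t"

lemma Re_phase: "Re (phase t) = sinh (Re t) * cos (Im t) - Re t"
  by (simp add: phase_def Re_sinh)

lemma Im_phase: "Im (phase t) = cosh (Re t) * sin (Im t) - Im t"
  by (simp add: phase_def Im_sinh)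

lemma phase_cnj: "phase (cnj t) = cnj (phase t)"
  by (simp add: phase_def cnj_sinh)

lemma phase_minus: "phase (- t) = - phase t"
  by (simp add: phase_def)

lemma DERIV_phase: "(phase has_field_derivative cosh t - 1) (at t within A)"
  unfolding phase_def[abs_def] by (auto intro!: derivative_eq_intros)

lemma phase_holomorphic [holomorphic_intros]: "phase holomorphic_on A"
  using DERIV_phase holomorphic_on_def field_differentiable_def by blast

text \<open>The margin 1/2 makes the closed strip between the saddles interior, while
  \<open>phase\<close> still vanishes only at 0. The derivative of the cube root is zero at the
  saddles, but the root itself stays holomorphic across them.\<close>

definition strip :: "complex set" where
  "strip = {t. \<bar>Im t\<bar> < 2 * pi + 1/2}"

lemma strip_eq: "strip = {t. Im t < 2 * pi + 1/2} \<inter> {t. Im t > - (2 * pi + 1/2)}"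
  by (auto simp: strip_def abs_less_iff)

lemma open_strip: "open strip"
  unfolding strip_eq by (intro open_Int open_halfspace_Im_lt open_halfspace_Im_gt)

lemma convex_strip: "convex strip"
  unfolding strip_eq by (intro convex_Int convex_halfspace_Im_lt convex_halfspace_Im_gt)

lemma zero_in_strip: "0 \<in> strip"
  by (simp add: strip_def add_pos_pos)

lemma strip_cnj: "t \<in> strip \<Longrightarrow> cnj t \<in> strip" and strip_minus: "t \<in> strip \<Longrightarrow> - t \<in> strip"
  by (auto simp: strip_def)

section \<open>Inequalities for hyperbolic and circular functions, and where the phase is
  real\<close>

lemma sinh_ge_mult_cosh_half:
  assumes "x \<ge> (0::real)"
  shows "x * cosh (x / 2) \<le> sinh x"
proof -
  have "x / 2 \<le> sinh (x / 2)"
    using real_le_x_sinh[of "x/2"] assms by (simp add: sinh_field_def exp_minus)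
  then have "x * cosh (x / 2) \<le> 2 * sinh (x / 2) * cosh (x / 2)"
    by (intro mult_right_mono) auto
  also have "\<dots> = sinh x" using sinh_double[of "x/2"] by simp
  finally show ?thesis .
qed

lemma sinh_gt_self:
  assumes "x > (0::real)"
  shows "x < sinh x"
proof -
  have "cosh (x / 2) > 1" using cosh_real_ge_1[of "x/2"] cosh_real_one_iff[of "x/2"] assms by linarith
  then have "x * 1 < x * cosh (x / 2)" using assms by (intro mult_strict_left_mono)
  then show ?thesis using sinh_ge_mult_cosh_half[of x] assms by linarith
qed

lemma sinh_le_mult_cosh:
  assumes "x \<ge> (0::real)"
  shows "sinh x \<le> x * cosh x"
proof -
  have "0 * cosh 0 - sinh 0 \<le> x * cosh x - sinh x"
  proof (rule DERIV_nonneg_imp_nondecreasing[OF assms])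
    fix y :: real assume "0 \<le> y"
    have "((\<lambda>y. y * cosh y - sinh y) has_real_derivative y * sinh y) (at y)"
      by (auto intro!: derivative_eq_intros)
    then show "\<exists>D. ((\<lambda>y. y * cosh y - sinh y) has_real_derivative D) (at y) \<and> 0 \<le> D"
      using \<open>0 \<le> y\<close> by (intro exI[of _ "y * sinh y"]) auto
  qed
  then show ?thesis by simp
qed

lemma mult_cos_less_sin:
  assumes "0 < v" "v < pi"
  shows "v * cos v < sin v"
proof -
  have "sin 0 - 0 * cos 0 < sin v - v * cos v"
  proof (rule DERIV_pos_imp_increasing_open[OF assms(1)])
    fix y :: real assume y: "0 < y" "y < v"
    have "((\<lambda>y. sin y - y * cos y) has_real_derivative y * sin y) (at y)"
      by (auto intro!: derivative_eq_intros)
    moreover have "y * sin y > 0" using y assms by (intro mult_pos_pos sin_gt_zero) auto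
    ultimately show "\<exists>D. ((\<lambda>y. sin y - y * cos y) has_real_derivative D) (at y) \<and> 0 < D" by blast
  qed (intro continuous_intros)
  then show ?thesis by simp
qed

text \<open>A real phase off the real axis means cosh x sin v = v, and the sign of the phase tells
  the sheets apart. For v < \<pi> the inequality v cos v < sin v makes it negative; just above 2
  \<pi> the sine is small, so x is large and sinh x cos v exceeds x.\<close>

lemma phase_real_values:
  assumes v: "0 < Im t" "Im t < 2 * pi + 1/2" and x: "Re t \<ge> 0" and im: "Im (phase t) = 0"
  shows "(Im t < pi \<and> Re t > 0 \<and> Re (phase t) < 0) \<or> (2 * pi < Im t \<and> Re (phase t) > 0)"
proof -
  obtain x v where t: "t = Complex x v" by (cases t)
  have im: "cosh x * sin v = v" and v: "0 < v" "v < 2 * pi + 1/2" and x: "x \<ge> 0"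
    using assms by (auto simp: t Im_phase)
  have ch: "cosh x > 0" by simp
  have sv: "sin v > 0" using im v(1) ch by (metis zero_less_mult_pos)
  have x0: "x > 0"
  proof (rule ccontr)
    assume "\<not> x > 0"
    then have "sin v = v" using im x by auto
    moreover have "v \<le> 1" using \<open>sin v = v\<close> sin_le_one[of v] by linarith
    moreover have "sin v = 2 * sin (v / 2) * cos (v / 2)" using sin_double[of "v / 2"] by simp
    moreover have "cos (v / 2) < 1" using cos_monotone_0_pi[of 0 "v / 2"] v \<open>v \<le> 1\<close> pi_gt3 by simp
    moreover have "cos (v / 2) > 0" using v \<open>v \<le> 1\<close> pi_gt3 by (intro cos_gt_zero) auto
    moreover have "sin (v / 2) \<le> v / 2" using v by (intro sin_x_le_x) auto
    then have "2 * sin (v / 2) * cos (v / 2) \<le> v * cos (v / 2)" using \<open>cos (v / 2) > 0\<close> by (intro mult_right_mono) auto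
    moreover have "v * cos (v / 2) < v * 1" using \<open>cos (v / 2) < 1\<close> v by (intro mult_strict_left_mono)
    ultimately show False by linarith
  qed
  consider "v < pi" | "pi \<le> v" "v \<le> 2 * pi" | "2 * pi < v" by linarith
  then show ?thesis
  proof cases
    case 1
    have "v * cos v < sin v" using mult_cos_less_sin v 1 by blast
    also have "sin v = v / cosh x" using im by (simp add: field_simps)
    finally have "cos v < 1 / cosh x" using v by (simp add: field_simps)
    then have "sinh x * cos v < sinh x * (1 / cosh x)" using x0 by (intro mult_strict_left_mono) auto
    also have "\<dots> \<le> x" using sinh_le_mult_cosh[of x] x by (simp add: field_simps)
    finally show ?thesis using 1 x0 by (simp add: t Re_phase)
  next
    case 2
    then have "sin v \<le> 0" using sin_le_zero[of v] by (cases "v = 2 * pi") auto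
    then show ?thesis using sv by linarith
  next
    case 3
    define u where "u = v - 2 * pi"
    have u: "0 < u" "u < 1/2" using 3 v by (auto simp: u_def)
    have sc: "sin v = sin u" "cos v = cos u"
      using sin_periodic[of u] cos_periodic[of u] by (auto simp: u_def)
    have "sin u < 1/2" using sin_x_le_x[of u] u by linarith
    \<comment> \<open>From cosh x sin v = v with v > 6 and sin v < 1/2; the resulting cosh (x/2) > 2
      compensates the factor cos v >= 1/2.\<close>
    have "12 < 2 * v" using 3 pi_gt3 by linarith
    also have "\<dots> \<le> cosh x"
    proof -
      have "v \<le> cosh x * (1/2)" using im sc \<open>sin u < 1/2\<close> by (metis ch less_imp_le mult_left_mono)
      then show ?thesis by simp
    qed
    finally have c12: "cosh x > 12" .
    have "2 * (cosh (x / 2))\<^sup>2 = cosh x + 1" using cosh_double_cosh[of "x/2"] by simp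
    then have "(cosh (x / 2))\<^sup>2 > 2\<^sup>2" using c12 by simp
    then have ch2: "cosh (x / 2) > 2" by (rule power2_less_imp_less) simp
    have "cos (1/2) \<le> cos u" using u pi_gt3 by (intro cos_monotone_0_pi_le) auto
    moreover have "cos (1/2) \<ge> (1/2::real)"
    proof -
      have "cos (1/2::real) \<ge> cos (pi/3)" using pi_gt3 by (intro cos_monotone_0_pi_le) auto
      then show ?thesis by (simp add: cos_60)
    qed
    ultimately have cu: "cos v \<ge> 1/2" using sc by simp
    have "x * 2 < x * cosh (x / 2)" using ch2 x0 by (intro mult_strict_left_mono)
    then have "x * 2 < sinh x" using sinh_ge_mult_cosh_half[of x] x by linarith
    moreover have "sinh x * (1/2) \<le> sinh x * cos v" using cu x by (intro mult_left_mono) auto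
    ultimately show ?thesis using 3 by (simp add: t Re_phase)
  qed
qed

text \<open>Reflection into the first quadrant keeps a zero a zero. Off the real axis the strict
  signs in \<open>phase_real_values\<close> exclude it, and on the real axis sinh x > x
  does.\<close>

lemma phase_eq_0_iff:
  assumes "t \<in> strip"
  shows "phase t = 0 \<longleftrightarrow> t = 0"
proof
  assume 0: "phase t = 0"
  let ?t = "Complex \<bar>Re t\<bar> \<bar>Im t\<bar>"
  have re: "sinh (Re t) * cos (Im t) = Re t" and im: "cosh (Re t) * sin (Im t) = Im t"
    using 0 Re_phase[of t] Im_phase[of t] by simp_all
  have "Re (phase ?t) = \<bar>sinh (Re t)\<bar> * cos (Im t) - \<bar>Re t\<bar>" by (simp add: Re_phase)
  also have "\<bar>sinh (Re t)\<bar> * cos (Im t) = \<bar>Re t\<bar>"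
    using re by (auto simp: abs_if)
  finally have re': "Re (phase ?t) = 0" by simp
  have im': "Im (phase ?t) = 0" using im by (auto simp: Im_phase abs_if)
  show "t = 0"
  proof (cases "Im t = 0")
    case True
    then have "sinh \<bar>Re t\<bar> = \<bar>Re t\<bar>" using re by simp
    then have "Re t = 0" using sinh_gt_self[of "\<bar>Re t\<bar>"] by (metis less_irrefl zero_less_abs_iff)
    then show ?thesis using True by (simp add: complex_eq_iff)
  next
    case False
    then show ?thesis using phase_real_values[of ?t] re' im' assms by (auto simp: strip_def)
  qed
qed (simp add: phase_def)

text \<open>The quotient of two such functions takes finitely many values, hence is constant on a
  connected set. Branches of cube roots are identified in this way: by one common value.\<close>

lemma cube_root_unique:
  fixes f g :: "'a::topological_space \<Rightarrow> complex"
  assumes "connected A" "continuous_on A f" "continuous_on A g"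
    and eq: "\<And>x. x \<in> A \<Longrightarrow> f x ^ 3 = g x ^ 3" and nz: "\<And>x. x \<in> A \<Longrightarrow> g x \<noteq> 0"
    and a: "a \<in> A" "f a = g a" and x: "x \<in> A"
  shows "f x = g x"
proof -
  have "(\<lambda>x. f x / g x) ` A \<subseteq> {z. z ^ 3 = 1}"
    using eq nz by (auto simp: power_divide)
  moreover have "finite {z::complex. z ^ 3 = 1}" by (rule finite_roots_unity) simp
  ultimately have "(\<lambda>x. f x / g x) constant_on A"
    using assms by (intro continuous_finite_range_constant continuous_on_divide) (auto intro: finite_subset)
  then obtain y where y: "\<forall>x\<in>A. f x / g x = y" unfolding constant_on_def by blast
  have "y = 1" using bspec[OF y a(1)] nz[OF a(1)] a(2) by simp
  then show ?thesis using bspec[OF y x] nz[OF x] by simp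
qed

text \<open>Repeated division by t - a: the quotient extends holomorphically to all of S, and in the
  Leibniz rule at a only the first derivative of t - a survives, which shifts the coefficients by
  one. The remainder has to be holomorphic on all of S, not just near a, to serve in a residue
  argument.\<close>

lemma holomorphic_taylor_factor:
  assumes "open S" "a \<in> S" "f holomorphic_on S"
  shows "\<exists>g. g holomorphic_on S \<and>
    (\<forall>t\<in>S. f t = (\<Sum>k<n. (deriv ^^ k) f a / fact k * (t - a) ^ k) + (t - a) ^ n * g t)"
  using assms(3)
proof (induction n arbitrary: f)
  case 0
  then show ?case by (intro exI[of _ f]) auto
next
  case (Suc n)
  define f1 where "f1 t = (if t = a then deriv f a else (f t - f a) / (t - a))" for t
  have f1: "f1 holomorphic_on S"
    unfolding f1_def using pole_lemma_open[OF Suc.prems assms(1)] .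
  have eq: "f t = f a + (t - a) * f1 t" for t by (simp add: f1_def)
  have d: "(deriv ^^ Suc k) f a / fact (Suc k) = (deriv ^^ k) f1 a / fact k" for k
  proof -
    have "(deriv ^^ Suc k) f a = (deriv ^^ Suc k) (\<lambda>t. (t - a) * f1 t + f a) a"
    proof (rule arg_cong[of _ _ "\<lambda>F. (deriv ^^ Suc k) F a"])
      show "f = (\<lambda>t. (t - a) * f1 t + f a)"
        by (rule ext) (metis add.commute eq)
    qed
    also have "\<dots> = (deriv ^^ Suc k) (\<lambda>t. (t - a) * f1 t) a + (deriv ^^ Suc k) (\<lambda>t. f a) a"
      using assms f1 by (intro higher_deriv_add[where S=S]) (auto intro!: holomorphic_intros)
    also have "(deriv ^^ Suc k) (\<lambda>t. f a) a = 0"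
      using higher_deriv_const[of "Suc k" "f a"] by simp
    also have "(deriv ^^ Suc k) (\<lambda>t. (t - a) * f1 t) a
        = (\<Sum>i=0..Suc k. of_nat (Suc k choose i) * (deriv ^^ i) (\<lambda>t. t - a) a * (deriv ^^ (Suc k - i)) f1 a)"
      using assms f1 by (intro higher_deriv_mult[where S=S]) (auto intro!: holomorphic_intros)
    also have "\<dots> = (\<Sum>i\<in>{1}. of_nat (Suc k choose i) * (deriv ^^ i) (\<lambda>t. t - a) a * (deriv ^^ (Suc k - i)) f1 a)"
    proof (rule sum.mono_neutral_right)
      show "\<forall>i\<in>{0..Suc k} - {1}. of_nat (Suc k choose i) * (deriv ^^ i) (\<lambda>t. t - a) a * (deriv ^^ (Suc k - i)) f1 a = 0"
      proof
        fix i assume "i \<in> {0..Suc k} - {1}"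
        have dd: "deriv (\<lambda>t. t - a) = (\<lambda>t. 1)" by (intro ext DERIV_imp_deriv) (auto intro!: derivative_eq_intros)
        consider "i = 0" | j where "i = Suc (Suc j)" using \<open>i \<in> _\<close> by (metis Diff_iff One_nat_def insertI1 not0_implies_Suc)
        then have "(deriv ^^ i) (\<lambda>t. t - a) a = 0"
        proof cases
          case (2 j)
          then have "(deriv ^^ i) (\<lambda>t. t - a) = (deriv ^^ Suc j) (deriv (\<lambda>t. t - a))"
            by (simp add: funpow_swap1)
          then show ?thesis unfolding dd using higher_deriv_const[of "Suc j" "1::complex"] by simp
        qed simp
        then show "of_nat (Suc k choose i) * (deriv ^^ i) (\<lambda>t. t - a) a * (deriv ^^ (Suc k - i)) f1 a = 0" by simp
      qed
    qed auto
    also have "\<dots> = of_nat (Suc k) * (deriv ^^ k) f1 a"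
    proof -
      have "deriv (\<lambda>t. t - a) a = 1" by (intro DERIV_imp_deriv) (auto intro!: derivative_eq_intros)
      then show ?thesis by simp
    qed
    finally show ?thesis by (simp add: field_simps del: of_nat_Suc)
  qed
  obtain g where g: "g holomorphic_on S"
    "\<And>t. t \<in> S \<Longrightarrow> f1 t = (\<Sum>k<n. (deriv ^^ k) f1 a / fact k * (t - a) ^ k) + (t - a) ^ n * g t"
    using Suc.IH[OF f1] by blast
  have "f t = (\<Sum>k<Suc n. (deriv ^^ k) f a / fact k * (t - a) ^ k) + (t - a) ^ Suc n * g t" if "t \<in> S" for t
  proof -
    have "f t = f a + (t - a) * ((\<Sum>k<n. (deriv ^^ k) f1 a / fact k * (t - a) ^ k) + (t - a) ^ n * g t)"
      using eq[of t] g(2)[OF that] by simp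
    also have "\<dots> = f a + (\<Sum>k<n. (deriv ^^ k) f1 a / fact k * (t - a) ^ Suc k) + (t - a) ^ Suc n * g t"
      by (simp add: distrib_left sum_distrib_left mult_ac)
    also have "(\<Sum>k<n. (deriv ^^ k) f1 a / fact k * (t - a) ^ Suc k) = (\<Sum>k<n. (deriv ^^ Suc k) f a / fact (Suc k) * (t - a) ^ Suc k)"
      by (simp only: d)
    also have "f a + \<dots> = (\<Sum>k<Suc n. (deriv ^^ k) f a / fact k * (t - a) ^ k)"
      by (subst sum.lessThan_Suc_shift) simp
    finally show ?thesis .
  qed
  with g(1) show ?case by blast
qed

lemma phase_factor:
  obtains g where "g holomorphic_on strip" "\<And>t. t \<in> strip \<Longrightarrow> phase t = t ^ 3 * (1/6 + t * g t)"
proof -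
  note 0 = zero_in_strip
  obtain g where g: "g holomorphic_on strip"
    "\<And>t. t \<in> strip \<Longrightarrow> phase t = (\<Sum>k<4. (deriv ^^ k) phase 0 / fact k * (t - 0) ^ k) + (t - 0) ^ 4 * g t"
    using holomorphic_taylor_factor[OF open_strip 0 phase_holomorphic, where n = 4] by blast
  have d1: "deriv phase = (\<lambda>t. cosh t - 1)"
    by (intro ext DERIV_imp_deriv DERIV_phase)
  have d2: "deriv (\<lambda>t. cosh t - 1) = (sinh :: complex \<Rightarrow> complex)"
    by (intro ext DERIV_imp_deriv) (auto intro!: derivative_eq_intros)
  have d3: "deriv sinh = (cosh :: complex \<Rightarrow> complex)"
    by (intro ext DERIV_imp_deriv) (auto intro!: derivative_eq_intros)
  have "phase t = t ^ 3 * (1/6 + t * g t)" if "t \<in> strip" for t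
    using g(2)[OF that] by (simp add: numeral_eq_Suc d1 d2 d3 phase_def[of 0] algebra_simps)
  with g(1) show ?thesis using that by blast
qed

lemma exp_third_power3: "exp (z / 3) ^ 3 = exp z" for z :: complex
  using exp_of_nat_mult[of 3 "z / 3"] by simp

text \<open>Without its factor t^3 the phase has no zero in the convex strip, so it has a
  holomorphic logarithm there. The constant \<open>w\<close> is a cube root of unity that makes the
  value at 0 real.\<close>

lemma cube_root_exists:
  "\<exists>E. E holomorphic_on strip \<and> (\<forall>t\<in>strip. (t * E t) ^ 3 = phase t) \<and> (\<forall>t\<in>strip. E t \<noteq> 0)
     \<and> E 0 = of_real (root 3 (1/6))"
proof -
  note 0 = zero_in_strip
  obtain g where g: "g holomorphic_on strip" "\<And>t. t \<in> strip \<Longrightarrow> phase t = t ^ 3 * (1/6 + t * g t)"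
    using phase_factor by blast
  let ?P = "\<lambda>t. 1/6 + t * g t"
  have "?P t \<noteq> 0" if "t \<in> strip" for t
    using g(2)[OF that] phase_eq_0_iff[OF that] by (cases "t = 0") auto
  moreover have "?P holomorphic_on strip" using g(1) by (intro holomorphic_intros)
  ultimately obtain h where h: "h holomorphic_on strip" "\<And>t. t \<in> strip \<Longrightarrow> exp (h t) = ?P t"
    using holomorphic_logarithm_exists[OF convex_strip open_strip _ _ 0, of ?P] by blast
  define w where "w = of_real (root 3 (1/6)) / exp (h 0 / 3)"
  have "of_real (root 3 (1/6)) ^ 3 = (of_real (1/6) :: complex)"
    unfolding of_real_power[symmetric] by simp
  then have w3: "w ^ 3 = 1" unfolding w_def power_divide exp_third_power3 h(2)[OF 0] by simp
  then have w0: "w \<noteq> 0" by auto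
  define E where "E t = w * exp (h t / 3)" for t
  have "E holomorphic_on strip" unfolding E_def using h(1) by (intro holomorphic_intros) auto
  moreover have "(t * E t) ^ 3 = phase t" if "t \<in> strip" for t
    unfolding E_def power_mult_distrib w3 exp_third_power3 h(2)[OF that] g(2)[OF that] by simp
  moreover have "E t \<noteq> 0" for t using w0 by (simp add: E_def)
  moreover have "E 0 = of_real (root 3 (1/6))" by (simp add: E_def w_def)
  ultimately show ?thesis by blast
qed

text \<open>The branch is chosen for the quotient by t, which has no zeros: its reciprocal powers
  are holomorphic on the strip, and their Taylor coefficients are the numbers \<open>B0\<close> up
  to powers of 6.\<close>

definition croot_quot :: "complex \<Rightarrow> complex" where
  "croot_quot = (SOME E. E holomorphic_on strip \<and> (\<forall>t\<in>strip. (t * E t) ^ 3 = phase t) \<and> (\<forall>t\<in>strip. E t \<noteq> 0)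
     \<and> E 0 = of_real (root 3 (1/6)))"

definition croot :: "complex \<Rightarrow> complex" where
  "croot t = t * croot_quot t"

lemma croot_quot_holomorphic [holomorphic_intros]: "croot_quot holomorphic_on strip"
  and croot_power3: "t \<in> strip \<Longrightarrow> croot t ^ 3 = phase t"
  and croot_quot_nonzero: "t \<in> strip \<Longrightarrow> croot_quot t \<noteq> 0"
  and croot_quot_0: "croot_quot 0 = of_real (root 3 (1/6))"
  using someI_ex[OF cube_root_exists] unfolding croot_quot_def[symmetric] croot_def by auto

lemma croot_holomorphic [holomorphic_intros]: "croot holomorphic_on strip"
  unfolding croot_def[abs_def] by (intro holomorphic_intros)

lemma croot_quot_symmetric:
  assumes "t \<in> strip"
  shows "croot_quot (- t) = croot_quot t" "croot_quot (cnj t) = cnj (croot_quot t)"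
proof -
  have c: "connected strip" by (rule convex_connected[OF convex_strip])
  note 0 = zero_in_strip
  have cont: "continuous_on strip croot_quot"
    by (intro holomorphic_on_imp_continuous_on holomorphic_intros)
  have q3: "croot_quot t ^ 3 = phase t / t ^ 3" if "t \<in> strip" "t \<noteq> 0" for t
    using croot_power3[OF that(1)] that(2) by (simp add: croot_def power_mult_distrib field_simps)
  show "croot_quot (- t) = croot_quot t"
  proof (rule cube_root_unique[OF c _ cont _ _ 0 _ assms])
    show "continuous_on strip (\<lambda>t. croot_quot (- t))"
      by (rule continuous_on_compose2[OF cont]) (auto intro!: continuous_intros strip_minus)
    show "croot_quot (- t) ^ 3 = croot_quot t ^ 3" if "t \<in> strip" for t
      using q3[OF that] q3[OF strip_minus[OF that]] by (cases "t = 0") (auto simp: phase_minus)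
  qed (auto simp: croot_quot_nonzero)
  have "cnj (croot_quot (cnj t)) = croot_quot t"
  proof (rule cube_root_unique[OF c _ cont _ _ 0 _ assms])
    show "continuous_on strip (\<lambda>t. cnj (croot_quot (cnj t)))"
      by (intro continuous_intros continuous_on_compose2[OF cont]) (auto intro!: strip_cnj)
    show "cnj (croot_quot (cnj t)) ^ 3 = croot_quot t ^ 3" if "t \<in> strip" for t
    proof (cases "t = 0")
      case False
      have "cnj (croot_quot (cnj t)) ^ 3 = cnj (croot_quot (cnj t) ^ 3)" by simp
      also have "\<dots> = croot_quot t ^ 3"
        using q3[OF that False] q3[OF strip_cnj[OF that]] False by (simp add: phase_cnj)
      finally show ?thesis .
    qed (simp add: croot_quot_0)
  qed (auto simp: croot_quot_nonzero croot_quot_0)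
  then show "croot_quot (cnj t) = cnj (croot_quot t)" by (metis complex_cnj_cnj)
qed

lemma croot_minus: "t \<in> strip \<Longrightarrow> croot (- t) = - croot t"
  and croot_cnj: "t \<in> strip \<Longrightarrow> croot (cnj t) = cnj (croot t)"
  by (simp_all add: croot_def croot_quot_symmetric)

text \<open>Here conjugation is the same as negation, so the two symmetries of the quotient make it
  real. These explicit values are the base points from which the branch is followed along other
  curves.\<close>

lemma croot_imaginary_axis:
  assumes "\<bar>v\<bar> < 2 * pi + 1/2"
  shows "croot (Complex 0 v) = \<i> * of_real (root 3 (v - sin v))"
proof -
  have t: "Complex 0 v \<in> strip" using assms by (simp add: strip_def)
  have "cnj (Complex 0 v) = - Complex 0 v" by (simp add: complex_eq_iff)
  then have "cnj (croot_quot (Complex 0 v)) = croot_quot (Complex 0 v)"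
    using croot_quot_symmetric[OF t] by metis
  then have im: "Im (croot_quot (Complex 0 v)) = 0" by (simp add: complex_eq_iff)
  define r where "r = v * Re (croot_quot (Complex 0 v))"
  have r: "croot (Complex 0 v) = \<i> * of_real r"
    using im by (simp add: croot_def r_def complex_eq_iff)
  have "(\<i> * of_real r) ^ 3 = phase (Complex 0 v)"
    using croot_power3[OF t] by (simp only: r)
  then have "- \<i> * of_real (r ^ 3) = phase (Complex 0 v)"
    by (simp add: power_mult_distrib power3_eq_cube mult_ac)
  then have "- (r ^ 3) = Im (phase (Complex 0 v))" by (metis Im_i_times Re_complex_of_real mult_minus_left uminus_complex.sel(2))
  then have "r ^ 3 = v - sin v" by (simp add: Im_phase)
  then have "root 3 (v - sin v) = r" by (intro odd_real_root_unique) auto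
  then show ?thesis using r by simp
qed

section \<open>The curves bounding the principal sheet\<close>

definition inv_sinhc :: "real \<Rightarrow> real" where
  "inv_sinhc x = (if x = 0 then 1 else x / sinh x)"

lemma inv_sinhc_continuous: "continuous_on A inv_sinhc"
proof -
  have "isCont inv_sinhc x" for x
  proof (cases "x = 0")
    case True
    have "(sinh has_real_derivative cosh 0) (at (0::real))" by (auto intro!: derivative_eq_intros)
    then have "((\<lambda>x::real. sinh x / x) \<longlongrightarrow> 1) (at 0)" by (simp add: has_field_derivative_iff)
    from tendsto_inverse[OF this] have "((\<lambda>x::real. x / sinh x) \<longlongrightarrow> 1) (at 0)" by simp
    then have "(inv_sinhc \<longlongrightarrow> 1) (at 0)"
      by (rule Lim_transform_eventually) (auto simp: inv_sinhc_def eventually_at_filter)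
    then show ?thesis using True by (simp add: isCont_def inv_sinhc_def)
  next
    case False
    have "isCont (\<lambda>x. x / sinh x) x" using False by (intro continuous_intros) auto
    moreover have "\<forall>\<^sub>F y in nhds x. inv_sinhc y = y / sinh y"
      using t1_space_nhds[OF False] by (auto simp: inv_sinhc_def elim: eventually_mono)
    ultimately show ?thesis using isCont_cong by fastforce
  qed
  then show ?thesis using continuous_at_imp_continuous_on by blast
qed

lemma inv_sinhc_bounds:
  assumes "x \<ge> 0"
  shows "0 < inv_sinhc x" "inv_sinhc x \<le> 1" "x > 0 \<Longrightarrow> inv_sinhc x < 1"
    "inv_sinhc x * cosh (x / 2) \<le> 1"
  using assms sinh_gt_self[of x] sinh_ge_mult_cosh_half[of x]
  by (auto simp: inv_sinhc_def divide_le_eq)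

text \<open>The curve \<open>bd x = x + i (2 \<pi> - u)\<close> with \<open>cos u = x / sinh x\<close> starts in the saddle \<open>2 \<pi> i\<close>. The phase is
  purely imaginary on it, and the cube root of the phase maps it onto the cut \<open>i rho\<close>; these definitions
  are only meant for \<open>x \<ge> 0\<close>.\<close>

definition bd_angle :: "real \<Rightarrow> real" where
  "bd_angle x = arccos (inv_sinhc x)"

lemma bd_angle_bounds:
  assumes "x \<ge> 0"
  shows "0 \<le> bd_angle x" "bd_angle x < pi / 2" "cos (bd_angle x) = inv_sinhc x"
    "x > 0 \<Longrightarrow> 0 < bd_angle x"
proof -
  note bnd = inv_sinhc_bounds[OF assms]
  show "0 \<le> bd_angle x" unfolding bd_angle_def using bnd by (intro arccos_lbound) auto
  have "arccos (inv_sinhc x) < arccos 0" using bnd by (intro arccos_less_arccos) auto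
  then show "bd_angle x < pi / 2" by (simp add: bd_angle_def)
  show "cos (bd_angle x) = inv_sinhc x" unfolding bd_angle_def using bnd by (intro cos_arccos) auto
  show "0 < bd_angle x" if "x > 0"
    using arccos_less_arccos[of "inv_sinhc x" 1] bnd that by (simp add: bd_angle_def)
qed

lemma bd_angle_continuous: "continuous_on {0..} bd_angle"
  unfolding bd_angle_def
proof (rule continuous_on_arccos[OF inv_sinhc_continuous])
  show "\<forall>x\<in>{0..}. - 1 \<le> inv_sinhc x \<and> inv_sinhc x \<le> 1"
  proof
    fix x :: real assume "x \<in> {0..}"
    then show "- 1 \<le> inv_sinhc x \<and> inv_sinhc x \<le> 1" using inv_sinhc_bounds[of x] by auto
  qed
qed

lemma bd_angle_DERIV:
  assumes "x > 0"
  obtains D where "(bd_angle has_real_derivative D) (at x)"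
proof -
  have b: "0 < x / sinh x" "x / sinh x < 1" using inv_sinhc_bounds[of x] assms by (auto simp: inv_sinhc_def)
  have "((\<lambda>x. x / sinh x) has_real_derivative (sinh x - x * cosh x) / (sinh x * sinh x)) (at x)"
    using assms by (auto intro!: derivative_eq_intros)
  from DERIV_chain2[OF DERIV_arccos this]
  have d: "((\<lambda>x. arccos (x / sinh x)) has_real_derivative
      inverse (- sqrt (1 - (x / sinh x)\<^sup>2)) * ((sinh x - x * cosh x) / (sinh x * sinh x))) (at x)"
    using b by simp
  have ev: "\<forall>\<^sub>F y in nhds x. arccos (y / sinh y) = bd_angle y"
    using eventually_nhds_in_open[of "{0<..}" x] assms
    by (auto simp: bd_angle_def inv_sinhc_def elim!: eventually_mono)
  show ?thesis by (rule that[OF DERIV_cong_ev[OF refl ev refl, THEN iffD1, OF d]])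
qed

definition bd :: "real \<Rightarrow> complex" where
  "bd x = Complex x (2 * pi - bd_angle x)"

definition rho3 :: "real \<Rightarrow> real" where
  "rho3 x = 2 * pi - bd_angle x + cosh x * sin (bd_angle x)"

definition rho :: "real \<Rightarrow> real" where
  "rho x = root 3 (rho3 x)"

lemma bd_sel [simp]: "Re (bd x) = x" "Im (bd x) = 2 * pi - bd_angle x"
  by (simp_all add: bd_def)

lemma bd_Im_bounds: "x \<ge> 0 \<Longrightarrow> 3 * pi / 2 < Im (bd x)" "x \<ge> 0 \<Longrightarrow> Im (bd x) \<le> 2 * pi"
  using bd_angle_bounds[of x] by auto

lemma bd_in_strip: "x \<ge> 0 \<Longrightarrow> bd x \<in> strip"
  using bd_Im_bounds[of x] pi_gt_zero unfolding strip_def by auto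

lemma bd_continuous: "continuous_on {0..} bd"
  unfolding bd_def Complex_eq by (intro continuous_intros bd_angle_continuous)

lemma phase_bd:
  assumes "x \<ge> 0"
  shows "phase (bd x) = - \<i> * of_real (rho3 x)"
proof -
  have "sinh x * inv_sinhc x = x" using assms by (simp add: inv_sinhc_def)
  then show ?thesis
    using bd_angle_bounds(3)[OF assms] by (simp add: complex_eq_iff Re_phase Im_phase rho3_def)
qed

text \<open>From cos u = x / sinh x <= 1 / cosh (x/2) follows sin u >= tanh (x/2), so replacing cosh
  x sin u by cosh x costs at most 2. The summand 2 \<pi> - u > 3 \<pi> / 2 pays for it. The
  exponential growth of \<open>rho\<close> makes all moments finite.\<close>

lemma rho3_ge_cosh:
  assumes "x \<ge> 0"
  shows "cosh x \<le> rho3 x"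
proof -
  define s where "s = sin (bd_angle x)"
  define a where "a = x / 2"
  have s0: "s \<ge> 0" unfolding s_def using bd_angle_bounds[OF assms] by (intro sin_ge_zero) auto
  have ca: "cosh a > 0" by simp
  have "s\<^sup>2 = 1 - (inv_sinhc x)\<^sup>2"
    unfolding s_def using bd_angle_bounds(3)[OF assms] by (simp add: sin_squared_eq)
  moreover have "(inv_sinhc x * cosh a)\<^sup>2 \<le> 1\<^sup>2"
    unfolding a_def using inv_sinhc_bounds[OF assms] by (intro power_mono) auto
  ultimately have "(s * cosh a)\<^sup>2 \<ge> (cosh a)\<^sup>2 - 1"
    by (simp add: power_mult_distrib left_diff_distrib)
  then have "(sinh a)\<^sup>2 \<le> (s * cosh a)\<^sup>2" by (simp add: sinh_square_eq)
  then have sc: "sinh a \<le> s * cosh a" by (rule power2_le_imp_le) (use s0 in auto)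
  have "cosh x = 2 * (cosh a)\<^sup>2 - 1" using cosh_double_cosh[of a] by (simp add: a_def)
  have ce: "cosh a * exp (- a) \<le> 1"
  proof -
    have "cosh a * exp (- a) = (1 + exp (- 2 * a)) / 2"
      by (simp add: cosh_field_def exp_add[symmetric] add_divide_distrib ring_distribs)
    also have "\<dots> \<le> 1" using assms by (simp add: a_def)
    finally show ?thesis .
  qed
  have "(cosh x * (1 - s)) * cosh a = cosh x * (cosh a - s * cosh a)" by (simp add: algebra_simps)
  also have "\<dots> \<le> cosh x * (cosh a - sinh a)" using sc by (intro mult_left_mono) auto
  also have "\<dots> = cosh x * exp (- a)" by (simp add: cosh_minus_sinh)
  also have "\<dots> \<le> (2 * (cosh a)\<^sup>2) * exp (- a)"
    using \<open>cosh x = 2 * (cosh a)\<^sup>2 - 1\<close> by (intro mult_right_mono) auto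
  also have "\<dots> = (2 * (cosh a * exp (- a))) * cosh a" by (simp add: power2_eq_square)
  also have "\<dots> \<le> 2 * cosh a" using ce by (intro mult_right_mono) auto
  finally have "cosh x * (1 - s) \<le> 2" using ca by simp
  then have "cosh x - cosh x * s \<le> 2" by (simp add: algebra_simps)
  moreover have "bd_angle x < pi / 2" using bd_angle_bounds[OF assms] by simp
  ultimately show ?thesis unfolding rho3_def s_def[symmetric] using pi_gt3 by linarith
qed

lemma rho3_pos: "x \<ge> 0 \<Longrightarrow> rho3 x > 0" and rho3_ge_1: "x \<ge> 0 \<Longrightarrow> rho3 x \<ge> 1"
  using rho3_ge_cosh[of x] cosh_real_ge_1[of x] by auto

lemma rho_pos: "x \<ge> 0 \<Longrightarrow> rho x > 0" and rho_power3: "rho x ^ 3 = rho3 x"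
  using rho3_pos[of x] by (auto simp: rho_def odd_real_root_pow)

lemma rho_nonzero [simp]: "x \<ge> 0 \<Longrightarrow> rho x \<noteq> 0"
  using rho_pos[of x] by simp

lemma rho_lower:
  assumes "x \<ge> 0"
  shows "exp (x / 3) \<le> 2 * rho x" "1 \<le> rho x"
proof -
  show "1 \<le> rho x" unfolding rho_def using rho3_ge_1[OF assms] by simp
  have "exp x / 2 \<le> cosh x" by (simp add: cosh_field_def)
  then have "exp (x / 3) ^ 3 \<le> 2 * rho3 x"
    using rho3_ge_cosh[OF assms] exp_of_nat_mult[of 3 "x/3"] by simp
  also have "\<dots> \<le> (2 * rho x) ^ 3" using rho3_pos[OF assms] by (simp add: power_mult_distrib rho_power3)
  finally show "exp (x / 3) \<le> 2 * rho x"
    by (rule power_le_imp_le_base[where n=2, simplified]) (use rho_pos[OF assms] in auto)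
qed

lemma rho_continuous: "continuous_on {0..} rho"
  unfolding rho_def rho3_def by (intro continuous_intros bd_angle_continuous)

text \<open>At x = 0 the curve is in the saddle on the imaginary axis, where the branch is known;
  continuity carries it along.\<close>

lemma croot_bd:
  assumes "x \<ge> 0"
  shows "croot (bd x) = \<i> * of_real (rho x)"
proof (rule cube_root_unique[of "{0..}" "\<lambda>x. croot (bd x)" "\<lambda>x. \<i> * of_real (rho x)" 0])
  show "continuous_on {0..} (\<lambda>x. croot (bd x))"
    by (rule continuous_on_compose2[OF holomorphic_on_imp_continuous_on[OF croot_holomorphic] bd_continuous])
       (auto intro: bd_in_strip)
  show "continuous_on {0..} (\<lambda>x. \<i> * complex_of_real (rho x))"
    by (intro continuous_intros rho_continuous)
  show "croot (bd x) ^ 3 = (\<i> * of_real (rho x)) ^ 3" if "x \<in> {0..}" for x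
  proof -
    have "(\<i> * complex_of_real (rho x)) ^ 3 = - \<i> * of_real (rho x ^ 3)"
      by (simp add: power_mult_distrib power3_eq_cube mult_ac)
    also have "\<dots> = phase (bd x)" using that by (simp add: rho_power3 phase_bd)
    finally show ?thesis using croot_power3[OF bd_in_strip] that by simp
  qed
  have "bd_angle 0 = 0" by (simp add: bd_angle_def inv_sinhc_def)
  then show "croot (bd 0) = \<i> * of_real (rho 0)"
    using croot_imaginary_axis[of "2 * pi"] pi_gt_zero by (simp add: bd_def rho_def rho3_def)
  show "\<i> * complex_of_real (rho x) \<noteq> 0" if "x \<in> {0..}" for x
    using rho_pos[of x] that by auto
qed (use assms in auto)

text \<open>Mirror images in the imaginary axis have the same image: they are the two sides of one
  cut.\<close>

lemma croot_bd_reflections: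
  assumes "x \<ge> 0"
  shows "croot (- cnj (bd x)) = \<i> * of_real (rho x)"
    "croot (cnj (bd x)) = - \<i> * of_real (rho x)" "croot (- bd x) = - \<i> * of_real (rho x)"
  using croot_bd[OF assms] croot_minus[of "cnj (bd x)"] croot_cnj[of "bd x"] croot_minus[of "bd x"]
    bd_in_strip[OF assms] strip_cnj[of "bd x"] by simp_all

lemma norm_croot_ge:
  assumes "t \<in> strip"
  shows "sinh \<bar>Re t\<bar> - norm t \<le> norm (croot t) ^ 3"
proof -
  have "(cmod (sinh t))\<^sup>2 = (sinh (Re t) * cos (Im t))\<^sup>2 + (cosh (Re t) * sin (Im t))\<^sup>2"
    by (simp add: cmod_power2 Re_sinh Im_sinh)
  also have "\<dots> = (sinh (Re t))\<^sup>2 + (sin (Im t))\<^sup>2"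
    by (simp add: power_mult_distrib cosh_square_eq cos_squared_eq algebra_simps)
  finally have "\<bar>sinh (Re t)\<bar>\<^sup>2 \<le> (cmod (sinh t))\<^sup>2" by simp
  then have "\<bar>sinh (Re t)\<bar> \<le> cmod (sinh t)" by (rule power2_le_imp_le) simp
  moreover have "cmod (sinh t) - cmod t \<le> cmod (phase t)"
    unfolding phase_def by (rule norm_triangle_ineq2)
  moreover have "cmod (phase t) = norm (croot t) ^ 3"
    using croot_power3[OF assms] by (metis norm_power)
  ultimately show ?thesis by simp
qed

section \<open>A residue theorem on the principal sheet\<close>

lemma sinh_minus_double_ge:
  assumes "x \<ge> (10::real)"
  shows "x \<le> sinh x - 2 * x"
proof -
  have "1 + x / 2 \<le> exp (x / 2)" by (rule exp_ge_add_one_self)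
  moreover have "exp (x / 2) \<le> 2 * cosh (x / 2)" by (simp add: cosh_field_def)
  ultimately have "3 \<le> cosh (x / 2)" using assms by linarith
  then have "x * 3 \<le> x * cosh (x / 2)" using assms by (intro mult_left_mono) auto
  then show ?thesis using sinh_ge_mult_cosh_half[of x] assms by linarith
qed

lemma croot_far_large:
  assumes "C \<ge> 0"
  obtains R where "R > 0" "\<And>t. \<bar>Im t\<bar> \<le> 2 * pi \<Longrightarrow> \<bar>Re t\<bar> \<ge> R \<Longrightarrow> norm (croot t) \<ge> C"
proof -
  define R0 where "R0 = max 10 (C ^ 3)"
  have R0: "sinh x - 2 * x \<ge> C ^ 3" if "x \<ge> R0" for x :: real
    using that sinh_minus_double_ge[of x] by (simp add: R0_def)
  define R where "R = max R0 (2 * pi)"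
  have "norm (croot t) \<ge> C" if t: "\<bar>Im t\<bar> \<le> 2 * pi" "\<bar>Re t\<bar> \<ge> R" for t
  proof -
    have "t \<in> strip" using t by (auto simp: strip_def)
    from norm_croot_ge[OF this] have "sinh \<bar>Re t\<bar> - norm t \<le> norm (croot t) ^ 3" .
    moreover have "norm t \<le> 2 * \<bar>Re t\<bar>" using cmod_le[of t] t by (auto simp: R_def)
    moreover have "sinh \<bar>Re t\<bar> - 2 * \<bar>Re t\<bar> \<ge> C ^ 3" using R0[of "\<bar>Re t\<bar>"] t by (auto simp: R_def)
    ultimately have "C ^ 3 \<le> norm (croot t) ^ 3" by linarith
    then show ?thesis by (rule power_le_imp_le_base[where n=2, simplified]) simp
  qed
  moreover have "R > 0" by (simp add: R_def R0_def less_max_iff_disj)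
  ultimately show ?thesis using that by blast
qed

lemma has_vector_derivative_bd:
  assumes "x > 0"
  obtains D where "(bd has_vector_derivative Complex 1 (- D)) (at x)"
    "((\<lambda>x. - cnj (bd x)) has_vector_derivative Complex (-1) (- D)) (at x)"
proof -
  obtain D where D: "(bd_angle has_real_derivative D) (at x)" using bd_angle_DERIV[OF assms] .
  have *: "(bd has_vector_derivative Complex 1 (- D)) (at x)"
    unfolding bd_def Complex_eq
    by (auto intro!: derivative_eq_intros D simp: complex_eq_iff)
  moreover have "((\<lambda>x. - cnj (bd x)) has_vector_derivative Complex (-1) (- D)) (at x)"
  proof -
    have "- cnj (Complex 1 (- D)) = Complex (-1) (- D)" by (simp add: complex_eq_iff)
    then show ?thesis using has_vector_derivative_minus[OF has_vector_derivative_cnj[OF *]] by (simp only:)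
  qed
  ultimately show ?thesis using that by blast
qed

text \<open>The tangents of the two branches are 1 - i D and -1 - i D. Since f has equal values on
  both, the parts with D cancel and 2 F dx remains. The branches start at the same saddle, so
  nothing is left over from x = 0.\<close>

lemma boundary_FTC:
  assumes R: "R \<ge> 0" and U: "\<And>t. 3 * pi / 2 < Im t \<Longrightarrow> Im t \<le> 2 * pi \<Longrightarrow> (U has_field_derivative f t) (at t)"
    and f: "\<And>x. x \<ge> 0 \<Longrightarrow> f (bd x) = F x" "\<And>x. x \<ge> 0 \<Longrightarrow> f (- cnj (bd x)) = F x"
  shows "((\<lambda>x. 2 * F x) has_integral (U (bd R) - U (- cnj (bd R)))) {0..R}"
proof -
  have str: "3 * pi / 2 < Im (bd x)" "Im (bd x) \<le> 2 * pi" "3 * pi / 2 < Im (- cnj (bd x))" "Im (- cnj (bd x)) \<le> 2 * pi" if "x \<ge> 0" for x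
    using bd_Im_bounds[OF that] by auto
  have "bd_angle 0 = 0" by (simp add: bd_angle_def inv_sinhc_def)
  then have b0: "- cnj (bd 0) = bd 0" by (simp add: complex_eq_iff)
  have "((\<lambda>x. 2 * F x) has_integral ((U (bd R) - U (- cnj (bd R))) - (U (bd 0) - U (- cnj (bd 0))))) {0..R}"
  proof (rule fundamental_theorem_of_calculus_interior[OF R])
    show "continuous_on {0..R} (\<lambda>x. U (bd x) - U (- cnj (bd x)))"
    proof -
      let ?T = "{t. 3 * pi / 2 < Im t \<and> Im t \<le> 2 * pi}"
      have cU: "continuous_on ?T U"
        using U by (intro continuous_at_imp_continuous_on ballI) (auto dest: DERIV_isCont)
      have cb: "continuous_on {0..R} bd" by (rule continuous_on_subset[OF bd_continuous]) auto
      have cb': "continuous_on {0..R} (\<lambda>x. - cnj (bd x))" by (intro continuous_intros cb)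
      have "bd ` {0..R} \<subseteq> ?T" "(\<lambda>x. - cnj (bd x)) ` {0..R} \<subseteq> ?T"
        using str by (auto simp del: bd_sel)
      then show ?thesis
        by (intro continuous_on_diff continuous_on_compose2[OF cU cb] continuous_on_compose2[OF cU cb'])
    qed
    fix x assume x: "x \<in> {0<..<R}"
    obtain D where D: "(bd has_vector_derivative Complex 1 (- D)) (at x)"
      "((\<lambda>x. - cnj (bd x)) has_vector_derivative Complex (-1) (- D)) (at x)"
      using has_vector_derivative_bd[of x] x by auto
    have U': "(U has_field_derivative F x) (at (bd x))" "(U has_field_derivative F x) (at (- cnj (bd x)))"
      using U[of "bd x"] U[of "- cnj (bd x)"] x str[of x] f[of x] by (auto simp del: bd_sel)
    have "((\<lambda>x. U (bd x)) has_vector_derivative (Complex 1 (- D) * F x)) (at x)"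
      using field_vector_diff_chain_at[OF D(1) U'(1)] by (simp add: o_def)
    moreover have "((\<lambda>x. U (- cnj (bd x))) has_vector_derivative (Complex (-1) (- D) * F x)) (at x)"
      using field_vector_diff_chain_at[OF D(2) U'(2)] by (simp add: o_def)
    ultimately have "((\<lambda>x. U (bd x) - U (- cnj (bd x))) has_vector_derivative
        (Complex 1 (- D) * F x - Complex (-1) (- D) * F x)) (at x)"
      by (rule has_vector_derivative_diff)
    also have "Complex 1 (- D) * F x - Complex (-1) (- D) * F x = 2 * F x"
      by (simp add: left_diff_distrib[symmetric] complex_eq_iff)
    finally show "((\<lambda>x. U (bd x) - U (- cnj (bd x))) has_vector_derivative 2 * F x) (at x)" .
  qed
  then show ?thesis using b0 by simp
qed

lemma tendsto_Ln_ray: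
  assumes "a \<notin> \<real>\<^sub>\<le>\<^sub>0" "((\<lambda>x. z x / of_real x) \<longlongrightarrow> a) at_top"
  shows "((\<lambda>x. Ln (z x) - of_real (ln x)) \<longlongrightarrow> Ln a) at_top"
proof -
  have "((\<lambda>x. Ln (z x / of_real x)) \<longlongrightarrow> Ln a) at_top"
    using assms by (intro tendsto_intros) auto
  moreover have "\<forall>\<^sub>F x in at_top. z x / of_real x \<noteq> 0"
    using assms by (intro tendsto_imp_eventually_ne) auto
  then have "\<forall>\<^sub>F x in at_top. Ln (z x / of_real x) = Ln (z x) - of_real (ln x)"
    using eventually_gt_at_top[of 0]
  proof eventually_elim
    case (elim x)
    then show ?case using Ln_divide_of_real[of x "z x"] by auto
  qed
  ultimately show ?thesis by (rule Lim_transform_eventually)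
qed

text \<open>The residue theorem for the region bounded by the curves \<open>\<plusminus>bd\<close>, \<open>\<plusminus>cnj bd\<close>, in terms of primitives. The
  two branches above the real axis carry the same values of \<open>f\<close>, so that their
  contributions only differ in the sign of \<open>dx\<close>.\<close>

lemma boundary_residue:
  fixes f g :: "complex \<Rightarrow> complex" and a :: "nat \<Rightarrow> complex"
  assumes S: "open S" "convex S" and mem: "\<And>t. \<bar>Im t\<bar> \<le> 2 * pi \<Longrightarrow> t \<in> S"
    and g: "g holomorphic_on S"
    and fg: "\<And>t. t \<in> S \<Longrightarrow> t \<noteq> t0 \<Longrightarrow> f t = g t + (\<Sum>k<m. a k / (t - t0) ^ Suc k)"
    and t0: "\<bar>Im t0\<bar> \<le> 3 * pi / 2"
    and lim: "\<And>\<epsilon>. \<epsilon> > 0 \<Longrightarrow> \<exists>R. \<forall>t. \<bar>Im t\<bar> \<le> 2 * pi \<longrightarrow> \<bar>Re t\<bar> \<ge> R \<longrightarrow> norm (f t) \<le> \<epsilon>"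
    and up: "\<And>x. x \<ge> 0 \<Longrightarrow> f (bd x) = F x" "\<And>x. x \<ge> 0 \<Longrightarrow> f (- cnj (bd x)) = F x"
    and dn: "\<And>x. x \<ge> 0 \<Longrightarrow> f (cnj (bd x)) = G x" "\<And>x. x \<ge> 0 \<Longrightarrow> f (- bd x) = G x"
    and m: "m > 0"
  shows "((\<lambda>R. integral {0..R} (\<lambda>x. G x - F x)) \<longlongrightarrow> pi * \<i> * a 0) at_top"
proof -
  obtain H where H: "\<And>t. t \<in> S \<Longrightarrow> (H has_field_derivative g t) (at t)"
    using holomorphic_convex_primitive'[OF S(2,1) g] at_within_open[OF _ S(1)] by metis
  \<comment> \<open>Poles of order at least 2 have single-valued primitives that vanish at infinity;
    they do not affect the result.\<close>
  define Q where "Q t = (\<Sum>k\<in>{1..<m}. - a k / (of_nat k * (t - t0) ^ k))" for t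
  have Q: "(Q has_field_derivative (\<Sum>k\<in>{1..<m}. a k / (t - t0) ^ Suc k)) (at t)" if "t \<noteq> t0" for t
  proof -
    have "((\<lambda>t. - a k / (of_nat k * (t - t0) ^ k)) has_field_derivative a k / (t - t0) ^ Suc k) (at t)"
      if "k \<in> {1..<m}" for k
    proof -
      define j where "j = k - 1"
      have k: "k = Suc j" using that by (simp add: j_def)
      define n where "n = (of_nat (Suc j) :: complex)"
      have n: "n \<noteq> 0" unfolding n_def by (rule of_nat_neq_0)
      have y: "t - t0 \<noteq> 0" using \<open>t \<noteq> t0\<close> by simp
      have "((\<lambda>t. t - t0) has_field_derivative 1) (at t)" by (auto intro!: derivative_eq_intros)
      from DERIV_power[OF this, of "Suc j"]
      have p: "((\<lambda>t. (t - t0) ^ Suc j) has_field_derivative n * (t - t0) ^ j) (at t)"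
        by (simp add: n_def)
      have "((\<lambda>t. (- a k / n) * inverse ((t - t0) ^ Suc j)) has_field_derivative
          (- a k / n) * - (inverse ((t - t0) ^ Suc j) * (n * (t - t0) ^ j) * inverse ((t - t0) ^ Suc j))) (at t)"
        using y by (intro DERIV_cmult DERIV_inverse' p) auto
      also have "(\<lambda>t. (- a k / n) * inverse ((t - t0) ^ Suc j)) = (\<lambda>t. - a k / (of_nat k * (t - t0) ^ k))"
        unfolding k n_def by (simp only: divide_inverse inverse_mult_distrib mult.assoc)
      also have "(- a k / n) * - (inverse ((t - t0) ^ Suc j) * (n * (t - t0) ^ j) * inverse ((t - t0) ^ Suc j))
          = a k / (t - t0) ^ Suc k"
      proof -
        have "(- A / n) * - (inverse (Y * z) * (n * z) * inverse (Y * z)) = A / (Y * (Y * z))" if "z \<noteq> 0" "Y \<noteq> 0" for A Y z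
          using that n by (simp add: divide_simps)
        from this[of "(t - t0) ^ j" "t - t0" "a k"] show ?thesis unfolding k using y by simp
      qed
      finally show ?thesis .
    qed
    then show ?thesis unfolding Q_def by (intro DERIV_sum)
  qed
  have split: "(\<Sum>k<m. a k / (t - t0) ^ Suc k) = a 0 / (t - t0) + (\<Sum>k\<in>{1..<m}. a k / (t - t0) ^ Suc k)" for t
    using m by (simp add: lessThan_atLeast0 sum.atLeast_Suc_lessThan)
  have ln_deriv: "((\<lambda>t. Ln (c * (t - t0))) has_field_derivative 1 / (t - t0)) (at t)"
    if "c * (t - t0) \<notin> \<real>\<^sub>\<le>\<^sub>0" "c \<noteq> 0" for c t
    using that by (auto intro!: derivative_eq_intros simp: divide_simps)
  \<comment> \<open>The factor c = - i puts the cut of the logarithm straight below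
    \<open>t0\<close>, c = i straight above it. So c = - i serves the upper curves and c = i the
    lower ones.\<close>
  define U where "U c t = H t + Q t + a 0 * Ln (c * (t - t0))" for c t
  have U: "(U c has_field_derivative f t) (at t)"
    if "t \<in> S" "t \<noteq> t0" "c * (t - t0) \<notin> \<real>\<^sub>\<le>\<^sub>0" "c \<noteq> 0" for c t
  proof -
    have "(U c has_field_derivative g t + (\<Sum>k\<in>{1..<m}. a k / (t - t0) ^ Suc k) + a 0 * (1 / (t - t0))) (at t)"
      unfolding U_def using that by (intro DERIV_add DERIV_cmult H Q ln_deriv)
    also have "g t + (\<Sum>k\<in>{1..<m}. a k / (t - t0) ^ Suc k) + a 0 * (1 / (t - t0)) = f t"
      using fg that split by simp
    finally show ?thesis .
  qed
  have U1: "((\<lambda>x. 2 * F x) has_integral (U (-\<i>) (bd R) - U (-\<i>) (- cnj (bd R)))) {0..R}" if "R \<ge> 0" for R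
  proof (rule boundary_FTC[OF that _ up])
    fix t assume "3 * pi / 2 < Im t" "Im t \<le> 2 * pi"
    then show "(U (-\<i>) has_field_derivative f t) (at t)"
      using t0 by (intro U mem) (auto simp: complex_nonpos_Reals_iff)
  qed
  have U2: "((\<lambda>x. - 2 * G x) has_integral (U \<i> (- bd R) - U \<i> (cnj (bd R)))) {0..R}" if "R \<ge> 0" for R
  proof -
    have "((\<lambda>x. 2 * (- G x)) has_integral (U \<i> (- bd R) - U \<i> (- (- cnj (bd R))))) {0..R}"
    proof (rule boundary_FTC[OF that, of "\<lambda>t. U \<i> (- t)" "\<lambda>t. - f (- t)"])
      fix t assume t: "3 * pi / 2 < Im t" "Im t \<le> 2 * pi"
      then have "(U \<i> has_field_derivative f (- t)) (at (- t))"
        using t0 by (intro U mem) (auto simp: complex_nonpos_Reals_iff)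
      moreover have "(uminus has_field_derivative -1) (at t)" by (auto intro!: derivative_eq_intros)
      ultimately show "((\<lambda>t. U \<i> (- t)) has_field_derivative - f (- t)) (at t)"
        using DERIV_chain2[where f="U \<i>" and g=uminus and x=t] by fastforce
    qed (use dn in auto)
    then show ?thesis by simp
  qed
  have int: "integral {0..R} (\<lambda>x. G x - F x) =
      ((U \<i> (cnj (bd R)) - U \<i> (- bd R)) - (U (-\<i>) (bd R) - U (-\<i>) (- cnj (bd R)))) / 2" if "R \<ge> 0" for R
  proof -
    have "((\<lambda>x. (- (1/2)) * (2 * F x + (- 2 * G x))) has_integral (- (1/2)) *
        ((U (-\<i>) (bd R) - U (-\<i>) (- cnj (bd R))) + (U \<i> (- bd R) - U \<i> (cnj (bd R))))) {0..R}"
      by (intro has_integral_mult_right has_integral_add U1 U2 that)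
    from integral_unique[OF this] show ?thesis by (simp add: algebra_simps diff_divide_distrib add_divide_distrib)
  qed
  have bdq: "((\<lambda>x. bd x / of_real x) \<longlongrightarrow> 1) at_top"
  proof -
    have "((\<lambda>x. bd x / of_real x - 1) \<longlongrightarrow> 0) at_top"
    proof (rule Lim_null_comparison)
      show "\<forall>\<^sub>F x in at_top. norm (bd x / of_real x - 1) \<le> 2 * pi / x"
        using eventually_gt_at_top[of 0]
      proof eventually_elim
        case (elim x)
        have "bd x / of_real x - 1 = (bd x - of_real x) / of_real x" using elim by (simp add: field_simps)
        also have "bd x - of_real x = \<i> * of_real (Im (bd x))" by (simp add: complex_eq_iff)
        also have "norm (\<i> * of_real (Im (bd x)) / complex_of_real x) = \<bar>Im (bd x)\<bar> / x"
          using elim by (simp add: norm_divide norm_mult del: bd_sel)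
        also have "\<dots> \<le> 2 * pi / x" using bd_Im_bounds[of x] elim pi_gt_zero by (intro divide_right_mono) auto
        finally show ?case .
      qed
      show "((\<lambda>x. 2 * pi / x) \<longlongrightarrow> 0) at_top"
        by (rule tendsto_divide_0[OF tendsto_const filterlim_at_top_imp_at_infinity[OF filterlim_ident]])
    qed
    from tendsto_add[OF this tendsto_const[of 1]] show ?thesis by simp
  qed
  have bdc: "((\<lambda>x. cnj (bd x) / of_real x) \<longlongrightarrow> 1) at_top"
    using tendsto_cnj[OF bdq] by simp
  have inv0: "((\<lambda>x. w / of_real x) \<longlongrightarrow> 0) at_top" for w :: complex
    by (rule tendsto_divide_0[OF tendsto_const filterlim_of_real_at_infinity])
  have Lns: "((\<lambda>x. Ln (c * (z x - t0)) - of_real (ln x)) \<longlongrightarrow> Ln (c * w)) at_top"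
    if "((\<lambda>x. z x / of_real x) \<longlongrightarrow> w) at_top" "c * w \<notin> \<real>\<^sub>\<le>\<^sub>0" for c w z
  proof (rule tendsto_Ln_ray[OF that(2)])
    have "((\<lambda>x. c * (z x / of_real x - t0 / of_real x)) \<longlongrightarrow> c * (w - 0)) at_top"
      by (intro tendsto_intros that(1) inv0)
    then show "((\<lambda>x. c * (z x - t0) / of_real x) \<longlongrightarrow> c * w) at_top"
      by (simp only: diff_divide_distrib[symmetric] times_divide_eq_right diff_zero)
  qed
  have Qlim: "((\<lambda>x. Q (z x)) \<longlongrightarrow> 0) at_top"
    if "((\<lambda>x. z x / of_real x) \<longlongrightarrow> w) at_top" "w \<noteq> 0" for w z
  proof -
    have "((\<lambda>x. z x / of_real x - t0 / of_real x) \<longlongrightarrow> w - 0) at_top"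
      by (intro tendsto_intros that(1) inv0)
    then have inf0: "filterlim (\<lambda>x. (z x / of_real x - t0 / of_real x) * of_real x) at_infinity at_top"
      using that(2) by (intro tendsto_mult_filterlim_at_infinity[where c=w] filterlim_of_real_at_infinity) auto
    have ev: "\<forall>\<^sub>F x in at_top. (z x / of_real x - t0 / of_real x) * of_real x = z x - t0"
      using eventually_gt_at_top[of 0] by eventually_elim (simp add: field_simps)
    have inf: "filterlim (\<lambda>x. z x - t0) at_infinity at_top"
      by (rule filterlim_cong[OF refl refl ev, THEN iffD1, OF inf0])
    have "((\<lambda>x. Q (z x)) \<longlongrightarrow> (\<Sum>k\<in>{1..<m}. 0)) at_top"
      unfolding Q_def
    proof (intro tendsto_sum)
      fix k assume k: "k \<in> {1..<m}"
      have "filterlim (\<lambda>x. (z x - t0) ^ k) at_infinity at_top"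
        using k by (intro filterlim_compose[OF filterlim_power_at_infinity inf]) auto
      then have "filterlim (\<lambda>x. of_nat k * (z x - t0) ^ k) at_infinity at_top"
        using k by (intro tendsto_mult_filterlim_at_infinity[OF tendsto_const]) auto
      then show "((\<lambda>x. - a k / (of_nat k * (z x - t0) ^ k)) \<longlongrightarrow> 0) at_top"
        by (rule tendsto_divide_0[OF tendsto_const])
    qed
    then show ?thesis by simp
  qed
  have glim: "\<exists>R. \<forall>t. \<bar>Im t\<bar> \<le> 2 * pi \<longrightarrow> \<bar>Re t\<bar> \<ge> R \<longrightarrow> norm (g t) \<le> \<epsilon>" if e0: "\<epsilon> > 0" for \<epsilon>
  proof -
    obtain R1 where R1: "\<And>t. \<bar>Im t\<bar> \<le> 2 * pi \<Longrightarrow> \<bar>Re t\<bar> \<ge> R1 \<Longrightarrow> norm (f t) \<le> \<epsilon> / 2"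
      using lim[of "\<epsilon> / 2"] half_gt_zero[OF e0] by blast
    define A where "A = (\<Sum>k<m. norm (a k))"
    have A: "A \<ge> 0" unfolding A_def by (intro sum_nonneg) auto
    define d where "d = max 1 (2 * A / \<epsilon>)"
    have d: "d \<ge> 1" "A / d \<le> \<epsilon> / 2"
      using e0 A by (auto simp: d_def field_simps max_def)
    have "norm (g t) \<le> \<epsilon>" if t: "\<bar>Im t\<bar> \<le> 2 * pi" "\<bar>Re t\<bar> \<ge> max R1 (\<bar>Re t0\<bar> + d)" for t
    proof -
      have nf: "norm (f t) \<le> \<epsilon> / 2" using t by (intro R1) auto
      have "d \<le> \<bar>Re (t - t0)\<bar>" using t by auto
      also have "\<dots> \<le> norm (t - t0)" by (rule abs_Re_le_cmod)
      finally have dt: "d \<le> norm (t - t0)" .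
      then have "t \<noteq> t0" using d by auto
      moreover have "t \<in> S" using t by (intro mem)
      ultimately have "g t = f t - (\<Sum>k<m. a k / (t - t0) ^ Suc k)" using fg by simp
      also have "norm \<dots> \<le> norm (f t) + norm (\<Sum>k<m. a k / (t - t0) ^ Suc k)" by (rule norm_triangle_ineq4)
      also have "norm (\<Sum>k<m. a k / (t - t0) ^ Suc k) \<le> (\<Sum>k<m. norm (a k) / d)"
      proof (rule sum_norm_le)
        fix k assume "k \<in> {..<m}"
        have "d ^ 1 \<le> d ^ Suc k" using d by (intro power_increasing) auto
        also have "\<dots> \<le> norm (t - t0) ^ Suc k" using dt d by (intro power_mono) auto
        finally show "norm (a k / (t - t0) ^ Suc k) \<le> norm (a k) / d"
          using d unfolding norm_divide norm_power by (intro divide_left_mono) auto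
      qed
      also have "(\<Sum>k<m. norm (a k) / d) = A / d" by (simp add: A_def sum_divide_distrib)
      finally show ?thesis using nf d(2) by linarith
    qed
    then show ?thesis by blast
  qed
  \<comment> \<open>The vertical sides that close the contour on the left and on the right have
    length at most 4 \<pi>, and g tends to 0 there because f and the principal part do.\<close>
  have Hlim: "((\<lambda>x. H (Complex (\<sigma> * x) (- Im (bd x))) - H (Complex (\<sigma> * x) (Im (bd x)))) \<longlongrightarrow> 0) at_top"
    if "\<bar>\<sigma>\<bar> = 1" for \<sigma> :: real
    unfolding tendsto_iff dist_norm
  proof (intro allI impI)
    fix e :: real assume e: "e > 0"
    have "e / (8 * pi) > 0" using e by simp
    then obtain R where R: "\<And>t. \<bar>Im t\<bar> \<le> 2 * pi \<Longrightarrow> \<bar>Re t\<bar> \<ge> R \<Longrightarrow> norm (g t) \<le> e / (8 * pi)"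
      using glim[of "e / (8 * pi)"] by auto
    show "\<forall>\<^sub>F x in at_top. norm (H (Complex (\<sigma> * x) (- Im (bd x))) - H (Complex (\<sigma> * x) (Im (bd x))) - 0) < e"
      using eventually_ge_at_top[of "max 0 R"]
    proof eventually_elim
      case (elim x)
      let ?y = "Im (bd x)"
      have y: "0 < ?y" "?y \<le> 2 * pi" using bd_Im_bounds[of x] elim pi_gt_zero by (auto simp del: bd_sel)
      have seg: "\<bar>Im t\<bar> \<le> 2 * pi" "\<bar>Re t\<bar> \<ge> R" if "t \<in> closed_segment (Complex (\<sigma> * x) ?y) (Complex (\<sigma> * x) (- ?y))" for t
        using closed_segment_vertical[OF that] y elim \<open>\<bar>\<sigma>\<bar> = 1\<close> by (auto simp: abs_mult simp del: bd_sel)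
      have "norm (H (Complex (\<sigma> * x) (- ?y)) - H (Complex (\<sigma> * x) ?y))
          \<le> e / (8 * pi) * norm (Complex (\<sigma> * x) (- ?y) - Complex (\<sigma> * x) ?y)"
      proof (rule norm_primitive_diff_le)
        fix t assume t: "t \<in> closed_segment (Complex (\<sigma> * x) ?y) (Complex (\<sigma> * x) (- ?y))"
        show "(H has_field_derivative g t) (at t)" using seg(1)[OF t] by (intro H mem)
        show "norm (g t) \<le> e / (8 * pi)" using seg[OF t] by (intro R)
      qed
      also have "Complex (\<sigma> * x) (- ?y) - Complex (\<sigma> * x) ?y = - \<i> * of_real (2 * ?y)"
        by (simp add: complex_eq_iff del: bd_sel)
      also have "e / (8 * pi) * norm (- \<i> * complex_of_real (2 * ?y)) = e / (8 * pi) * (2 * ?y)"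
        using y by (simp add: norm_mult del: bd_sel)
      also have "\<dots> \<le> e / (8 * pi) * (4 * pi)" using y e by (intro mult_left_mono) auto
      also have "\<dots> < e" using e by simp
      finally show ?case by simp
    qed
  qed
  \<comment> \<open>Subtracting ln x from every logarithm makes each bracket converge; with the
    signs + - - + these subtractions cancel.\<close>
  define E where "E x = ((H (Complex (1 * x) (- Im (bd x))) - H (Complex (1 * x) (Im (bd x))))
        - (H (Complex (-1 * x) (- Im (bd x))) - H (Complex (-1 * x) (Im (bd x))))
        + (Q (cnj (bd x)) - Q (- bd x) - Q (bd x) + Q (- cnj (bd x)))
        + a 0 * ((Ln (\<i> * (cnj (bd x) - t0)) - of_real (ln x)) - (Ln (\<i> * (- bd x - t0)) - of_real (ln x))
           - (Ln (- \<i> * (bd x - t0)) - of_real (ln x)) + (Ln (- \<i> * (- cnj (bd x) - t0)) - of_real (ln x)))) / 2" for x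
  have "(E
      \<longlongrightarrow> (0 - 0 + (0 - 0 - 0 + 0) + a 0 * (Ln (\<i> * 1) - Ln (\<i> * (-1)) - Ln (- \<i> * 1) + Ln (- \<i> * (-1)))) / 2) at_top"
  proof -
    have m1: "((\<lambda>x. - bd x / of_real x) \<longlongrightarrow> -1) at_top" "((\<lambda>x. - cnj (bd x) / of_real x) \<longlongrightarrow> -1) at_top"
      using tendsto_minus[OF bdq] tendsto_minus[OF bdc] by simp_all
    show ?thesis
      unfolding E_def
      by (intro tendsto_add tendsto_diff tendsto_mult tendsto_const tendsto_divide Hlim Lns bdq bdc m1)
         (auto intro!: Qlim[OF bdq] Qlim[OF bdc] Qlim[OF m1(1)] Qlim[OF m1(2)] simp: complex_nonpos_Reals_iff)
  qed
  \<comment> \<open>Each of the two differences Ln i - Ln (- i) is \<pi> i: the two cuts together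
    account for one full turn around \<open>t0\<close>, and the division by 2 stems from the doubled
    integrand.\<close>
  also have "(0 - 0 + (0 - 0 - 0 + 0) + a 0 * (Ln (\<i> * 1) - Ln (\<i> * (-1)) - Ln (- \<i> * 1) + Ln (- \<i> * (-1)))) / 2 = pi * \<i> * a 0"
    by simp
  finally show ?thesis
  proof (rule Lim_transform_eventually)
    have c: "Complex (1 * x) (- Im (bd x)) = cnj (bd x)" "Complex (1 * x) (Im (bd x)) = bd x"
       "Complex (-1 * x) (- Im (bd x)) = - bd x" "Complex (-1 * x) (Im (bd x)) = - cnj (bd x)" for x
      by (simp_all add: complex_eq_iff)
    show "\<forall>\<^sub>F x in at_top. E x = integral {0..x} (\<lambda>x. G x - F x)"
      using eventually_ge_at_top[of 0]
    proof eventually_elim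
      case (elim x)
      show ?case unfolding E_def int[OF elim] U_def c by (simp add: algebra_simps)
    qed
  qed
qed

section \<open>Stieltjes representation of the inverse cube root\<close>

lemma bd_ne:
  assumes "x \<ge> 0" "\<bar>Im t\<bar> \<le> 3 * pi / 2"
  shows "bd x \<noteq> t" "cnj (bd x) \<noteq> t"
  using bd_Im_bounds(1)[OF assms(1)] assms(2) by (auto simp del: bd_sel)

lemma exp_third_integrable: "(\<lambda>x::real. exp (- x / 3)) integrable_on {0<..}"
  using has_absolute_integral_Gamma(1)[of 1 "1/3"] has_integral_integrable
  by (fastforce intro: integrable_eq)

lemma rho_inverse_le:
  assumes "x \<ge> 0"
  shows "1 / rho x \<le> 2 * exp (- x / 3)"
  using rho_lower[OF assms] rho_pos[OF assms] by (simp add: exp_minus divide_simps mult.commute)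

lemma rho_continuous_Ioi: "continuous_on {0<..} rho"
  by (rule continuous_on_subset[OF rho_continuous]) auto

lemma absolutely_integrable_rho_bound:
  fixes f :: "real \<Rightarrow> 'a::euclidean_space"
  assumes "continuous_on {0<..} f" "\<And>x. x > 0 \<Longrightarrow> norm (f x) \<le> C / rho x" "C \<ge> 0"
  shows "f absolutely_integrable_on {0<..}"
proof (rule absolutely_integrable_continuous_dominated[OF assms(1)])
  show "(\<lambda>x. (2 * C) * exp (- x / 3)) integrable_on {0<..}"
    by (rule integrable_on_mult_right[OF exp_third_integrable])
  show "norm (f x) \<le> (2 * C) * exp (- x / 3)" if "x > 0" for x
  proof -
    have "norm (f x) \<le> C * (1 / rho x)" using assms(2)[OF that] by simp
    also have "\<dots> \<le> C * (2 * exp (- x / 3))" using rho_inverse_le[of x] that assms(3) by (intro mult_left_mono) auto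
    finally show ?thesis by simp
  qed
qed

text \<open>(f t - w) / (t - t0) has no zero in S, so its reciprocal is holomorphic there.
  Subtracting the value at t0 and dividing by t - t0 splits off the pole on all of S.\<close>

lemma pole_simple:
  assumes "open S" "t0 \<in> S" "f holomorphic_on S" "f t0 = w" "deriv f t0 \<noteq> 0"
    and "\<And>t. t \<in> S \<Longrightarrow> f t = w \<Longrightarrow> t = t0"
  obtains g where "g holomorphic_on S"
    "\<And>t. t \<in> S \<Longrightarrow> t \<noteq> t0 \<Longrightarrow> 1 / (f t - w) = g t + (1 / deriv f t0) / (t - t0)"
proof -
  define q where "q t = (if t = t0 then deriv f t0 else (f t - f t0) / (t - t0))" for t
  have q: "q holomorphic_on S"
    unfolding q_def using pole_lemma_open[OF assms(3,1)] .
  have q0: "q t \<noteq> 0" if "t \<in> S" for t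
  proof (cases "t = t0")
    case False
    then have "f t \<noteq> f t0" using assms(4) assms(6)[OF that] by blast
    then show ?thesis using False by (simp add: q_def)
  qed (simp add: q_def assms(5))
  define r where "r t = 1 / q t" for t
  have r: "r holomorphic_on S" unfolding r_def using q q0 by (intro holomorphic_intros) auto
  define g where "g t = (if t = t0 then deriv r t0 else (r t - r t0) / (t - t0))" for t
  have g: "g holomorphic_on S"
    unfolding g_def using pole_lemma_open[OF r assms(1)] .
  have "1 / (f t - w) = g t + (1 / deriv f t0) / (t - t0)" if "t \<in> S" "t \<noteq> t0" for t
  proof -
    have "f t \<noteq> w" using assms(6) that by blast
    have "r t = (t - t0) / (f t - w)" "r t0 = 1 / deriv f t0"
      using that assms(4) by (simp_all add: r_def q_def)
    then have "g t = ((t - t0) / (f t - w) - 1 / deriv f t0) / (t - t0)"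
      using that by (simp add: g_def)
    also have "\<dots> = 1 / (f t - w) - (1 / deriv f t0) / (t - t0)"
    proof -
      have "(d / A - c) / d = 1 / A - c / d" if "d \<noteq> 0" for d A c :: complex
        using that by (simp add: diff_divide_distrib)
      then show ?thesis using that by simp
    qed
    finally show ?thesis by simp
  qed
  with g show ?thesis using that by blast
qed

text \<open>The residue of 1 / (croot t - w) is 1 / croot' (t0), the derivative of the inverse at w.
  The values on the upper and lower curves differ by 2i rho / (rho^2 + w^2). The domain S is a
  parameter so that uniqueness of t0 may be restricted to a thin neighbourhood of the closed
  strip.\<close>

lemma integral_rho_stieltjes:
  assumes S: "open S" "convex S" "S \<subseteq> strip" and mem: "\<And>t. \<bar>Im t\<bar> \<le> 2 * pi \<Longrightarrow> t \<in> S"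
    and t0: "\<bar>Im t0\<bar> \<le> 3 * pi / 2"
    and uniq: "\<And>t. t \<in> S \<Longrightarrow> croot t = croot t0 \<Longrightarrow> t = t0"
    and d0: "deriv croot t0 \<noteq> 0"
    and abs: "(\<lambda>x. of_real (rho x) / ((of_real (rho x))\<^sup>2 + (croot t0)\<^sup>2)) absolutely_integrable_on {0<..}"
  shows "integral {0<..} (\<lambda>x. of_real (rho x) / ((of_real (rho x))\<^sup>2 + (croot t0)\<^sup>2)) = pi / 2 * (1 / deriv croot t0)"
proof -
  define w where "w = croot t0"
  let ?f = "\<lambda>t. 1 / (croot t - w)"
  let ?Y = "\<lambda>x. of_real (rho x) / ((of_real (rho x))\<^sup>2 + w\<^sup>2)"
  have t0S: "t0 \<in> S" using t0 pi_gt_zero by (intro mem) linarith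
  obtain g where g: "g holomorphic_on S"
    "\<And>t. t \<in> S \<Longrightarrow> t \<noteq> t0 \<Longrightarrow> ?f t = g t + (1 / deriv croot t0) / (t - t0)"
    using pole_simple[OF S(1) t0S holomorphic_on_subset[OF croot_holomorphic S(3)] w_def[symmetric] d0] uniq unfolding w_def by blast
  have "((\<lambda>R. integral {0..R} (\<lambda>x. 1 / (- \<i> * of_real (rho x) - w) - 1 / (\<i> * of_real (rho x) - w)))
      \<longlongrightarrow> pi * \<i> * (1 / deriv croot t0)) at_top"
  proof (rule boundary_residue[where m=1 and a="\<lambda>k. 1 / deriv croot t0" and f="?f", OF S(1,2) mem g(1) _ t0])
    show "?f t = g t + (\<Sum>k<1. 1 / deriv croot t0 / (t - t0) ^ Suc k)" if "t \<in> S" "t \<noteq> t0" for t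
      using g(2)[OF that] by simp
    fix \<epsilon> :: real assume e: "\<epsilon> > 0"
    obtain R where R: "\<And>t. \<bar>Im t\<bar> \<le> 2 * pi \<Longrightarrow> \<bar>Re t\<bar> \<ge> R \<Longrightarrow> norm (croot t) \<ge> norm w + 1 / \<epsilon>"
      using croot_far_large[of "norm w + 1 / \<epsilon>"] e by (metis add_nonneg_nonneg norm_ge_zero zero_le_divide_1_iff less_imp_le)
    have "norm (?f t) \<le> \<epsilon>" if "\<bar>Im t\<bar> \<le> 2 * pi" "\<bar>Re t\<bar> \<ge> R" for t
    proof -
      have "1 / \<epsilon> \<le> norm (croot t) - norm w" using R[OF that] by simp
      also have "\<dots> \<le> norm (croot t - w)" by (rule norm_triangle_ineq2)
      finally have "1 / \<epsilon> \<le> norm (croot t - w)" .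
      moreover have "0 < 1 / \<epsilon>" using e by simp
      ultimately have "1 / norm (croot t - w) \<le> 1 / (1 / \<epsilon>)"
        by (intro divide_left_mono mult_pos_pos) (auto intro: less_le_trans)
      then show ?thesis by (simp add: norm_divide)
    qed
    then show "\<exists>R. \<forall>t. \<bar>Im t\<bar> \<le> 2 * pi \<longrightarrow> R \<le> \<bar>Re t\<bar> \<longrightarrow> norm (?f t) \<le> \<epsilon>" by blast
  qed (simp_all add: croot_bd croot_bd_reflections)
  moreover have "integral {0..R} (\<lambda>x. 1 / (- \<i> * of_real (rho x) - w) - 1 / (\<i> * of_real (rho x) - w))
      = 2 * \<i> * integral {0..R} ?Y" for R
  proof -
    have "1 / (- \<i> * of_real (rho x) - w) - 1 / (\<i> * of_real (rho x) - w) = 2 * \<i> * ?Y x" if "x \<in> {0..R}" for x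
    proof -
      have x: "x \<ge> 0" using that by simp
      have "croot (bd x) \<noteq> w" "croot (cnj (bd x)) \<noteq> w"
        using uniq[of "bd x"] uniq[of "cnj (bd x)"] bd_ne[OF x t0] mem[of "bd x"] mem[of "cnj (bd x)"] bd_Im_bounds[OF x]
        by (auto simp: w_def)
      then have nz: "\<i> * of_real (rho x) - w \<noteq> 0" "- \<i> * of_real (rho x) - w \<noteq> 0"
        using x by (auto simp: croot_bd croot_bd_reflections)
      have e: "(\<i> * of_real (rho x) - w) * (- \<i> * of_real (rho x) - w) = (of_real (rho x))\<^sup>2 + w\<^sup>2"
        by (simp add: algebra_simps power2_eq_square)
      have "1 / (- \<i> * of_real (rho x) - w) - 1 / (\<i> * of_real (rho x) - w)
          = ((\<i> * of_real (rho x) - w) - (- \<i> * of_real (rho x) - w)) / ((\<i> * of_real (rho x) - w) * (- \<i> * of_real (rho x) - w))"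
        using nz by (simp add: diff_frac_eq mult.commute)
      also have "\<dots> = 2 * \<i> * ?Y x" unfolding e by simp
      finally show ?thesis .
    qed
    then have "integral {0..R} (\<lambda>x. 1 / (- \<i> * of_real (rho x) - w) - 1 / (\<i> * of_real (rho x) - w))
      = integral {0..R} (\<lambda>x. 2 * \<i> * ?Y x)" by (intro integral_cong) auto
    then show ?thesis by (simp only: integral_mult_right)
  qed
  ultimately have "((\<lambda>R. 2 * \<i> * integral {0..R} ?Y) \<longlongrightarrow> pi * \<i> * (1 / deriv croot t0)) at_top" by simp
  from tendsto_mult_left[OF this, of "1 / (2 * \<i>)"]
  have "((\<lambda>R. integral {0..R} ?Y) \<longlongrightarrow> pi / 2 * (1 / deriv croot t0)) at_top" by (simp add: mult_ac)
  moreover have "((\<lambda>R. integral {0..R} ?Y) \<longlongrightarrow> integral {0<..} ?Y) at_top"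
    using abs unfolding w_def by (rule integral_Icc_tendsto)
  ultimately show ?thesis unfolding w_def using tendsto_unique trivial_limit_at_top_linorder by blast
qed

text \<open>Up to the sign (-1)^n this is the coefficient of w^(2n) in the power series of
  y'(w).\<close>

definition moment :: "nat \<Rightarrow> real" where
  "moment n = 2 / pi * integral {0<..} (\<lambda>x. 1 / rho x ^ (2 * n + 1))"

lemma moment_integrable: "(\<lambda>x. 1 / rho x ^ (2 * n + 1)) absolutely_integrable_on {0<..}"
proof (rule absolutely_integrable_rho_bound[where C=1])
  show "continuous_on {0<..} (\<lambda>x. 1 / rho x ^ (2 * n + 1))"
    by (intro continuous_intros rho_continuous_Ioi) auto
  show "norm (1 / rho x ^ (2 * n + 1)) \<le> 1 / rho x" if "x > 0" for x
  proof -
    have "rho x ^ 1 \<le> rho x ^ (2 * n + 1)" using rho_lower(2)[of x] that by (intro power_increasing) auto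
    then show ?thesis using rho_pos[of x] that by (simp add: divide_simps)
  qed
qed auto

text \<open>Near 0 the base in \<open>B0\<close> has positive real part, and c = k / croot_quot is
  its principal cube root because both equal 1 at 0. Its principal power with exponent (n + 1)/3 is
  therefore c^(n + 1); the factor k = 6^(-1/3) accounts for the power of 6.\<close>

lemma higher_deriv_croot_quot:
  fixes n :: nat
  shows "(deriv ^^ n) (\<lambda>t. (1 / croot_quot t) ^ (n + 1)) 0 / fact n = of_real (6 powr (real (n + 1) / 3)) * B0 n"
proof -
  let ?B = "\<lambda>t::complex. if t = 0 then 1 else 1 / 6 * (t ^ 3 / (sinh t - t))"
  define k where "k = complex_of_real (root 3 (1/6))"
  define c where "c t = k / croot_quot t" for t
  have k3: "k ^ 3 = 1/6" unfolding k_def of_real_power[symmetric] by simp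
  then have k0: "k \<noteq> 0" by auto
  note 0 = zero_in_strip
  have ch: "c holomorphic_on strip" unfolding c_def by (intro holomorphic_intros) (auto simp: croot_quot_nonzero)
  have c0: "c 0 = 1" using k0 by (simp add: c_def croot_quot_0 k_def)
  have c3: "c t ^ 3 = ?B t" if "t \<in> strip" for t
  proof (cases "t = 0")
    case False
    have "croot_quot t ^ 3 = (sinh t - t) / t ^ 3"
      using croot_power3[OF that] False by (simp add: croot_def power_mult_distrib phase_def field_simps)
    then show ?thesis using False by (simp add: c_def power_divide k3)
  qed (simp add: c0)
  have cc: "continuous_on strip (\<lambda>t. c t ^ 3)"
    by (intro continuous_intros holomorphic_on_imp_continuous_on ch)
  have "\<exists>d>0. ball 0 d \<subseteq> strip \<and> (\<forall>t\<in>ball 0 d. Re (c t ^ 3) > 0)"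
  proof -
    have "isCont (\<lambda>t. c t ^ 3) 0" using cc 0 open_strip by (simp add: continuous_on_eq_continuous_at)
    then have "((\<lambda>t. Re (c t ^ 3)) \<longlongrightarrow> Re (c 0 ^ 3)) (nhds 0)"
      using continuous_at_imp_continuous_within tendsto_Re isCont_def tendsto_nhds_iff by blast
    then have "\<forall>\<^sub>F t in nhds 0. Re (c t ^ 3) > 0" by (rule order_tendstoD(1)) (simp add: c0)
    moreover have "\<forall>\<^sub>F t in nhds 0. t \<in> strip" using open_strip 0 by (rule eventually_nhds_in_open)
    ultimately have "\<forall>\<^sub>F t in nhds 0. t \<in> strip \<and> Re (c t ^ 3) > 0" by eventually_elim auto
    then show ?thesis unfolding eventually_nhds_metric by (auto simp: subset_iff dist_commute)
  qed
  then obtain d where d: "d > 0" "ball 0 d \<subseteq> strip" "\<And>t. t \<in> ball 0 d \<Longrightarrow> Re (c t ^ 3) > 0" by blast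
  have nz: "c t ^ 3 \<noteq> 0" "c t ^ 3 \<notin> \<real>\<^sub>\<le>\<^sub>0" if "t \<in> ball 0 d" for t
    using d(3)[OF that] by (auto simp: complex_nonpos_Reals_iff)
  have Lc: "exp (Ln (c t ^ 3) / 3) = c t" if t: "t \<in> ball 0 d" for t
  proof (rule cube_root_unique[of "ball 0 d" "\<lambda>t. exp (Ln (c t ^ 3) / 3)" c 0])
    show "continuous_on (ball 0 d) (\<lambda>t. exp (Ln (c t ^ 3) / 3))"
      using nz d(2) by (intro continuous_intros continuous_on_subset[OF cc]) auto
    show "continuous_on (ball 0 d) c"
      using ch d(2) holomorphic_on_imp_continuous_on holomorphic_on_subset by blast
  qed (use nz t d(1) c0 in \<open>auto simp: exp_third_power3\<close>)
  have pw: "?B t powr (of_nat (n + 1) / 3) = c t ^ (n + 1)" if t: "t \<in> ball 0 d" for t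
  proof -
    have "t \<in> strip" using d(2) t by blast
    then have "?B t = c t ^ 3" by (rule c3[symmetric])
    then have "?B t powr (of_nat (n + 1) / 3) = exp (of_nat (n + 1) * (Ln (c t ^ 3) / 3))"
      using nz(1)[OF t] by (simp add: powr_def)
    also have "\<dots> = c t ^ (n + 1)" unfolding exp_of_nat_mult Lc[OF t] by simp
    finally show ?thesis .
  qed
  have "(deriv ^^ n) (\<lambda>t. ?B t powr (of_nat (n + 1) / 3)) 0 = (deriv ^^ n) (\<lambda>t. k ^ (n + 1) * (1 / croot_quot t) ^ (n + 1)) 0"
  proof (rule higher_deriv_cong_ev)
    have "\<forall>\<^sub>F t in nhds 0. t \<in> ball 0 d" using d(1) by (intro eventually_nhds_in_open) auto
    then show "\<forall>\<^sub>F t in nhds 0. ?B t powr (of_nat (n + 1) / 3) = k ^ (n + 1) * (1 / croot_quot t) ^ (n + 1)"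
      by eventually_elim (subst pw, auto simp: c_def power_divide)
  qed simp
  also have "\<dots> = k ^ (n + 1) * (deriv ^^ n) (\<lambda>t. (1 / croot_quot t) ^ (n + 1)) 0"
    by (rule higher_deriv_cmult[where A=strip])
       (auto intro!: holomorphic_intros open_strip simp: 0 croot_quot_nonzero)
  finally have "B0 n = k ^ (n + 1) * ((deriv ^^ n) (\<lambda>t. (1 / croot_quot t) ^ (n + 1)) 0 / fact n)"
    by (simp add: B0_def)
  moreover have "of_real (6 powr (real (n + 1) / 3)) * k ^ (n + 1) = 1"
  proof -
    have "root 3 (1/6) ^ (n + 1) = ((1/6::real) powr (1/3)) ^ (n + 1)" using root_powr_inverse[of 3 "1/6"] by simp
    also have "((1/6::real) powr (1/3)) ^ (n + 1) = ((1/6) powr (1/3)) powr real (n + 1)"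
      by (rule powr_realpow[symmetric]) simp
    also have "\<dots> = (1/6) powr (1/3 * real (n + 1))" by (rule powr_powr)
    finally have "root 3 (1/6) ^ (n + 1) = (1/6) powr (1/3 * real (n + 1))" .
    then have "6 powr (real (n + 1) / 3) * root 3 (1/6) ^ (n + 1) = (6 * (1/6)) powr (real (n + 1) / 3)"
      by (subst powr_mult) (auto simp: mult.commute)
    then have "6 powr (real (n + 1) / 3) * root 3 (1/6) ^ (n + 1) = 1" by simp
    then show ?thesis unfolding k_def by (metis of_real_1 of_real_mult of_real_power)
  qed
  ultimately show ?thesis by (simp only: mult.assoc[symmetric] mult_1_left)
qed

text \<open>Lagrange inversion as a residue: the residue of croot^(-(2n+1)) at 0 is the coefficient
  of t^(2n) in croot_quot^(-(2n+1)). On the cuts the odd power of 1 / (i rho) contributes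
  i^(-(2n+1)), whence the alternating sign.\<close>

lemma moment_eq: "of_real (moment n) = (- 1) ^ n * (of_real (6 powr (real (2 * n + 1) / 3)) * B0 (2 * n))"
proof -
  let ?q = "\<lambda>t. (1 / croot_quot t) ^ (2 * n + 1)"
  let ?f = "\<lambda>t. (1 / croot t) ^ (2 * n + 1)"
  let ?c = "\<lambda>k. (deriv ^^ k) ?q 0 / fact k"
  note 0 = zero_in_strip
  have "?q holomorphic_on strip" by (intro holomorphic_intros) (auto simp: croot_quot_nonzero)
  from holomorphic_taylor_factor[OF open_strip 0 this, of "2 * n + 1"]
  obtain g where g: "g holomorphic_on strip"
    "\<And>t. t \<in> strip \<Longrightarrow> ?q t = (\<Sum>k<2 * n + 1. ?c k * (t - 0) ^ k) + (t - 0) ^ (2 * n + 1) * g t"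
    by blast
  have "((\<lambda>R. integral {0..R} (\<lambda>x. (1 / (- \<i> * of_real (rho x))) ^ (2 * n + 1) - (1 / (\<i> * of_real (rho x))) ^ (2 * n + 1)))
      \<longlongrightarrow> pi * \<i> * ?c (2 * n - 0)) at_top"
  \<comment> \<open>The indices run backwards: the Taylor coefficient of t^(2n - k) belongs to the
    pole of order k + 1, so \<open>a 0\<close> is the residue.\<close>
  proof (rule boundary_residue[where m="2 * n + 1" and a="\<lambda>k. ?c (2 * n - k)" and f="?f" and ?t0.0=0, OF open_strip convex_strip _ g(1)])
    show "t \<in> strip" if "\<bar>Im t\<bar> \<le> 2 * pi" for t using that by (simp add: strip_def)
    show "?f t = g t + (\<Sum>k<2 * n + 1. ?c (2 * n - k) / (t - 0) ^ Suc k)" if "t \<in> strip" "t \<noteq> 0" for t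
    proof -
      have "?f t = ?q t / t ^ (2 * n + 1)" by (simp add: croot_def power_divide power_mult_distrib)
      also have "\<dots> = g t + (\<Sum>k<2 * n + 1. ?c k * t ^ k) / t ^ (2 * n + 1)"
        unfolding g(2)[OF that(1)] using that(2) by (simp add: add_divide_distrib)
      also have "(\<Sum>k<2 * n + 1. ?c k * t ^ k) / t ^ (2 * n + 1) = (\<Sum>k<2 * n + 1. ?c k * t ^ k / t ^ (2 * n + 1))"
        by (rule sum_divide_distrib)
      also have "\<dots> = (\<Sum>k<2 * n + 1. ?c (2 * n - k) / (t - 0) ^ Suc k)"
      proof (rule sum.reindex_bij_witness[where i="\<lambda>k. 2 * n - k" and j="\<lambda>k. 2 * n - k"])
        fix k assume k: "k \<in> {..<2 * n + 1}"
        then have "2 * n + 1 = k + Suc (2 * n - k)" by simp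
        then have "t ^ (2 * n + 1) = t ^ k * t ^ Suc (2 * n - k)" by (metis power_add)
        then have "?c k * t ^ k / t ^ (2 * n + 1) = ?c k / t ^ Suc (2 * n - k)" using that(2) by simp
        then show "?c (2 * n - (2 * n - k)) / (t - 0) ^ Suc (2 * n - k) = ?c k * t ^ k / t ^ (2 * n + 1)"
          using k by simp
      qed auto
      finally show ?thesis .
    qed
    fix \<epsilon> :: real assume e: "\<epsilon> > 0"
    obtain R where R: "\<And>t. \<bar>Im t\<bar> \<le> 2 * pi \<Longrightarrow> \<bar>Re t\<bar> \<ge> R \<Longrightarrow> norm (croot t) \<ge> 1 + 1 / \<epsilon>"
      using croot_far_large[of "1 + 1 / \<epsilon>"] e by (metis add_nonneg_nonneg zero_le_one zero_le_divide_1_iff less_imp_le)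
    have "norm (?f t) \<le> \<epsilon>" if "\<bar>Im t\<bar> \<le> 2 * pi" "\<bar>Re t\<bar> \<ge> R" for t
    proof -
      have n: "norm (croot t) \<ge> 1" "norm (croot t) \<ge> 1 / \<epsilon>" using R[OF that] e by (auto simp: add_increasing2 intro: order_trans[rotated])
      have "norm (croot t) ^ 1 \<le> norm (croot t) ^ (2 * n + 1)" using n(1) by (intro power_increasing) auto
      then have "1 / \<epsilon> \<le> norm (croot t) ^ (2 * n + 1)" using n(2) by simp
      then have "1 / norm (croot t) ^ (2 * n + 1) \<le> 1 / (1 / \<epsilon>)" using e n by (intro divide_left_mono mult_pos_pos zero_less_power) auto
      then show ?thesis by (simp add: norm_divide norm_power norm_mult power_divide)
    qed
    then show "\<exists>R. \<forall>t. \<bar>Im t\<bar> \<le> 2 * pi \<longrightarrow> R \<le> \<bar>Re t\<bar> \<longrightarrow> norm (?f t) \<le> \<epsilon>" by blast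
  qed (simp_all add: croot_bd croot_bd_reflections)
  moreover have e: "(1 / (- \<i> * of_real (rho x))) ^ (2 * n + 1) - (1 / (\<i> * of_real (rho x))) ^ (2 * n + 1)
      = 2 * \<i> * (- 1) ^ n * of_real (1 / rho x ^ (2 * n + 1))" for x
  proof -
    have "\<i> ^ (2 * n + 1) = \<i> * (- 1) ^ n" by (simp add: power_mult)
    then have "1 / \<i> ^ (2 * n + 1) = - \<i> * (- 1) ^ n" by (cases "even n") simp_all
    moreover have "(1 / (\<i> * of_real (rho x))) ^ (2 * n + 1) = (1 / \<i> ^ (2 * n + 1)) * of_real (1 / rho x ^ (2 * n + 1))"
      by (simp only: power_divide power_mult_distrib power_one of_real_divide of_real_1 of_real_power times_divide_times_eq mult_1)
    ultimately have i: "(1 / (\<i> * of_real (rho x))) ^ (2 * n + 1) = - \<i> * (- 1) ^ n * of_real (1 / rho x ^ (2 * n + 1))"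
      by simp
    have "(1 / (- \<i> * of_real (rho x))) ^ (2 * n + 1) = - ((1 / (\<i> * of_real (rho x))) ^ (2 * n + 1))"
      using power_minus_odd[of "2 * n + 1" "1 / (\<i> * of_real (rho x))"] by simp
    then show ?thesis unfolding i by simp
  qed
  moreover have "integral {0..R} (\<lambda>x. 2 * \<i> * (- 1) ^ n * of_real (1 / rho x ^ (2 * n + 1)))
      = 2 * \<i> * (- 1) ^ n * of_real (integral {0..R} (\<lambda>x. 1 / rho x ^ (2 * n + 1)))" for R
  proof -
    have "continuous_on {0..R} (\<lambda>x. 1 / rho x ^ (2 * n + 1))"
      by (intro continuous_intros continuous_on_subset[OF rho_continuous]) auto
    then have "(\<lambda>x. 1 / rho x ^ (2 * n + 1)) integrable_on {0..R}" by (rule integrable_continuous_real)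
    then show ?thesis
      by (intro integral_unique has_integral_mult_right has_integral_of_real integrable_integral)
  qed
  ultimately have "((\<lambda>R. 2 * \<i> * (- 1) ^ n * of_real (integral {0..R} (\<lambda>x. 1 / rho x ^ (2 * n + 1))))
      \<longlongrightarrow> pi * \<i> * ?c (2 * n)) at_top"
    by (simp only: diff_zero)
  moreover have "((\<lambda>R. 2 * \<i> * (- 1) ^ n * of_real (integral {0..R} (\<lambda>x. 1 / rho x ^ (2 * n + 1))))
      \<longlongrightarrow> 2 * \<i> * (- 1) ^ n * complex_of_real (integral {0<..} (\<lambda>x. 1 / rho x ^ (2 * n + 1)))) at_top"
    by (intro tendsto_mult tendsto_const tendsto_of_real integral_Icc_tendsto[OF moment_integrable])
  ultimately have "2 * \<i> * (- 1) ^ n * complex_of_real (integral {0<..} (\<lambda>x. 1 / rho x ^ (2 * n + 1))) = pi * \<i> * ?c (2 * n)"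
    using tendsto_unique[OF trivial_limit_at_top_linorder] by blast
  then have "(- 1) ^ n * complex_of_real (moment n) = ?c (2 * n)"
    by (simp add: moment_def field_simps)
  then have "(- 1) ^ n * ((- 1) ^ n * complex_of_real (moment n)) = (- 1) ^ n * ?c (2 * n)" by simp
  moreover have "(- 1) ^ n * ((- 1) ^ n * complex_of_real (moment n)) = of_real (moment n)"
    by (simp add: mult.assoc[symmetric] power_mult_distrib[symmetric])
  ultimately have "complex_of_real (moment n) = (- 1) ^ n * ?c (2 * n)" by (simp only:)
  then show ?thesis by (simp only: higher_deriv_croot_quot)
qed

section \<open>Terminants\<close>

text \<open>The integral for \<open>moment n\<close> with the factor 1 / (1 + s^2 / rho^6) that
  closes the three-term remainder. The singularities s = i rho^3 and s = - i rho^3 lie on the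
  imaginary axis.\<close>

definition stieltjes :: "nat \<Rightarrow> complex \<Rightarrow> complex" where
  "stieltjes n s = complex_of_real (2 / pi) *
     integral {0<..} (\<lambda>x. complex_of_real (1 / rho x ^ (2 * n + 1)) / (1 + (s / complex_of_real (rho x ^ 3))\<^sup>2))"

text \<open>1 + z^2 = (z + i)(z - i), and each factor is at least \<kappa>: the points i and - i
  have distance Re z / |z| from the line through 0 and z. In the proof this distance bound is a sum
  of two squares.\<close>

lemma norm_one_plus_square_ge:
  fixes z :: complex
  assumes "\<kappa> * norm z \<le> Re z" "0 \<le> \<kappa>" "\<kappa> \<le> 1"
  shows "\<kappa>\<^sup>2 \<le> norm (1 + z\<^sup>2)"
proof -
  have *: "\<kappa> \<le> norm (z + c)" if c: "c = \<i> \<or> c = - \<i>" for c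
  proof (cases "z = 0")
    case False
    obtain e where e: "c = Complex 0 e" "e\<^sup>2 = 1" using c by (auto simp: complex_eq_iff)
    have "(norm (z + c) * norm z)\<^sup>2 = ((Re z)\<^sup>2 + (Im z + e)\<^sup>2) * ((Re z)\<^sup>2 + (Im z)\<^sup>2)"
      unfolding power_mult_distrib cmod_power2 by (simp add: e)
    also have "\<dots> = ((Re z)\<^sup>2 + Im z * (Im z + e))\<^sup>2 + (Re z)\<^sup>2 * e\<^sup>2" by algebra
    finally have "(Re z)\<^sup>2 \<le> (norm (z + c) * norm z)\<^sup>2" using e by simp
    then have "Re z \<le> norm (z + c) * norm z" by (rule power2_le_imp_le) simp
    with assms(1) have "\<kappa> * norm z \<le> norm (z + c) * norm z" by linarith
    then show ?thesis using False by simp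
  qed (use assms c in auto)
  have "1 + z\<^sup>2 = (z + \<i>) * (z + - \<i>)" by (simp add: algebra_simps power2_eq_square)
  then have "norm (1 + z\<^sup>2) = norm (z + \<i>) * norm (z + - \<i>)" by (simp only: norm_mult)
  moreover have "\<kappa> * \<kappa> \<le> norm (z + \<i>) * norm (z + - \<i>)"
    using *[of \<i>] *[of "- \<i>"] assms by (intro mult_mono) auto
  ultimately show ?thesis by (simp add: power2_eq_square)
qed

lemma norm_one_plus_scaled_square_ge:
  assumes "\<kappa> * norm s \<le> Re s" "0 \<le> \<kappa>" "\<kappa> \<le> 1" "r > 0"
  shows "\<kappa>\<^sup>2 \<le> norm (1 + (s / of_real r)\<^sup>2)"
proof (rule norm_one_plus_square_ge[OF _ assms(2,3)])
  have "\<kappa> * norm s / r \<le> Re s / r" using assms by (intro divide_right_mono) auto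
  then show "\<kappa> * norm (s / of_real r) \<le> Re (s / of_real r)"
    using assms by (simp add: norm_divide)
qed

lemma cone_constant:
  assumes "Re s > 0"
  shows "\<exists>\<kappa>>0. \<kappa> \<le> 1 \<and> \<kappa> * norm s \<le> Re s"
  using assms abs_Re_le_cmod[of s]
  by (intro exI[of _ "Re s / norm s"]) (auto simp: divide_le_eq)

context
  fixes n :: nat
begin

abbreviation (input) "stieltjes_integrand s x \<equiv> complex_of_real (1 / rho x ^ (2 * n + 1)) / (1 + (s / complex_of_real (rho x ^ 3))\<^sup>2)"

lemma norm_stieltjes_integrand_le:
  assumes "B \<le> norm (1 + (s / of_real (rho x ^ 3))\<^sup>2)" "B > 0" "x \<ge> 0"
  shows "norm (stieltjes_integrand s x :: complex) \<le> (1 / B) * (1 / rho x ^ (2 * n + 1))"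
proof -
  have p: "0 < 1 / rho x ^ (2 * n + 1)" using rho_pos[OF assms(3)] by simp
  have "norm (stieltjes_integrand s x :: complex) = (1 / rho x ^ (2 * n + 1)) / norm (1 + (s / of_real (rho x ^ 3))\<^sup>2)"
    unfolding norm_divide norm_of_real using p by simp
  also have "\<dots> \<le> (1 / rho x ^ (2 * n + 1)) / B"
    using assms p by (intro divide_left_mono mult_pos_pos) auto
  also have "\<dots> = (1 / B) * (1 / rho x ^ (2 * n + 1))"
    by (simp only: divide_inverse mult_1 mult.commute)
  finally show ?thesis .
qed

lemma stieltjes_integrand_nonzero:
  assumes "Re s > 0" "x \<ge> 0"
  shows "1 + (s / of_real (rho x ^ 3))\<^sup>2 \<noteq> 0"
proof -
  obtain \<kappa> where k: "\<kappa> > 0" "\<kappa> \<le> 1" "\<kappa> * norm s \<le> Re s" using cone_constant[OF assms(1)] by blast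
  have "\<kappa>\<^sup>2 \<le> norm (1 + (s / of_real (rho x ^ 3))\<^sup>2)"
    using k rho_pos[OF assms(2)] by (intro norm_one_plus_scaled_square_ge) auto
  moreover have "\<kappa>\<^sup>2 > 0" using k by simp
  ultimately show ?thesis by (metis norm_zero not_less)
qed

lemma stieltjes_integrand_integrable:
  assumes "Re s > 0"
  shows "(\<lambda>x. stieltjes_integrand s x :: complex) absolutely_integrable_on {0<..}"
proof -
  obtain \<kappa> where k: "\<kappa> > 0" "\<kappa> \<le> 1" "\<kappa> * norm s \<le> Re s" using cone_constant[OF assms] by blast
  show ?thesis
  proof (rule absolutely_integrable_continuous_dominated)
    show "continuous_on {0<..} (\<lambda>x. stieltjes_integrand s x :: complex)"
      using stieltjes_integrand_nonzero[OF assms] by (intro continuous_intros rho_continuous_Ioi) auto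
    show "(\<lambda>x. (1 / \<kappa>\<^sup>2) * (1 / rho x ^ (2 * n + 1))) integrable_on {0<..}"
      by (intro integrable_on_mult_right set_lebesgue_integral_eq_integral(1) moment_integrable)
    show "norm (stieltjes_integrand s x :: complex) \<le> (1 / \<kappa>\<^sup>2) * (1 / rho x ^ (2 * n + 1))" if "x > 0" for x
      using that k rho_pos[of x]
      by (intro norm_stieltjes_integrand_le norm_one_plus_scaled_square_ge) auto
  qed
qed

lemma norm_stieltjes_le:
  assumes "Re s > 0" "B > 0" "\<And>r. r > 0 \<Longrightarrow> B \<le> norm (1 + (s / of_real r)\<^sup>2)"
  shows "norm (stieltjes n s) \<le> moment n / B"
proof -
  have "norm (integral {0<..} (\<lambda>x. stieltjes_integrand s x :: complex))
      \<le> integral {0<..} (\<lambda>x. (1 / B) * (1 / rho x ^ (2 * n + 1)))"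
  proof (rule integral_norm_bound_integral)
    show "(\<lambda>x. stieltjes_integrand s x :: complex) integrable_on {0<..}"
      by (intro set_lebesgue_integral_eq_integral(1) stieltjes_integrand_integrable assms)
    show "(\<lambda>x. (1 / B) * (1 / rho x ^ (2 * n + 1))) integrable_on {0<..}"
      by (intro integrable_on_mult_right set_lebesgue_integral_eq_integral(1) moment_integrable)
    show "norm (stieltjes_integrand s x :: complex) \<le> (1 / B) * (1 / rho x ^ (2 * n + 1))" if "x \<in> {0<..}" for x
    proof (rule norm_stieltjes_integrand_le[OF assms(3) assms(2)])
      show "0 < rho x ^ 3" "0 \<le> x" using that rho_pos[of x] by auto
    qed
  qed
  also have "\<dots> = (1 / B) * integral {0<..} (\<lambda>x. 1 / rho x ^ (2 * n + 1))" by (simp only: integral_mult_right)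
  finally have "2 / pi * norm (integral {0<..} (\<lambda>x. stieltjes_integrand s x :: complex))
      \<le> 2 / pi * ((1 / B) * integral {0<..} (\<lambda>x. 1 / rho x ^ (2 * n + 1)))"
    by (intro mult_left_mono) auto
  moreover have "norm (complex_of_real (2 / pi)) = 2 / pi" unfolding norm_of_real by simp
  ultimately have "norm (stieltjes n s) \<le> 2 / pi * ((1 / B) * integral {0<..} (\<lambda>x. 1 / rho x ^ (2 * n + 1)))"
    unfolding stieltjes_def norm_mult by (simp only:)
  also have "\<dots> = moment n / B" unfolding moment_def by simp
  finally show ?thesis .
qed

lemma stieltjes_holomorphic: "stieltjes n holomorphic_on {s. Re s > 0}"
proof -
  have "(\<lambda>s. integral {0<..} (\<lambda>x. stieltjes_integrand s x :: complex)) holomorphic_on {s. Re s > 0}"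
  proof (rule integral_holomorphic_on)
    show "open {s. Re s > 0}" by (rule open_halfspace_Re_gt)
    show "(\<lambda>x. stieltjes_integrand s x :: complex) integrable_on {0<..}" if "s \<in> {s. Re s > 0}" for s
      using that by (intro set_lebesgue_integral_eq_integral(1) stieltjes_integrand_integrable) auto
    show "(\<lambda>s. stieltjes_integrand s x) holomorphic_on {s. Re s > 0}" if "x \<in> {0<..}" for x
      using that stieltjes_integrand_nonzero by (intro holomorphic_intros) auto
    fix z :: complex assume "z \<in> {s. Re s > 0}"
    then have z: "Re z > 0" by simp
    define r where "r = Re z / 2"
    \<comment> \<open>On the ball Re y >= r and |y| <= |z| + r, so this is a lower bound for Re y /
      |y| there.\<close>
    define \<kappa> where "\<kappa> = r / (norm z + r)"
    have r: "r > 0" "norm z + r > 0" using z by (auto simp: r_def add_nonneg_pos)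
    have k: "\<kappa> > 0" "\<kappa> \<le> 1" using r by (auto simp: \<kappa>_def divide_le_eq)
    have cone: "Re y > 0" "\<kappa> * norm y \<le> Re y" if "y \<in> cball z r" for y
    proof -
      have d: "norm (z - y) \<le> r" using that by (simp add: dist_norm)
      have "Re (z - y) \<le> r" using d complex_Re_le_cmod[of "z - y"] by linarith
      then have re: "Re y \<ge> r" by (simp add: r_def)
      then show "Re y > 0" using r by linarith
      have "norm y \<le> norm z + r" using norm_triangle_ineq2[of y z] d by (simp add: norm_minus_commute)
      then have "\<kappa> * norm y \<le> \<kappa> * (norm z + r)" using k by (intro mult_left_mono) auto
      also have "\<dots> = r" using r by (simp add: \<kappa>_def)
      finally show "\<kappa> * norm y \<le> Re y" using re by linarith
    qed
    have "norm (stieltjes_integrand y x :: complex) \<le> (1 / \<kappa>\<^sup>2) * (1 / rho x ^ (2 * n + 1))"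
      if "x \<in> {0<..}" "y \<in> cball z r" for x y
      using that k rho_pos[of x] cone[OF that(2)]
      by (intro norm_stieltjes_integrand_le norm_one_plus_scaled_square_ge) auto
    moreover have "(\<lambda>x. (1 / \<kappa>\<^sup>2) * (1 / rho x ^ (2 * n + 1))) integrable_on {0<..}"
      by (intro integrable_on_mult_right set_lebesgue_integral_eq_integral(1) moment_integrable)
    moreover have "cball z r \<subseteq> {s. Re s > 0}" using cone by blast
    ultimately show "\<exists>r>0. \<exists>g. g integrable_on {0<..} \<and> cball z r \<subseteq> {s. Re s > 0} \<and>
        (\<forall>x\<in>{0<..}. \<forall>y\<in>cball z r. norm (stieltjes_integrand y x :: complex) \<le> g x)"
      using r(1) by blast
  qed
  then show ?thesis unfolding stieltjes_def[abs_def] by (intro holomorphic_intros)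
qed

lemma norm_stieltjes_cone:
  assumes "\<kappa> * norm s \<le> Re s" "0 < \<kappa>" "\<kappa> \<le> 1" "s \<noteq> 0"
  shows "norm (stieltjes n s) \<le> moment n / \<kappa>\<^sup>2"
proof (rule norm_stieltjes_le)
  have "\<kappa> * norm s > 0" using assms by simp
  then show "Re s > 0" using assms by linarith
qed (use assms in \<open>auto intro: norm_one_plus_scaled_square_ge\<close>)

end

lemma moment_nonneg: "moment n \<ge> 0"
  unfolding moment_def by (intro mult_nonneg_nonneg integral_nonneg set_lebesgue_integral_eq_integral(1) moment_integrable)
    (auto intro!: mult_nonneg_nonneg zero_le_power less_imp_le[OF rho_pos])

section \<open>Laplace integrals along rays\<close>

definition tau :: "nat \<Rightarrow> real" where "tau n = (2 * real n + 1) / 3"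

lemma tau_pos: "tau n > 0" by (simp add: tau_def add_pos_nonneg)

definition laplace_integrand :: "nat \<Rightarrow> complex \<Rightarrow> complex \<Rightarrow> complex" where
  "laplace_integrand n \<nu> s = exp (- \<nu> * s) * s powr (of_real (tau n - 1)) * stieltjes n s"

text \<open>The Laplace integral along the ray of argument \<open>- \<alpha>\<close>; turning the ray continues it analytically in \<open>\<nu>\<close>.\<close>

definition terminant :: "nat \<Rightarrow> real \<Rightarrow> complex \<Rightarrow> complex" where
  "terminant n \<alpha> \<nu> = integral {0<..} (\<lambda>\<sigma>. cis (- \<alpha>) * laplace_integrand n \<nu> (of_real \<sigma> * cis (- \<alpha>)))"

lemma laplace_integrand_holomorphic: "laplace_integrand n \<nu> holomorphic_on {s. Re s > 0}"
proof -
  have "s \<notin> \<real>\<^sub>\<le>\<^sub>0" if "Re s > 0" for s using that by (auto simp: complex_nonpos_Reals_iff)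
  then show ?thesis unfolding laplace_integrand_def[abs_def]
    by (intro holomorphic_intros stieltjes_holomorphic) auto
qed

lemma norm_laplace_integrand_le:
  assumes "Re (\<nu> * s) \<ge> \<mu>" "norm (stieltjes n s) \<le> C" 
  shows "norm (laplace_integrand n \<nu> s) \<le> norm s powr (tau n - 1) * exp (- \<mu>) * C"
proof -
  have "norm (laplace_integrand n \<nu> s) = exp (- Re (\<nu> * s)) * norm s powr (tau n - 1) * norm (stieltjes n s)"
    unfolding laplace_integrand_def norm_mult by (simp add: norm_powr_real_powr')
  also have "\<dots> \<le> exp (- \<mu>) * norm s powr (tau n - 1) * C"
    using assms by (intro mult_mono) auto
  finally show ?thesis by (simp add: mult_ac)
qed

context
  fixes n :: nat and \<alpha> :: real
  assumes \<alpha>: "cos \<alpha> > 0"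
begin

lemma ray_cone:
  assumes "\<sigma> > 0"
  shows "cos \<alpha> * norm (of_real \<sigma> * cis (- \<alpha>)) \<le> Re (of_real \<sigma> * cis (- \<alpha>))"
    "Re (of_real \<sigma> * cis (- \<alpha>)) > 0" "of_real \<sigma> * cis (- \<alpha>) \<noteq> 0"
  using \<alpha> assms by (auto simp: norm_mult)

lemma norm_ray_integrand_le:
  assumes "\<sigma> > 0" "Re (\<nu> * cis (- \<alpha>)) \<ge> \<mu>" "norm (stieltjes n (of_real \<sigma> * cis (- \<alpha>))) \<le> C"
  shows "norm (cis (- \<alpha>) * laplace_integrand n \<nu> (of_real \<sigma> * cis (- \<alpha>)))
    \<le> C * (\<sigma> powr (tau n - 1) * exp (- \<mu> * \<sigma>))"
proof -
  have "\<sigma> * \<mu> \<le> \<sigma> * Re (\<nu> * cis (- \<alpha>))" using assms by (intro mult_left_mono) auto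
  also have "\<dots> = Re (\<nu> * (of_real \<sigma> * cis (- \<alpha>)))" by (simp add: algebra_simps)
  finally have "norm (laplace_integrand n \<nu> (of_real \<sigma> * cis (- \<alpha>)))
      \<le> norm (of_real \<sigma> * cis (- \<alpha>)) powr (tau n - 1) * exp (- (\<sigma> * \<mu>)) * C"
    by (intro norm_laplace_integrand_le assms(3))
  then show ?thesis using assms(1) by (simp add: norm_mult mult_ac)
qed

lemma ray_integrand_continuous:
  "continuous_on {0<..} (\<lambda>\<sigma>. cis (- \<alpha>) * laplace_integrand n \<nu> (of_real \<sigma> * cis (- \<alpha>)))"
proof -
  have "continuous_on {0<..} (\<lambda>\<sigma>. laplace_integrand n \<nu> (of_real \<sigma> * cis (- \<alpha>)))"
    by (rule continuous_on_compose2[OF holomorphic_on_imp_continuous_on[OF laplace_integrand_holomorphic]])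
       (use ray_cone in \<open>auto intro!: continuous_intros\<close>)
  then show ?thesis by (intro continuous_intros)
qed

lemma ray_integrand_integrable:
  assumes "Re (\<nu> * cis (- \<alpha>)) > 0"
  shows "(\<lambda>\<sigma>. cis (- \<alpha>) * laplace_integrand n \<nu> (of_real \<sigma> * cis (- \<alpha>))) absolutely_integrable_on {0<..}"
proof (rule absolutely_integrable_continuous_dominated[OF ray_integrand_continuous])
  let ?\<mu> = "Re (\<nu> * cis (- \<alpha>))"
  show "(\<lambda>\<sigma>. (moment n / (cos \<alpha>)\<^sup>2) * (\<sigma> powr (tau n - 1) * exp (- ?\<mu> * \<sigma>))) integrable_on {0<..}"
    by (intro integrable_on_mult_right has_integral_integrable[OF has_absolute_integral_Gamma(1)] tau_pos assms)
  show "norm (cis (- \<alpha>) * laplace_integrand n \<nu> (of_real \<sigma> * cis (- \<alpha>)))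
      \<le> (moment n / (cos \<alpha>)\<^sup>2) * (\<sigma> powr (tau n - 1) * exp (- ?\<mu> * \<sigma>))" if "\<sigma> > 0" for \<sigma>
    by (rule norm_ray_integrand_le[OF that order_refl])
       (use \<alpha> ray_cone[OF that] in \<open>intro norm_stieltjes_cone, auto\<close>)
qed

lemma norm_terminant_le:
  assumes "Re (\<nu> * cis (- \<alpha>)) > 0"
    and C: "\<And>\<sigma>. \<sigma> > 0 \<Longrightarrow> norm (stieltjes n (of_real \<sigma> * cis (- \<alpha>))) \<le> C"
  shows "norm (terminant n \<alpha> \<nu>) \<le> C * (Gamma (tau n) / Re (\<nu> * cis (- \<alpha>)) powr tau n)"
proof -
  let ?\<mu> = "Re (\<nu> * cis (- \<alpha>))"
  note G = has_absolute_integral_Gamma(1)[OF tau_pos assms(1), of n]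
  have "norm (terminant n \<alpha> \<nu>) \<le> integral {0<..} (\<lambda>\<sigma>. C * (\<sigma> powr (tau n - 1) * exp (- ?\<mu> * \<sigma>)))"
    unfolding terminant_def
  proof (rule integral_norm_bound_integral)
    show "(\<lambda>\<sigma>. cis (- \<alpha>) * laplace_integrand n \<nu> (of_real \<sigma> * cis (- \<alpha>))) integrable_on {0<..}"
      by (intro set_lebesgue_integral_eq_integral(1) ray_integrand_integrable assms(1))
    show "(\<lambda>\<sigma>. C * (\<sigma> powr (tau n - 1) * exp (- ?\<mu> * \<sigma>))) integrable_on {0<..}"
      by (intro integrable_on_mult_right has_integral_integrable[OF G])
    show "norm (cis (- \<alpha>) * laplace_integrand n \<nu> (of_real \<sigma> * cis (- \<alpha>)))
        \<le> C * (\<sigma> powr (tau n - 1) * exp (- ?\<mu> * \<sigma>))" if "\<sigma> \<in> {0<..}" for \<sigma>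
      using that by (intro norm_ray_integrand_le C) auto
  qed
  also have "\<dots> = C * (Gamma (tau n) / ?\<mu> powr tau n)"
    using G by (simp only: integral_mult_right integral_unique)
  finally show ?thesis .
qed

lemma terminant_holomorphic: "terminant n \<alpha> holomorphic_on {\<nu>. Re (\<nu> * cis (- \<alpha>)) > 0}"
  unfolding terminant_def[abs_def]
proof (rule integral_holomorphic_on)
  let ?S = "{\<nu>. Re (\<nu> * cis (- \<alpha>)) > 0}"
  let ?f = "\<lambda>\<nu> \<sigma>. cis (- \<alpha>) * laplace_integrand n \<nu> (of_real \<sigma> * cis (- \<alpha>))"
  show "open ?S" by (intro open_Collect_less continuous_intros)
  show "?f \<nu> integrable_on {0<..}" if "\<nu> \<in> ?S" for \<nu>
    using that by (intro set_lebesgue_integral_eq_integral(1) ray_integrand_integrable) auto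
  show "(\<lambda>\<nu>. ?f \<nu> \<sigma>) holomorphic_on ?S" for \<sigma>
    unfolding laplace_integrand_def by (intro holomorphic_intros)
  fix z assume "z \<in> ?S"
  then have z: "Re (z * cis (- \<alpha>)) > 0" by simp
  define r where "r = Re (z * cis (- \<alpha>)) / 2"
  have r: "r > 0" using z by (simp add: r_def)
  have re: "Re (y * cis (- \<alpha>)) \<ge> r" if "y \<in> cball z r" for y
  proof -
    have "Re ((z - y) * cis (- \<alpha>)) \<le> norm ((z - y) * cis (- \<alpha>))" by (rule complex_Re_le_cmod)
    also have "\<dots> \<le> r" using that by (simp add: norm_mult dist_norm)
    finally show ?thesis by (simp add: r_def left_diff_distrib)
  qed
  have "norm (?f y \<sigma>) \<le> (moment n / (cos \<alpha>)\<^sup>2) * (\<sigma> powr (tau n - 1) * exp (- r * \<sigma>))"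
    if "\<sigma> \<in> {0<..}" "y \<in> cball z r" for \<sigma> y
    by (rule norm_ray_integrand_le[OF _ re[OF that(2)]])
       (use \<alpha> ray_cone[of \<sigma>] that in \<open>auto intro!: norm_stieltjes_cone\<close>)
  moreover have "(\<lambda>\<sigma>. (moment n / (cos \<alpha>)\<^sup>2) * (\<sigma> powr (tau n - 1) * exp (- r * \<sigma>))) integrable_on {0<..}"
    by (intro integrable_on_mult_right has_integral_integrable[OF has_absolute_integral_Gamma(1)] tau_pos r)
  moreover have "cball z r \<subseteq> ?S" using re r by force
  ultimately show "\<exists>r>0. \<exists>g. g integrable_on {0<..} \<and> cball z r \<subseteq> ?S \<and>
      (\<forall>\<sigma>\<in>{0<..}. \<forall>y\<in>cball z r. norm (?f y \<sigma>) \<le> g \<sigma>)"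
    using r by blast
qed

end


lemma tendsto_powr_mult_exp_0:
  assumes "\<mu> > (0::real)"
  shows "((\<lambda>x. x powr t * exp (- \<mu> * x)) \<longlongrightarrow> 0) at_top"
proof -
  define m where "m = nat \<lceil>t\<rceil>"
  have lim: "((\<lambda>x. (1 / \<mu> ^ m) * ((\<mu> * x) ^ m / exp (\<mu> * x))) \<longlongrightarrow> (1 / \<mu> ^ m) * 0) at_top"
    by (intro tendsto_mult tendsto_const filterlim_compose[OF tendsto_power_div_exp_0]
        filterlim_tendsto_pos_mult_at_top[OF tendsto_const assms] filterlim_ident)
  show ?thesis
  proof (rule Lim_null_comparison)
    show "((\<lambda>x. (1 / \<mu> ^ m) * ((\<mu> * x) ^ m / exp (\<mu> * x))) \<longlongrightarrow> 0) at_top" using lim by simp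
    show "\<forall>\<^sub>F x in at_top. norm (x powr t * exp (- \<mu> * x)) \<le> (1 / \<mu> ^ m) * ((\<mu> * x) ^ m / exp (\<mu> * x))"
      using eventually_ge_at_top[of 1]
    proof eventually_elim
      case (elim x)
      have "t \<le> real m" unfolding m_def by linarith
      then have "x powr t \<le> x powr (real m)" using elim by (intro powr_mono) auto
      then have "x powr t * exp (- \<mu> * x) \<le> x ^ m * exp (- \<mu> * x)"
        using elim by (intro mult_right_mono) (auto simp: powr_realpow)
      also have "\<dots> = (1 / \<mu> ^ m) * ((\<mu> * x) ^ m / exp (\<mu> * x))"
        using assms by (simp add: power_mult_distrib exp_minus divide_inverse)
      finally show ?case by simp
    qed
  qed
qed

text \<open>Cauchy's theorem by a primitive K on the half-plane: the integrals differ by the change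
  of K between the two rays at radius \<sigma>. On the chord joining them \<open>stieltjes\<close>
  stays bounded and e^(- \<nu> s) decays, so the change is at most a constant times \<sigma>^\<tau>
  e^(- \<mu> \<sigma>), which vanishes at both ends.\<close>

lemma terminant_rotate:
  assumes c: "cos \<alpha> > 0" "cos \<beta> > 0" and re: "Re (\<nu> * cis (- \<alpha>)) > 0" "Re (\<nu> * cis (- \<beta>)) > 0"
  shows "terminant n \<alpha> \<nu> = terminant n \<beta> \<nu>"
proof -
  define \<kappa> where "\<kappa> = min (cos \<alpha>) (cos \<beta>)"
  define \<mu> where "\<mu> = min (Re (\<nu> * cis (- \<alpha>))) (Re (\<nu> * cis (- \<beta>)))"
  define C where "C = moment n / \<kappa>\<^sup>2"
  have \<kappa>: "\<kappa> > 0" "\<kappa> \<le> cos \<alpha>" "\<kappa> \<le> cos \<beta>" "\<kappa> \<le> 1" using c by (auto simp: \<kappa>_def min_le_iff_disj)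
  have \<mu>: "\<mu> > 0" "\<mu> \<le> Re (\<nu> * cis (- \<alpha>))" "\<mu> \<le> Re (\<nu> * cis (- \<beta>))" using re by (auto simp: \<mu>_def)
  have C: "C \<ge> 0" using moment_nonneg by (simp add: C_def)
  let ?S = "{s::complex. Re s > 0}"
  obtain K where K: "\<And>s. s \<in> ?S \<Longrightarrow> (K has_field_derivative laplace_integrand n \<nu> s) (at s)"
    using holomorphic_convex_primitive'[OF convex_halfspace_Re_gt open_halfspace_Re_gt laplace_integrand_holomorphic]
      at_within_open[OF _ open_halfspace_Re_gt] by metis
  let ?a = "\<lambda>\<sigma>. of_real \<sigma> * cis (- \<alpha>)" and ?c = "\<lambda>\<sigma>. of_real \<sigma> * cis (- \<beta>)"
  let ?fa = "\<lambda>\<sigma>. cis (- \<alpha>) * laplace_integrand n \<nu> (?a \<sigma>)"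
  let ?fc = "\<lambda>\<sigma>. cis (- \<beta>) * laplace_integrand n \<nu> (?c \<sigma>)"
  define D where "D \<sigma> = K (?a \<sigma>) - K (?c \<sigma>)" for \<sigma> :: real
  have ray: "((\<lambda>\<sigma>. K (of_real \<sigma> * cis (- \<gamma>))) has_vector_derivative cis (- \<gamma>) * laplace_integrand n \<nu> (of_real \<sigma> * cis (- \<gamma>))) (at \<sigma>)"
    if "cos \<gamma> > 0" "\<sigma> > 0" for \<gamma> \<sigma>
  proof -
    have "((\<lambda>\<sigma>. of_real \<sigma> * cis (- \<gamma>)) has_vector_derivative cis (- \<gamma>)) (at \<sigma>)"
      by (auto intro!: derivative_eq_intros)
    moreover have "(K has_field_derivative laplace_integrand n \<nu> (of_real \<sigma> * cis (- \<gamma>))) (at (of_real \<sigma> * cis (- \<gamma>)))"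
      using ray_cone(2)[OF that] by (intro K) auto
    ultimately show ?thesis using field_vector_diff_chain_at by (fastforce simp: o_def)
  qed
  have Dd: "(D has_vector_derivative (?fa \<sigma> - ?fc \<sigma>)) (at \<sigma>)" if "\<sigma> > 0" for \<sigma>
    unfolding D_def by (intro has_vector_derivative_diff ray c that)
  \<comment> \<open>A chord is used instead of an arc because Re t and Re (\<nu> t) are affine on it
    and hence bounded below by their values at the endpoints.\<close>
  have seg: "Re t \<ge> \<sigma> * \<kappa>" "norm t \<le> \<sigma>" "Re (\<nu> * t) \<ge> \<sigma> * \<mu>"
    if t: "t \<in> closed_segment (?c \<sigma>) (?a \<sigma>)" and \<sigma>: "\<sigma> > 0" for t \<sigma>
  proof -
    obtain u where u: "0 \<le> u" "u \<le> 1" and tu: "t = (1 - u) *\<^sub>R ?c \<sigma> + u *\<^sub>R ?a \<sigma>"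
      using t by (auto simp: in_segment)
    have "\<sigma> * \<kappa> = \<sigma> * ((1 - u) * \<kappa> + u * \<kappa>)" by (simp add: algebra_simps)
    also have "\<dots> \<le> \<sigma> * ((1 - u) * cos \<beta> + u * cos \<alpha>)"
      using u \<kappa> \<sigma> by (intro mult_left_mono add_mono) auto
    also have "\<dots> = Re t" by (simp add: tu algebra_simps)
    finally show "Re t \<ge> \<sigma> * \<kappa>" .
    have "norm t \<le> norm ((1 - u) *\<^sub>R ?c \<sigma>) + norm (u *\<^sub>R ?a \<sigma>)" unfolding tu by (rule norm_triangle_ineq)
    also have "\<dots> = (1 - u) * \<sigma> + u * \<sigma>" unfolding norm_scaleR using u \<sigma> by (simp add: norm_mult)
    also have "\<dots> = \<sigma>" by (simp add: algebra_simps)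
    finally show "norm t \<le> \<sigma>" .
    have "\<sigma> * \<mu> = \<sigma> * ((1 - u) * \<mu> + u * \<mu>)" by (simp add: algebra_simps)
    also have "\<dots> \<le> \<sigma> * ((1 - u) * Re (\<nu> * cis (- \<beta>)) + u * Re (\<nu> * cis (- \<alpha>)))"
      using u \<mu> \<sigma> by (intro mult_left_mono add_mono) auto
    also have "\<dots> = Re (\<nu> * t)" by (simp add: tu algebra_simps)
    finally show "Re (\<nu> * t) \<ge> \<sigma> * \<mu>" .
  qed
  \<comment> \<open>The summand 1 serves \<tau> >= 1, where |t| <= \<sigma> bounds the power. For
    \<tau> < 1 the exponent is negative, and |t| >= \<sigma> \<kappa> produces the power of
    \<kappa>. The final 2 comes from the chord, of length at most 2 \<sigma>.\<close>
  define C' where "C' = (1 + \<kappa> powr (tau n - 1)) * C * 2"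
  have Db: "norm (D \<sigma>) \<le> C' * (\<sigma> powr tau n * exp (- \<mu> * \<sigma>))" if \<sigma>: "\<sigma> > 0" for \<sigma>
  proof -
    let ?B = "(\<sigma> powr (tau n - 1) * (1 + \<kappa> powr (tau n - 1))) * exp (- (\<sigma> * \<mu>)) * C"
    have "norm (K (?a \<sigma>) - K (?c \<sigma>)) \<le> ?B * norm (?a \<sigma> - ?c \<sigma>)"
    proof (rule norm_primitive_diff_le)
      fix t assume t: "t \<in> closed_segment (?c \<sigma>) (?a \<sigma>)"
      note s = seg[OF t \<sigma>]
      have pos: "\<sigma> * \<kappa> > 0" using \<sigma> \<kappa> by simp
      then have rt: "Re t > 0" using s by linarith
      then show "(K has_field_derivative laplace_integrand n \<nu> t) (at t)" by (intro K) simp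
      have nt: "\<sigma> * \<kappa> \<le> norm t" "norm t > 0" using s(1) complex_Re_le_cmod[of t] pos by linarith+
      have "norm (stieltjes n t) \<le> C" unfolding C_def
      proof (rule norm_stieltjes_cone)
        have "\<kappa> * norm t \<le> \<kappa> * \<sigma>" using s \<kappa> by (intro mult_left_mono) auto
        then show "\<kappa> * norm t \<le> Re t" using s(1) by (simp add: mult.commute)
      qed (use \<kappa> rt in auto)
      then have "norm (laplace_integrand n \<nu> t) \<le> norm t powr (tau n - 1) * exp (- (\<sigma> * \<mu>)) * C"
        using s(3) by (intro norm_laplace_integrand_le)
      also have "\<dots> \<le> ?B"
      proof (intro mult_right_mono)
        show "norm t powr (tau n - 1) \<le> \<sigma> powr (tau n - 1) * (1 + \<kappa> powr (tau n - 1))"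
        proof (cases "tau n \<ge> 1")
          case True
          then have "norm t powr (tau n - 1) \<le> \<sigma> powr (tau n - 1)" using s(2) nt by (intro powr_mono2) auto
          also have "\<dots> * 1 \<le> \<sigma> powr (tau n - 1) * (1 + \<kappa> powr (tau n - 1))" by (intro mult_left_mono) auto
          finally show ?thesis by simp
        next
          case False
          then have "norm t powr (tau n - 1) \<le> (\<sigma> * \<kappa>) powr (tau n - 1)" using nt pos by (intro powr_mono2') auto
          also have "\<dots> = \<sigma> powr (tau n - 1) * \<kappa> powr (tau n - 1)" using \<sigma> \<kappa> by (intro powr_mult)
          also have "\<dots> \<le> \<sigma> powr (tau n - 1) * (1 + \<kappa> powr (tau n - 1))" by (intro mult_left_mono) auto
          finally show ?thesis .
        qed
      qed (use C in auto)
      finally show "norm (laplace_integrand n \<nu> t) \<le> ?B" .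
    qed
    also have "\<dots> \<le> ?B * (2 * \<sigma>)"
    proof (rule mult_left_mono)
      have "norm (?a \<sigma> - ?c \<sigma>) \<le> norm (?a \<sigma>) + norm (?c \<sigma>)" by (rule norm_triangle_ineq4)
      also have "\<dots> = 2 * \<sigma>" using \<sigma> by (simp add: norm_mult)
      finally show "norm (?a \<sigma> - ?c \<sigma>) \<le> 2 * \<sigma>" .
    qed (use C in \<open>auto intro!: mult_nonneg_nonneg add_nonneg_nonneg\<close>)
    also have "\<dots> = C' * ((\<sigma> powr (tau n - 1) * \<sigma>) * exp (- \<mu> * \<sigma>))"
      unfolding C'_def by (simp only: mult_ac mult_minus_left mult_minus_right)
    also have "\<sigma> powr (tau n - 1) * \<sigma> = \<sigma> powr tau n" using \<sigma> by (simp add: powr_diff)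
    finally show ?thesis unfolding D_def .
  qed
  have lim0: "(D \<longlongrightarrow> 0) (at_right 0)"
  proof (rule Lim_null_comparison)
    show "\<forall>\<^sub>F \<sigma> in at_right 0. norm (D \<sigma>) \<le> C' * (\<sigma> powr tau n * exp (- \<mu> * \<sigma>))"
      using eventually_at_right_less[of 0] by eventually_elim (rule Db)
    have "((\<lambda>\<sigma>. \<sigma> powr tau n) \<longlongrightarrow> 0 powr tau n) (at_right (0::real))"
      by (rule tendsto_powr') (use tau_pos[of n] eventually_at_right_less[of "0::real"] in \<open>auto elim: eventually_mono\<close>)
    from tendsto_mult[OF tendsto_const[of C'] tendsto_mult[OF this tendsto_exp[OF tendsto_mult[OF tendsto_const[of "- \<mu>"] tendsto_ident_at]]]]
    show "((\<lambda>\<sigma>. C' * (\<sigma> powr tau n * exp (- \<mu> * \<sigma>))) \<longlongrightarrow> 0) (at_right 0)" by simp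
  qed
  have liminf: "(D \<longlongrightarrow> 0) at_top"
  proof (rule Lim_null_comparison)
    show "\<forall>\<^sub>F \<sigma> in at_top. norm (D \<sigma>) \<le> C' * (\<sigma> powr tau n * exp (- \<mu> * \<sigma>))"
      using eventually_gt_at_top[of 0] by eventually_elim (rule Db)
    show "((\<lambda>\<sigma>. C' * (\<sigma> powr tau n * exp (- \<mu> * \<sigma>))) \<longlongrightarrow> 0) at_top"
      by (rule tendsto_mult_right_zero[OF tendsto_powr_mult_exp_0[OF \<mu>(1)]])
  qed
  note ia = ray_integrand_integrable[OF c(1) re(1), of n] and ic = ray_integrand_integrable[OF c(2) re(2), of n]
  have "integral {0<..} (\<lambda>\<sigma>. ?fa \<sigma> - ?fc \<sigma>) = 0 - 0"
  proof (rule half_line_FTC_eq[OF _ _ Dd lim0 liminf])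
    show "(\<lambda>\<sigma>. ?fa \<sigma> - ?fc \<sigma>) absolutely_integrable_on {0<..}" by (rule set_integral_diff(1)[OF ia ic])
    show "continuous_on {0<..} (\<lambda>\<sigma>. ?fa \<sigma> - ?fc \<sigma>)"
      by (intro continuous_on_diff ray_integrand_continuous c)
  qed
  moreover have "integral {0<..} (\<lambda>\<sigma>. ?fa \<sigma> - ?fc \<sigma>) = terminant n \<alpha> \<nu> - terminant n \<beta> \<nu>"
    unfolding terminant_def by (intro integral_diff set_lebesgue_integral_eq_integral(1) ia ic)
  ultimately show ?thesis by simp
qed

section \<open>The path of steepest descent\<close>

lemma Im_cosh: "Im (cosh t) = sinh (Re t) * sin (Im t)"
  by (simp add: cosh_field_def sinh_field_def Im_exp algebra_simps diff_divide_distrib)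

text \<open>On \<open>sd\<close> the phase decreases from \<open>0\<close> to \<open>- \<infinity>\<close> along the real axis, by the equation
  \<open>cosh x = v / sin v\<close> for \<open>sd v = x + i v\<close>. The path is only meant for \<open>0 < v < \<pi>\<close>.\<close>

definition sd :: "real \<Rightarrow> complex" where
  "sd v = Complex (arcosh (v / sin v)) v"

definition sd_height :: "real \<Rightarrow> real" where
  "sd_height v = - Re (phase (sd v))"

lemma sd_sel [simp]: "Re (sd v) = arcosh (v / sin v)" "Im (sd v) = v"
  by (simp_all add: sd_def)

lemma sin_less_self:
  assumes "0 < v" "v < pi"
  shows "sin v < (v::real)"
proof -
  have "0 - sin 0 < v - sin v"
  proof (rule DERIV_pos_imp_increasing_open[OF assms(1)])
    fix y :: real assume y: "0 < y" "y < v"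
    have "((\<lambda>y. y - sin y) has_real_derivative 1 - cos y) (at y)"
      by (auto intro!: derivative_eq_intros)
    moreover have "cos y < 1" using cos_monotone_0_pi[of 0 y] y assms by simp
    ultimately show "\<exists>D. ((\<lambda>y. y - sin y) has_real_derivative D) (at y) \<and> 0 < D"
      by (intro exI[of _ "1 - cos y"]) auto
  qed (intro continuous_intros)
  then show ?thesis by simp
qed

context
  fixes v :: real
  assumes v: "0 < v" "v < pi"
begin

lemma sd_sin_pos: "sin v > 0"
  using v by (rule sin_gt_zero)

lemma sd_ratio: "v / sin v > 1"
  using sd_sin_pos sin_less_self[OF v] by simp

lemma cosh_sd: "cosh (Re (sd v)) = v / sin v"
  using sd_ratio by simp

lemma Re_sd_pos: "Re (sd v) > 0"
  unfolding sd_sel using arcosh_real_gt_1_iff[of "v / sin v"] sd_ratio by (metis less_imp_le less_irrefl)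

lemma sd_in_strip: "sd v \<in> strip"
  using v pi_gt_zero by (simp add: strip_def)

lemma Im_phase_sd: "Im (phase (sd v)) = 0"
  unfolding Im_phase cosh_sd using sd_sin_pos by simp

lemma phase_sd: "phase (sd v) = - of_real (sd_height v)"
  using Im_phase_sd by (simp add: complex_eq_iff sd_height_def)

lemma sd_height_pos: "sd_height v > 0"
  using phase_real_values[of "sd v"] v Re_sd_pos Im_phase_sd pi_gt_zero
  by (auto simp: sd_height_def simp del: sd_sel(1))

lemma cosh_sd_ne_1: "cosh (sd v) - 1 \<noteq> 0"
proof -
  have "Im (cosh (sd v) - 1) > 0"
    using Re_sd_pos sd_sin_pos by (simp add: Im_cosh del: sd_sel(1))
  then show ?thesis by auto
qed

text \<open>The phase stays real along the path, so its derivative sd' (cosh - 1) is real. Since Im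
  sd' = 1 and Im (cosh - 1) > 0, this number is negative: the height increases and can replace v as
  the parameter.\<close>

lemma sd_DERIV:
  obtains D s' where "(sd has_vector_derivative Complex D 1) (at v)"
    "(sd_height has_real_derivative s') (at v)" "s' > 0"
    "Complex D 1 = - of_real s' / (cosh (sd v) - 1)"
proof -
  have "((\<lambda>v. v / sin v) has_real_derivative (sin v - v * cos v) / (sin v * sin v)) (at v)"
    using sd_sin_pos by (auto intro!: derivative_eq_intros)
  from DERIV_chain2[OF arcosh_real_has_field_derivative[OF sd_ratio] this]
  obtain D where D: "((\<lambda>v. arcosh (v / sin v)) has_real_derivative D) (at v)" by blast
  have sd: "(sd has_vector_derivative Complex D 1) (at v)"
    unfolding sd_def Complex_eq
    by (auto intro!: derivative_eq_intros D simp: complex_eq_iff)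
  define q where "q = Complex D 1 * (cosh (sd v) - 1)"
  have ph: "((\<lambda>v. phase (sd v)) has_vector_derivative q) (at v)"
    using field_vector_diff_chain_at[OF sd DERIV_phase] by (simp add: o_def q_def)
  have "((\<lambda>v. Im (phase (sd v))) has_real_derivative Im q) (at v)"
    using bounded_linear.has_vector_derivative[OF bounded_linear_Im ph]
    by (simp add: has_real_derivative_iff_has_vector_derivative)
  moreover have "((\<lambda>v. Im (phase (sd v))) has_real_derivative 0) (at v)"
  proof (rule DERIV_cong_ev[OF refl _ refl, THEN iffD2])
    have "\<forall>\<^sub>F u in nhds v. u \<in> {0<..<pi}" using v by (intro eventually_nhds_in_open) auto
    then show "\<forall>\<^sub>F u in nhds v. Im (phase (sd u)) = 0"
    proof eventually_elim
      case (elim u)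
      then have u: "0 < u" "u < pi" by auto
      have "sin u > 0" "u / sin u > 1" using sin_gt_zero[OF u] sin_less_self[OF u] by auto
      then show ?case by (simp add: Im_phase)
    qed
  qed simp
  ultimately have "Im q = 0" by (rule DERIV_unique)
  define s' where "s' = - Re q"
  have q: "q = - of_real s'" using \<open>Im q = 0\<close> by (simp add: s'_def complex_eq_iff)
  have "((\<lambda>v. Re (phase (sd v))) has_real_derivative Re q) (at v)"
    using bounded_linear.has_vector_derivative[OF bounded_linear_Re ph]
    by (simp add: has_real_derivative_iff_has_vector_derivative)
  then have h: "(sd_height has_real_derivative s') (at v)"
    unfolding sd_height_def[abs_def] s'_def by (rule DERIV_minus)
  have eq: "Complex D 1 = - of_real s' / (cosh (sd v) - 1)"
    using q cosh_sd_ne_1 by (simp add: q_def field_simps)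
  have ic: "Im (cosh (sd v) - 1) > 0"
    using Re_sd_pos sd_sin_pos by (simp add: Im_cosh del: sd_sel(1))
  have "Im (- of_real s' / (cosh (sd v) - 1)) = s' * Im (cosh (sd v) - 1) / (cmod (cosh (sd v) - 1))\<^sup>2"
    by (simp add: Im_divide cmod_power2)
  moreover have "Im (- of_real s' / (cosh (sd v) - 1)) = 1" by (simp only: eq[symmetric] complex.sel)
  ultimately have "s' * Im (cosh (sd v) - 1) / (cmod (cosh (sd v) - 1))\<^sup>2 = 1" by (simp only:)
  then have "s' * Im (cosh (sd v) - 1) > 0"
    using cosh_sd_ne_1 by (metis zero_less_one zero_less_divide_iff zero_le_power2 not_less)
  then have "s' > 0" using ic by (simp add: zero_less_mult_iff)
  with sd h eq that show ?thesis by blast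
qed

text \<open>The branch is followed along the horizontal segment from i v to \<open>sd v\<close>.
  There Re (i phase) = v - cosh x sin v is not negative, so the principal logarithm of i phase is
  continuous. It starts at a positive number and ends at - i times the height; a third of the
  argument - \<pi>/2, together with the factor i, leaves \<pi>/3.\<close>

lemma croot_sd: "croot (sd v) = of_real (root 3 (sd_height v)) * cis (pi / 3)"
proof -
  define X where "X = Re (sd v)"
  have X: "X > 0" using Re_sd_pos by (simp add: X_def)
  let ?p = "\<lambda>x. \<i> * phase (Complex x v)"
  have str: "Complex x v \<in> strip" for x using v pi_gt_zero by (simp add: strip_def)
  have re: "?p x \<notin> \<real>\<^sub>\<le>\<^sub>0" if "x \<in> {0..X}" for x
  proof
    assume p: "?p x \<in> \<real>\<^sub>\<le>\<^sub>0"
    have "cosh x \<le> cosh X" using that by (simp add: cosh_real_nonneg_le_iff)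
    then have "cosh x * sin v \<le> (v / sin v) * sin v"
      using cosh_sd sd_sin_pos unfolding X_def by (intro mult_right_mono) auto
    then have "Re (?p x) \<ge> 0" using sd_sin_pos by (simp add: Im_phase)
    then have "?p x = 0" using p by (auto simp: complex_nonpos_Reals_iff complex_eq_iff)
    then have "phase (Complex x v) = 0" by simp
    then show False using phase_eq_0_iff[OF str] v by (auto simp: complex_eq_iff)
  qed
  then have nz: "?p x \<noteq> 0" if "x \<in> {0..X}" for x using that by (metis nonpos_Reals_zero_I)
  have rt: "exp (complex_of_real (ln r) / 3) = of_real (root 3 r)" if "r > 0" for r
  proof -
    have "root 3 r = exp (ln r / 3)" using root_powr_inverse[of 3 r] that by (simp add: powr_def)
    then show ?thesis by (simp flip: exp_of_real)
  qed
  have cont: "continuous_on {0..X} (\<lambda>x. Complex x v)" unfolding Complex_eq by (intro continuous_intros)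
  have "croot (Complex X v) = \<i> * exp (Ln (?p X) / 3)"
  proof (rule cube_root_unique[of "{0..X}" "\<lambda>x. croot (Complex x v)" "\<lambda>x. \<i> * exp (Ln (?p x) / 3)" 0])
    show "continuous_on {0..X} (\<lambda>x. croot (Complex x v))"
      by (rule continuous_on_compose2[OF holomorphic_on_imp_continuous_on[OF croot_holomorphic] cont]) (auto intro: str)
    have "continuous_on {0..X} (\<lambda>x. phase (Complex x v))"
      by (rule continuous_on_compose2[OF holomorphic_on_imp_continuous_on[OF phase_holomorphic[of UNIV]] cont]) auto
    then show "continuous_on {0..X} (\<lambda>x. \<i> * exp (Ln (?p x) / 3))"
      using re by (intro continuous_intros) auto
    show "croot (Complex x v) ^ 3 = (\<i> * exp (Ln (?p x) / 3)) ^ 3" if "x \<in> {0..X}" for x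
    proof -
      have "(\<i> * exp (Ln (?p x) / 3)) ^ 3 = \<i> ^ 3 * ?p x"
        unfolding power_mult_distrib exp_third_power3 using nz[OF that] by simp
      also have "\<dots> = phase (Complex x v)" by (simp add: power3_eq_cube)
      finally show ?thesis using croot_power3[OF str] by simp
    qed
    have r: "v - sin v > 0" using sin_less_self[OF v] by simp
    have "?p 0 = of_real (v - sin v)" by (simp add: complex_eq_iff Re_phase Im_phase)
    then have "Ln (?p 0) = of_real (ln (v - sin v))" using r by (simp only: Ln_of_real)
    then show "croot (Complex 0 v) = \<i> * exp (Ln (?p 0) / 3)"
      using croot_imaginary_axis[of v] v pi_gt_zero rt[OF r] by simp
  qed (use X in auto)
  moreover have "Complex X v = sd v" by (simp add: X_def sd_def)
  moreover have "\<i> * exp (Ln (\<i> * phase (sd v)) / 3) = of_real (root 3 (sd_height v)) * cis (pi / 3)"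
  proof -
    have "\<i> * phase (sd v) = of_real (sd_height v) * (- \<i>)" by (simp add: phase_sd)
    then have "Ln (\<i> * phase (sd v)) = of_real (ln (sd_height v)) + Ln (- \<i>)"
      using Ln_times_of_real[OF sd_height_pos, of "- \<i>"] Ln_of_real[OF sd_height_pos]
      by (metis complex_i_not_zero neg_equal_0_iff_equal)
    then have "exp (Ln (\<i> * phase (sd v)) / 3) = exp (of_real (ln (sd_height v)) / 3) * exp (\<i> * of_real (- pi / 6))"
      by (simp add: exp_add[symmetric] add_divide_distrib diff_divide_distrib)
    then have "\<i> * exp (Ln (\<i> * phase (sd v)) / 3) = of_real (root 3 (sd_height v)) * (\<i> * cis (- pi / 6))"
      unfolding rt[OF sd_height_pos] cis_conv_exp by simp
    also have "\<i> * cis (- pi / 6) = cis (pi / 2) * cis (- pi / 6)" by simp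
    also have "\<dots> = cis (pi / 3)" unfolding cis_mult by (intro arg_cong[of _ _ cis]) simp
    finally show ?thesis .
  qed
  ultimately show ?thesis by simp
qed

lemma deriv_croot_sd: "3 * croot (sd v) ^ 2 * deriv croot (sd v) = cosh (sd v) - 1"
proof -
  have "(croot has_field_derivative deriv croot (sd v)) (at (sd v))"
    by (rule holomorphic_derivI[OF croot_holomorphic open_strip sd_in_strip])
  then have "((\<lambda>t. croot t ^ 3) has_field_derivative 3 * croot (sd v) ^ 2 * deriv croot (sd v)) (at (sd v))"
    by (auto intro!: derivative_eq_intros)
  moreover have "((\<lambda>t. croot t ^ 3) has_field_derivative cosh (sd v) - 1) (at (sd v))"
  proof (rule DERIV_cong_ev[OF refl _ refl, THEN iffD2])
    have "\<forall>\<^sub>F t in nhds (sd v). t \<in> strip" using open_strip sd_in_strip by (rule eventually_nhds_in_open)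
    then show "\<forall>\<^sub>F t in nhds (sd v). croot t ^ 3 = phase t" by eventually_elim (rule croot_power3)
  qed (rule DERIV_phase)
  ultimately show ?thesis by (rule DERIV_unique)
qed

end

lemma sd_height_strict_mono:
  assumes "0 < v" "v < w" "w < pi"
  shows "sd_height v < sd_height w"
proof (rule DERIV_pos_imp_increasing[OF assms(2)])
  fix x assume "v \<le> x" "x \<le> w"
  then show "\<exists>y. (sd_height has_real_derivative y) (at x) \<and> 0 < y"
    using sd_DERIV[of x] assms by (metis less_le_trans le_less_trans)
qed

text \<open>Beyond \<open>\<bar>Im t\<bar> = 2 \<pi>\<close> the equation \<open>croot t = croot (sd v)\<close> does acquire further solutions,
  but their real parts are large when \<open>\<bar>Im t\<bar>\<close> is close to \<open>2 \<pi>\<close>; hence the thin margin \<open>\<delta>\<close>.\<close>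

lemma croot_eq_croot_sd:
  assumes v: "0 < v" "v < pi"
  obtains \<delta> where "0 < \<delta>" "\<delta> \<le> 1/2" "\<And>t. \<bar>Im t\<bar> < 2 * pi + \<delta> \<Longrightarrow> croot t = croot (sd v) \<Longrightarrow> t = sd v"
proof -
  define s where "s = sd_height v"
  \<comment> \<open>A further solution has |Im t| = 2 \<pi> + u with cosh x sin u > 6. The choice of
    \<open>\<delta>\<close> then forces x > x0, where the phase is at least (sinh x - 2 x) / 2 >= x
    / 2 > s; the bound 10 is the threshold of \<open>sinh_minus_double_ge\<close>.\<close>
  define x0 where "x0 = max 10 (2 * s + 1)"
  define \<delta> where "\<delta> = min (1/2) (6 / cosh x0)"
  have s: "s > 0" using sd_height_pos[OF v] by (simp add: s_def)
  have d: "0 < \<delta>" "\<delta> \<le> 1/2" by (auto simp: \<delta>_def)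
  have "\<delta> \<le> 6 / cosh x0" by (simp add: \<delta>_def)
  then have d2: "cosh x0 * \<delta> \<le> 6" by (simp add: pos_le_divide_eq mult.commute)
  have "t = sd v" if t: "\<bar>Im t\<bar> < 2 * pi + \<delta>" and eq: "croot t = croot (sd v)" for t
  proof -
    have ts: "t \<in> strip" using t d by (simp add: strip_def)
    have "phase t = phase (sd v)"
      using croot_power3[OF ts] croot_power3[OF sd_in_strip[OF v]] eq by simp
    then have ph: "phase t = - of_real s" using phase_sd[OF v] by (simp add: s_def)
    \<comment> \<open>The equation for the phase alone is also solved by the conjugate point; the
      positive imaginary part of the root excludes it, and real t as well.\<close>
    have Imc: "Im (croot (sd v)) > 0"
    proof -
      have "sin (pi / 3) > 0" by (intro sin_gt_zero) auto
      moreover have "root 3 (sd_height v) > 0" using sd_height_pos[OF v] by simp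
      ultimately show ?thesis unfolding croot_sd[OF v] by (simp del: sin_pi_divide_n_ge_0)
    qed
    have Imt: "Im t \<noteq> 0"
    proof
      assume "Im t = 0"
      then have "cnj t = t" by (simp add: complex_eq_iff)
      then have "cnj (croot t) = croot t" using croot_cnj[OF ts] by simp
      then have "Im (croot t) = 0" by (simp add: complex_eq_iff)
      then show False using Imc eq by simp
    qed
    let ?t = "Complex \<bar>Re t\<bar> \<bar>Im t\<bar>"
    have re: "Re (phase t) = - s" and im: "Im (phase t) = 0" using ph by auto
    have im': "Im (phase ?t) = 0" using im by (auto simp: Im_phase abs_if)
    have re': "Re (phase ?t) = (if Re t \<ge> 0 then - s else s)"
      using re by (auto simp: Re_phase abs_if)
    have "Re t \<ge> 0 \<and> \<bar>Im t\<bar> < pi \<and> \<bar>Re t\<bar> > 0"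
    proof (rule ccontr)
      assume neg: "\<not> ?thesis"
      have big: "2 * pi < \<bar>Im t\<bar>" and x: "\<bar>Re t\<bar> > 0" and rs: "Re (phase ?t) = s"
        using phase_real_values[of ?t] im' re' s neg Imt ts by (auto simp: strip_def split: if_splits)
      define x u where "x = \<bar>Re t\<bar>" and "u = \<bar>Im t\<bar> - 2 * pi"
      have u: "0 < u" "u < \<delta>" using big t by (auto simp: u_def)
      have sc: "sin \<bar>Im t\<bar> = sin u" "cos \<bar>Im t\<bar> = cos u"
        using sin_periodic[of u] cos_periodic[of u] by (auto simp: u_def)
      have "cosh x * sin u = \<bar>Im t\<bar>" using im' sc by (simp add: Im_phase x_def)
      moreover have "cosh x * sin u \<le> cosh x * u" using sin_x_le_x[of u] u by (intro mult_left_mono) auto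
      moreover have "cosh x * u \<le> cosh x * \<delta>" using u by (intro mult_left_mono) auto
      ultimately have "6 < cosh x * \<delta>" using big pi_gt3 by linarith
      then have "cosh x0 * \<delta> < cosh x * \<delta>" using d2 by linarith
      then have "cosh x0 < cosh x" using d by simp
      moreover have "x0 \<ge> 0" "x \<ge> 0" by (auto simp: x0_def x_def)
      ultimately have xx: "x0 < x" by (simp add: cosh_real_nonneg_less_iff)
      have "cos u \<ge> cos (pi / 3)" using u d pi_gt3 by (intro cos_monotone_0_pi_le) auto
      then have "cos u \<ge> 1/2" by (simp add: cos_60)
      moreover have "sinh x > 0" using x by (simp add: x_def)
      ultimately have "sinh x * (1/2) \<le> sinh x * cos u" by (intro mult_left_mono) auto
      moreover have "sinh x * cos u - x = s" using rs sc by (simp add: Re_phase x_def)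
      ultimately have "sinh x - 2 * x \<le> 2 * s" by linarith
      moreover have "x \<le> sinh x - 2 * x" using xx by (intro sinh_minus_double_ge) (simp add: x0_def)
      ultimately show False using xx by (simp add: x0_def)
    qed
    then have t1: "Re t > 0" "\<bar>Im t\<bar> < pi" by auto
    define w where "w = \<bar>Im t\<bar>"
    have w: "0 < w" "w < pi" using t1 Imt by (auto simp: w_def)
    have "cosh (Re t) * sin w = w" using im' t1 by (simp add: Im_phase w_def)
    then have "cosh (Re t) = w / sin w" using sd_sin_pos[OF w] by (simp add: field_simps)
    then have "arcosh (w / sin w) = Re t" using arcosh_cosh_real[of "Re t"] t1 by simp
    then have tw: "?t = sd w" using t1 by (simp add: sd_def w_def)
    then have "sd_height w = sd_height v" using re' t1 by (simp add: sd_height_def s_def)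
    then have "w = v" using sd_height_strict_mono[of v w] sd_height_strict_mono[of w v] v w
      by (metis less_irrefl linorder_less_linear)
    show "t = sd v"
    proof (cases "Im t > 0")
      case True
      then show ?thesis using tw \<open>w = v\<close> t1 by (simp add: complex_eq_iff)
    next
      case False
      then have "t = cnj (sd v)" using tw \<open>w = v\<close> t1 by (simp add: complex_eq_iff)
      then have "croot t = cnj (croot (sd v))" using croot_cnj[OF sd_in_strip[OF v]] by simp
      then have "Im (croot (sd v)) = 0" using eq by (simp add: complex_eq_iff)
      then show ?thesis using Imc by simp
    qed
  qed
  with d that show ?thesis by blast
qed


section \<open>The Stieltjes kernel on the image of the descent path\<close>

definition ray_root :: "real \<Rightarrow> complex" where
  "ray_root s = of_real (root 3 s) * cis (pi / 3)"

lemma ray_root_power6: "ray_root s ^ 6 = of_real (s\<^sup>2)"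
proof -
  have "root 3 s ^ 6 = (root 3 s ^ 3)\<^sup>2" by (simp add: power_mult[symmetric])
  moreover have "cis (pi / 3) ^ 6 = 1"
    by (simp add: Complex.DeMoivre)
  ultimately show ?thesis
    by (simp add: ray_root_def power_mult_distrib odd_real_root_pow del: of_real_power flip: of_real_power)
qed

text \<open>w^2 has argument 2 \<pi> / 3, so r^2 and w^2 cannot cancel. With q = |w|^2 the squared
  modulus is r^4 - r^2 q + q^2, and completing a square leaves at least r^4 / 4, uniformly in
  s.\<close>

lemma ray_denominator_ge:
  assumes "r > 0"
  shows "r\<^sup>2 / 2 \<le> norm ((complex_of_real r)\<^sup>2 + (ray_root s)\<^sup>2)"
proof -
  define q where "q = (root 3 s)\<^sup>2"
  have "(ray_root s)\<^sup>2 = of_real q * cis (2 * pi / 3)"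
    by (simp add: ray_root_def power_mult_distrib Complex.DeMoivre q_def)
  then have "(norm ((complex_of_real r)\<^sup>2 + (ray_root s)\<^sup>2))\<^sup>2 = (r\<^sup>2 + q * cos (2 * pi / 3))\<^sup>2 + (q * sin (2 * pi / 3))\<^sup>2"
    by (simp add: cmod_power2)
  also have "\<dots> = (r\<^sup>2 - q / 2)\<^sup>2 + (q * sqrt 3 / 2)\<^sup>2"
    unfolding cos_120 sin_120 by simp
  also have "\<dots> = (r\<^sup>2 / 2)\<^sup>2 + 3 * (r\<^sup>2 / 2)\<^sup>2 - r\<^sup>2 * q + q\<^sup>2"
    by (simp add: power2_eq_square algebra_simps)
  also have "\<dots> = (r\<^sup>2 / 2)\<^sup>2 + (3 * (r\<^sup>2 / 2 - q / 3)\<^sup>2 + 2 / 3 * q\<^sup>2)"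
    by (simp add: power2_eq_square algebra_simps)
  also have "\<dots> \<ge> (r\<^sup>2 / 2)\<^sup>2" by simp
  finally show ?thesis by (rule power2_le_imp_le) simp
qed

text \<open>The Stieltjes integral for dt/dw at w = \<open>ray_root s\<close>. It makes sense for
  all s, and \<open>root_kernel_sd\<close> identifies it at the heights reached by the path.\<close>

definition root_kernel :: "real \<Rightarrow> complex" where
  "root_kernel s = of_real (2 / pi) * integral {0<..} (\<lambda>x. of_real (rho x) / ((of_real (rho x))\<^sup>2 + (ray_root s)\<^sup>2))"

lemma root_kernel_integrable:
  "(\<lambda>x. complex_of_real (rho x) / ((of_real (rho x))\<^sup>2 + (ray_root s)\<^sup>2)) absolutely_integrable_on {0<..}"
proof (rule absolutely_integrable_rho_bound[where C=2])
  have nz: "(complex_of_real (rho x))\<^sup>2 + (ray_root s)\<^sup>2 \<noteq> 0" if "x > 0" for x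
  proof -
    have "(rho x)\<^sup>2 / 2 > 0" using rho_pos[of x] that by simp
    then show ?thesis using ray_denominator_ge[of "rho x" s] rho_pos[of x] that by (metis less_imp_le norm_zero not_less)
  qed
  show "continuous_on {0<..} (\<lambda>x. complex_of_real (rho x) / ((of_real (rho x))\<^sup>2 + (ray_root s)\<^sup>2))"
    using nz by (intro continuous_intros rho_continuous_Ioi) auto
  show "norm (complex_of_real (rho x) / ((of_real (rho x))\<^sup>2 + (ray_root s)\<^sup>2)) \<le> 2 / rho x" if "x > 0" for x
  proof -
    have r: "rho x > 0" using rho_pos[of x] that by simp
    have "norm (complex_of_real (rho x) / ((of_real (rho x))\<^sup>2 + (ray_root s)\<^sup>2)) \<le> rho x / ((rho x)\<^sup>2 / 2)"
      unfolding norm_divide using r ray_denominator_ge[OF r, of s] nz[OF that]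
      by (intro frac_le) auto
    also have "\<dots> = 2 / rho x" using r by (simp add: power2_eq_square)
    finally show ?thesis .
  qed
qed simp

lemma root_kernel_sd:
  assumes v: "0 < v" "v < pi"
  shows "root_kernel (sd_height v) = 3 * (ray_root (sd_height v))\<^sup>2 / (cosh (sd v) - 1)"
proof -
  have w: "croot (sd v) = ray_root (sd_height v)" using croot_sd[OF v] by (simp add: ray_root_def)
  obtain \<delta> where d: "0 < \<delta>" "\<delta> \<le> 1/2" "\<And>t. \<bar>Im t\<bar> < 2 * pi + \<delta> \<Longrightarrow> croot t = croot (sd v) \<Longrightarrow> t = sd v"
    using croot_eq_croot_sd[OF v] by blast
  define S where "S = {t. \<bar>Im t\<bar> < 2 * pi + \<delta>}"
  have S_eq: "S = {t. Im t < 2 * pi + \<delta>} \<inter> {t. Im t > - (2 * pi + \<delta>)}"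
    by (auto simp: S_def abs_less_iff)
  have e: "3 * (croot (sd v))\<^sup>2 * deriv croot (sd v) = cosh (sd v) - 1" by (rule deriv_croot_sd[OF v])
  then have dn: "deriv croot (sd v) \<noteq> 0" "croot (sd v) \<noteq> 0" using cosh_sd_ne_1[OF v] by auto
  have "integral {0<..} (\<lambda>x. of_real (rho x) / ((of_real (rho x))\<^sup>2 + (croot (sd v))\<^sup>2)) = pi / 2 * (1 / deriv croot (sd v))"
  proof (rule integral_rho_stieltjes)
    show "open S" unfolding S_eq by (intro open_Int open_halfspace_Im_lt open_halfspace_Im_gt)
    show "convex S" unfolding S_eq by (intro convex_Int convex_halfspace_Im_lt convex_halfspace_Im_gt)
    show "S \<subseteq> strip" using d(2) by (auto simp: S_def strip_def)
    show "t \<in> S" if "\<bar>Im t\<bar> \<le> 2 * pi" for t using that d(1) by (simp add: S_def)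
    show "\<bar>Im (sd v)\<bar> \<le> 3 * pi / 2" using v by simp
    show "t = sd v" if "t \<in> S" "croot t = croot (sd v)" for t using d(3) that by (simp add: S_def)
    show "(\<lambda>x. complex_of_real (rho x) / ((complex_of_real (rho x))\<^sup>2 + (croot (sd v))\<^sup>2)) absolutely_integrable_on {0<..}"
      unfolding w by (rule root_kernel_integrable)
  qed (rule dn)
  then have "root_kernel (sd_height v) = 1 / deriv croot (sd v)"
    unfolding root_kernel_def w[symmetric] by simp
  also have "\<dots> = 3 * (croot (sd v))\<^sup>2 / (3 * (croot (sd v))\<^sup>2 * deriv croot (sd v))"
    using dn by simp
  finally have "root_kernel (sd_height v) = 3 * (croot (sd v))\<^sup>2 / (cosh (sd v) - 1)" by (simp only: e)
  then show ?thesis by (simp only: w)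
qed

text \<open>This is Im (dt/ds), by the chain rule with dw/ds = cis (\<pi>/3) s^(-2/3) / 3.\<close>

definition bessel_density :: "real \<Rightarrow> real" where
  "bessel_density s = Im (root_kernel s * cis (pi / 3)) * s powr (-2/3) / 3"

text \<open>The path is parametrized by its own imaginary part, so the density is dv/ds, the
  reciprocal of the derivative of the height.\<close>

lemma bessel_density_sd:
  assumes v: "0 < v" "v < pi" and s': "Complex D 1 = - of_real s' / (cosh (sd v) - 1)"
  shows "bessel_density (sd_height v) * s' = 1"
proof -
  define s where "s = sd_height v"
  have s: "s > 0" using sd_height_pos[OF v] by (simp add: s_def)
  have r: "(root 3 s)\<^sup>2 * s powr (-2/3) = 1"
  proof -
    have "(root 3 s)\<^sup>2 = s powr (1/3) * s powr (1/3)" using root_powr_inverse[of 3 s] s by (simp add: power2_eq_square)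
    then have "(root 3 s)\<^sup>2 * s powr (-2/3) = s powr (1/3 + 1/3 + (-2/3))" by (simp only: powr_add)
    then show ?thesis using s by simp
  qed
  have "(ray_root s)\<^sup>2 * cis (pi / 3) = of_real ((root 3 s)\<^sup>2) * cis (pi / 3) ^ 3"
    by (simp add: ray_root_def power_mult_distrib power2_eq_square power3_eq_cube)
  also have "cis (pi / 3) ^ 3 = -1" by (simp add: Complex.DeMoivre)
  finally have w: "(ray_root s)\<^sup>2 * cis (pi / 3) = - of_real ((root 3 s)\<^sup>2)" by simp
  have "root_kernel s * cis (pi / 3) = 3 * ((ray_root s)\<^sup>2 * cis (pi / 3)) / (cosh (sd v) - 1)"
    using root_kernel_sd[OF v] by (simp add: s_def)
  also have "\<dots> * of_real s' = of_real (3 * (root 3 s)\<^sup>2) * (- of_real s' / (cosh (sd v) - 1))"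
    unfolding w by simp
  also have "\<dots> = of_real (3 * (root 3 s)\<^sup>2) * Complex D 1" by (simp only: s')
  finally have "Im (root_kernel s * cis (pi / 3) * of_real s') = 3 * (root 3 s)\<^sup>2" by simp
  then have "Im (root_kernel s * cis (pi / 3)) * s' = 3 * (root 3 s)\<^sup>2" by simp
  moreover have "bessel_density s * s' = (Im (root_kernel s * cis (pi / 3)) * s') * s powr (-2/3) / 3"
    by (simp add: bessel_density_def)
  ultimately show ?thesis using r by (simp add: s_def)
qed


text \<open>The alternating sign of \<open>B0 (2 * n)\<close> is moved to the sine, which leaves the
  nonnegative moments as the other factor.\<close>

definition sine_coeff :: "nat \<Rightarrow> real" where
  "sine_coeff n = (- 1) ^ n * sin (real (2 * n + 1) * pi / 3)"

lemma ray_root_even_power: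
  assumes "s > 0"
  shows "Im ((ray_root s) ^ (2 * n) * cis (pi / 3) * of_real r) * s powr (-2/3) = s powr (tau n - 1) * sin (real (2 * n + 1) * pi / 3) * r"
proof -
  have "(ray_root s) ^ (2 * n) * cis (pi / 3) = of_real (root 3 s ^ (2 * n)) * cis (real (2 * n + 1) * pi / 3)"
    unfolding ray_root_def power_mult_distrib Complex.DeMoivre mult.assoc cis_mult
    by (simp add: algebra_simps add_divide_distrib)
  then have X: "Im ((ray_root s) ^ (2 * n) * cis (pi / 3) * of_real r) = root 3 s ^ (2 * n) * sin (real (2 * n + 1) * pi / 3) * r"
    by (simp del: of_nat_Suc of_nat_add of_nat_mult)
  have P: "root 3 s ^ (2 * n) * s powr (-2/3) = s powr (tau n - 1)"
  proof -
    have "root 3 s ^ (2 * n) = (s powr (1/3)) powr real (2 * n)"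
    proof -
      have "root 3 s ^ (2 * n) = (s powr (1/3)) ^ (2 * n)" using root_powr_inverse[of 3 s] assms by simp
      also have "\<dots> = (s powr (1/3)) powr real (2 * n)"
        by (rule powr_realpow[symmetric]) (use assms in simp)
      finally show ?thesis .
    qed
    then have "root 3 s ^ (2 * n) * s powr (-2/3) = s powr (1/3 * real (2 * n) + (-2/3))"
      by (simp only: powr_powr powr_add)
    also have "1/3 * real (2 * n) + (-2/3) = tau n - 1" by (simp add: tau_def field_simps)
    finally show ?thesis .
  qed
  have "Im ((ray_root s) ^ (2 * n) * cis (pi / 3) * of_real r) * s powr (-2/3)
      = (root 3 s ^ (2 * n) * s powr (-2/3)) * sin (real (2 * n + 1) * pi / 3) * r"
    unfolding X by (simp only: mult_ac)
  then show ?thesis by (simp only: P)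
qed

text \<open>After N geometric terms, 1 / (r + q) = (r^2 - r q + q^2) / (r^3 + q^3). With q = w^2 on
  the ray, q^3 = s^2, so the denominator depends on s without any cube root.\<close>

lemma geometric_remainder:
  fixes q r :: complex
  assumes "r \<noteq> 0" "r + q \<noteq> 0" "r ^ 3 + q ^ 3 \<noteq> 0"
  shows "1 / (r + q) = (\<Sum>n<N. (- 1) ^ n * q ^ n / r ^ Suc n)
    + (\<Sum>n\<in>{N, N + 1, N + 2}. (- 1) ^ n * q ^ n / r ^ Suc n / (1 + q ^ 3 / r ^ 3))"
proof -
  have "1 / (r + q) = (\<Sum>n<N. (- 1) ^ n * q ^ n / r ^ Suc n) + (- q / r) ^ N / (r + q)"
  proof (induction N)
    case (Suc N)
    have "(- q / r) ^ N / (r + q) = (- 1) ^ N * q ^ N / r ^ Suc N + (- q / r) ^ Suc N / (r + q)"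
    proof -
      have "(- q / r) ^ N / (r + q) = (- q / r) ^ N * (1 / r + (- q / r) / (r + q))"
        using assms by (simp add: divide_simps)
      also have "\<dots> = (- q / r) ^ N / r + (- q / r) ^ Suc N / (r + q)"
      proof -
        have "A * (1 / r + y / (r + q)) = A / r + (y * A) / (r + q)" for A y
          by (simp add: distrib_left mult.commute)
        from this[of "(- q / r) ^ N" "- q / r"] show ?thesis by (simp only: power_Suc)
      qed
      also have "(- q / r) ^ N / r = (- 1) ^ N * q ^ N / r ^ Suc N"
        unfolding power_divide power_minus[of q N] by simp
      finally show ?thesis .
    qed
    then show ?case using Suc.IH by simp
  qed simp
  also have "(- q / r) ^ N / (r + q) = (\<Sum>n\<in>{N, N + 1, N + 2}. (- 1) ^ n * q ^ n / r ^ Suc n / (1 + q ^ 3 / r ^ 3))"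
  proof -
    have e: "1 / (r + q) = (1 / r - q / r\<^sup>2 + q\<^sup>2 / r ^ 3) / (1 + q ^ 3 / r ^ 3)"
    proof -
      have f: "r ^ 3 + q ^ 3 = (r + q) * (r\<^sup>2 - q * r + q\<^sup>2)" by algebra
      have "1 + q ^ 3 / r ^ 3 = (r ^ 3 + q ^ 3) / r ^ 3" using assms by (simp add: add_divide_distrib)
      moreover have "1 / r - q / r\<^sup>2 + q\<^sup>2 / r ^ 3 = (r\<^sup>2 - q * r + q\<^sup>2) / r ^ 3"
        using assms by (simp add: field_simps power2_eq_square power3_eq_cube)
      ultimately have "(1 / r - q / r\<^sup>2 + q\<^sup>2 / r ^ 3) / (1 + q ^ 3 / r ^ 3) = (r\<^sup>2 - q * r + q\<^sup>2) / (r ^ 3 + q ^ 3)"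
        using assms by simp
      also have "\<dots> = 1 / (r + q)" using assms unfolding f by simp
      finally show ?thesis by simp
    qed
    have p: "(- q / r) ^ N = (- 1) ^ N * q ^ N / r ^ N" unfolding power_divide power_minus[of q N] ..
    have "(- q / r) ^ N / (r + q) = ((- 1) ^ N * q ^ N / r ^ N) * (1 / (r + q))" unfolding p by simp
    also have "\<dots> = ((- 1) ^ N * q ^ N / r ^ N * (1 / r) - (- 1) ^ N * q ^ N / r ^ N * (q / r\<^sup>2)
        + (- 1) ^ N * q ^ N / r ^ N * (q\<^sup>2 / r ^ 3)) / (1 + q ^ 3 / r ^ 3)"
      unfolding e by (simp add: distrib_left right_diff_distrib)
    also have "\<dots> = (\<Sum>n\<in>{N, N + 1, N + 2}. (- 1) ^ n * q ^ n / r ^ Suc n / (1 + q ^ 3 / r ^ 3))"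
      by (simp add: power_add power2_eq_square power3_eq_cube add_divide_distrib diff_divide_distrib mult_ac)
    finally show ?thesis .
  qed
  finally show ?thesis .
qed

lemma root_kernel_expansion:
  assumes s: "s > 0"
  shows "root_kernel s = (\<Sum>n<N. (- 1) ^ n * ray_root s ^ (2 * n) * of_real (moment n))
    + (\<Sum>n\<in>{N, N + 1, N + 2}. (- 1) ^ n * ray_root s ^ (2 * n) * stieltjes n (of_real s))"
proof -
  let ?w = "ray_root s"
  let ?m = "\<lambda>n x. complex_of_real (1 / rho x ^ (2 * n + 1))"
  let ?S = "\<lambda>n x. ?m n x / (1 + (of_real s / complex_of_real (rho x ^ 3))\<^sup>2)"
  have re: "Re (complex_of_real s) > 0" using s by simp
  have pt: "complex_of_real (rho x) / ((of_real (rho x))\<^sup>2 + ?w\<^sup>2) =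
      (\<Sum>n<N. (- 1) ^ n * ?w ^ (2 * n) * ?m n x) + (\<Sum>n\<in>{N, N + 1, N + 2}. (- 1) ^ n * ?w ^ (2 * n) * ?S n x)"
    if "x \<in> {0<..}" for x
  proof -
    define \<rho> where "\<rho> = complex_of_real (rho x)"
    have x: "rho x > 0" using that rho_pos[of x] by simp
    then have r0: "\<rho> \<noteq> 0" by (simp add: \<rho>_def)
    have q3: "(?w\<^sup>2) ^ 3 = (of_real s)\<^sup>2" using ray_root_power6[of s] by (simp add: power_mult[symmetric])
    have "(rho x)\<^sup>2 / 2 > 0" using x by simp
    then have n1: "\<rho>\<^sup>2 + ?w\<^sup>2 \<noteq> 0" using ray_denominator_ge[OF x, of s] unfolding \<rho>_def by (metis norm_zero not_less)
    have "(\<rho>\<^sup>2) ^ 3 + (?w\<^sup>2) ^ 3 = of_real ((rho x) ^ 6 + s\<^sup>2)" unfolding q3 by (simp add: \<rho>_def power_mult[symmetric])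
    moreover have "(rho x) ^ 6 + s\<^sup>2 > 0" using x s by (intro add_pos_pos) auto
    ultimately have n2: "(\<rho>\<^sup>2) ^ 3 + (?w\<^sup>2) ^ 3 \<noteq> 0" by (metis of_real_eq_0_iff less_irrefl)
    have c: "\<rho> * ((- 1) ^ n * (?w\<^sup>2) ^ n / (\<rho>\<^sup>2) ^ Suc n) = (- 1) ^ n * ?w ^ (2 * n) * ?m n x" for n
    proof -
      have "(\<rho>\<^sup>2) ^ Suc n = \<rho> * \<rho> ^ (2 * n + 1)" by (simp add: power_mult power2_eq_square power_mult_distrib)
      moreover have "?m n x = 1 / \<rho> ^ (2 * n + 1)" by (simp add: \<rho>_def)
      moreover have "(?w\<^sup>2) ^ n = ?w ^ (2 * n)" by (simp add: power_mult)
      moreover have "\<rho> * (A / (\<rho> * B)) = A * (1 / B)" for A B using r0 by simp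
      ultimately show ?thesis by (simp only:)
    qed
    have d: "(?w\<^sup>2) ^ 3 / (\<rho>\<^sup>2) ^ 3 = (of_real s / complex_of_real (rho x ^ 3))\<^sup>2"
      unfolding q3 by (simp add: power_divide \<rho>_def power_mult[symmetric])
    have "\<rho> / (\<rho>\<^sup>2 + ?w\<^sup>2) = \<rho> * (1 / (\<rho>\<^sup>2 + ?w\<^sup>2))" by simp
    also have "\<dots> = (\<Sum>n<N. \<rho> * ((- 1) ^ n * (?w\<^sup>2) ^ n / (\<rho>\<^sup>2) ^ Suc n))
      + (\<Sum>n\<in>{N, N + 1, N + 2}. \<rho> * ((- 1) ^ n * (?w\<^sup>2) ^ n / (\<rho>\<^sup>2) ^ Suc n) / (1 + (?w\<^sup>2) ^ 3 / (\<rho>\<^sup>2) ^ 3))"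
      using geometric_remainder[OF _ n1 n2, of N] r0
      by (simp only: distrib_left sum_distrib_left times_divide_eq_right power_not_zero not_False_eq_True simp_thms)
    finally show ?thesis unfolding c d by (simp only: \<rho>_def times_divide_eq_right)
  qed
  have im: "(\<lambda>x. ?m n x) integrable_on {0<..}" "integral {0<..} (\<lambda>x. ?m n x) = of_real (integral {0<..} (\<lambda>x. 1 / rho x ^ (2 * n + 1)))" for n
  proof -
    have "((\<lambda>x. ?m n x) has_integral of_real (integral {0<..} (\<lambda>x. 1 / rho x ^ (2 * n + 1)))) {0<..}"
      by (intro has_integral_of_real integrable_integral set_lebesgue_integral_eq_integral(1) moment_integrable)
    then show "(\<lambda>x. ?m n x) integrable_on {0<..}" "integral {0<..} (\<lambda>x. ?m n x) = of_real (integral {0<..} (\<lambda>x. 1 / rho x ^ (2 * n + 1)))"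
      by (auto simp: has_integral_integrable integral_unique)
  qed
  have iS: "(\<lambda>x. ?S n x) integrable_on {0<..}" for n
    by (intro set_lebesgue_integral_eq_integral(1) stieltjes_integrand_integrable re)
  have "integral {0<..} (\<lambda>x. of_real (rho x) / ((of_real (rho x))\<^sup>2 + ?w\<^sup>2)) =
    integral {0<..} (\<lambda>x. (\<Sum>n<N. (- 1) ^ n * ?w ^ (2 * n) * ?m n x) + (\<Sum>n\<in>{N, N + 1, N + 2}. (- 1) ^ n * ?w ^ (2 * n) * ?S n x))"
    by (rule integral_cong[OF pt])
  also have "\<dots> = (\<Sum>n<N. (- 1) ^ n * ?w ^ (2 * n) * integral {0<..} (\<lambda>x. ?m n x))
    + (\<Sum>n\<in>{N, N + 1, N + 2}. (- 1) ^ n * ?w ^ (2 * n) * integral {0<..} (\<lambda>x. ?S n x))"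
    by (intro integral_unique has_integral_add has_integral_sum has_integral_mult_right integrable_integral im iS) auto
  finally have "root_kernel s = of_real (2 / pi) * \<dots>" unfolding root_kernel_def by simp
  also have "\<dots> = (\<Sum>n<N. (- 1) ^ n * ?w ^ (2 * n) * (of_real (2 / pi) * integral {0<..} (\<lambda>x. ?m n x)))
    + (\<Sum>n\<in>{N, N + 1, N + 2}. (- 1) ^ n * ?w ^ (2 * n) * (of_real (2 / pi) * integral {0<..} (\<lambda>x. ?S n x)))"
    by (simp only: distrib_left sum_distrib_left mult.left_commute)
  finally show ?thesis unfolding im(2) stieltjes_def moment_def of_real_mult .
qed

section \<open>The remainder in terms of terminants\<close>

definition stieltjes_re :: "nat \<Rightarrow> real \<Rightarrow> real" where
  "stieltjes_re n s = Re (stieltjes n (of_real s))"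

lemma stieltjes_of_real:
  assumes "s > 0"
  shows "stieltjes n (of_real s) = of_real (stieltjes_re n s)"
proof -
  let ?f = "\<lambda>x. complex_of_real (1 / rho x ^ (2 * n + 1)) / (1 + (of_real s / complex_of_real (rho x ^ 3))\<^sup>2)"
  have i: "?f integrable_on {0<..}"
    using assms by (intro set_lebesgue_integral_eq_integral(1) stieltjes_integrand_integrable) auto
  have "((\<lambda>x. Im (?f x)) has_integral Im (integral {0<..} ?f)) {0<..}"
    using has_integral_linear[OF integrable_integral[OF i] bounded_linear_Im] by (simp add: o_def)
  moreover have "Im (?f x) = 0" for x
  proof -
    have "?f x = of_real ((1 / rho x ^ (2 * n + 1)) / (1 + (s / rho x ^ 3)\<^sup>2))"
      by (simp only: of_real_divide of_real_add of_real_power of_real_1)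
    then show ?thesis by (simp only: Im_complex_of_real)
  qed
  ultimately have "Im (integral {0<..} ?f) = 0" using has_integral_0 has_integral_unique by fastforce
  then have "Im (stieltjes n (of_real s)) = 0" unfolding stieltjes_def by simp
  then show ?thesis by (simp add: stieltjes_re_def complex_eq_iff)
qed

lemma bessel_density_expansion:
  assumes s: "s > 0"
  shows "bessel_density s = ((\<Sum>n<N. sine_coeff n * moment n * s powr (tau n - 1))
    + (\<Sum>n\<in>{N, N + 1, N + 2}. sine_coeff n * (s powr (tau n - 1) * stieltjes_re n s))) / 3"
proof -
  have t: "Im ((- 1) ^ n * ray_root s ^ (2 * n) * of_real r * cis (pi / 3)) * s powr (-2/3)
      = sine_coeff n * r * s powr (tau n - 1)" for n r
  proof -
    have "(- 1) ^ n * ray_root s ^ (2 * n) * of_real r * cis (pi / 3)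
        = of_real ((- 1) ^ n) * (ray_root s ^ (2 * n) * cis (pi / 3) * of_real r)"
      by (simp only: of_real_power of_real_minus of_real_1 mult_ac)
    then have "Im ((- 1) ^ n * ray_root s ^ (2 * n) * of_real r * cis (pi / 3))
        = (- 1) ^ n * Im (ray_root s ^ (2 * n) * cis (pi / 3) * of_real r)"
      by (simp only: Im_complex_of_real Re_complex_of_real times_complex.sel mult_zero_left add_0_right)
    then have "Im ((- 1) ^ n * ray_root s ^ (2 * n) * of_real r * cis (pi / 3)) * s powr (-2/3)
        = (- 1) ^ n * (Im (ray_root s ^ (2 * n) * cis (pi / 3) * of_real r) * s powr (-2/3))"
      by (simp only: mult.assoc)
    also have "\<dots> = sine_coeff n * r * s powr (tau n - 1)"
      unfolding ray_root_even_power[OF s] sine_coeff_def by (simp only: mult_ac)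
    finally show ?thesis .
  qed
  have "Im (root_kernel s * cis (pi / 3)) * s powr (-2/3) =
    (\<Sum>n<N. Im ((- 1) ^ n * ray_root s ^ (2 * n) * of_real (moment n) * cis (pi / 3)) * s powr (-2/3))
    + (\<Sum>n\<in>{N, N + 1, N + 2}. Im ((- 1) ^ n * ray_root s ^ (2 * n) * of_real (stieltjes_re n s) * cis (pi / 3)) * s powr (-2/3))"
    unfolding root_kernel_expansion[OF s, of N] stieltjes_of_real[OF s] distrib_right sum_distrib_right
      plus_complex.sel Im_sum ..
  then show ?thesis unfolding bessel_density_def t by (simp only: mult_ac)
qed

lemma laplace_integrand_of_real:
  assumes "s > 0"
  shows "laplace_integrand n (of_real \<nu>) (of_real s) = of_real (exp (- \<nu> * s) * s powr (tau n - 1) * stieltjes_re n s)"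
proof -
  have "complex_of_real s powr of_real (tau n - 1) = of_real (s powr (tau n - 1))"
    using assms by (simp only: powr_of_real less_imp_le)
  then show ?thesis
    unfolding laplace_integrand_def stieltjes_of_real[OF assms] by (simp flip: exp_of_real)
qed

context
  fixes \<nu> :: real and n :: nat
  assumes \<nu>: "0 < \<nu>"
begin

lemma laplace_re_integrable:
  "(\<lambda>s. exp (- \<nu> * s) * s powr (tau n - 1) * stieltjes_re n s) absolutely_integrable_on {0<..}"
  and laplace_re_integral:
  "of_real (integral {0<..} (\<lambda>s. exp (- \<nu> * s) * s powr (tau n - 1) * stieltjes_re n s)) = terminant n 0 (of_real \<nu>)"
proof -
  let ?g = "\<lambda>s. exp (- \<nu> * s) * s powr (tau n - 1) * stieltjes_re n s"
  let ?f = "\<lambda>s. cis (- 0) * laplace_integrand n (of_real \<nu>) (of_real s * cis (- 0))"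
  have f: "?f absolutely_integrable_on {0<..}"
    using \<nu> by (intro ray_integrand_integrable) auto
  have eq: "?f s = of_real (?g s)" if "s \<in> {0<..}" for s
    using laplace_integrand_of_real[of s n \<nu>] that by simp
  have "(Re \<circ> ?f) absolutely_integrable_on {0<..}"
    using f bounded_linear_Re by (rule absolutely_integrable_linear)
  then show g: "?g absolutely_integrable_on {0<..}"
  proof (rule set_integrable_cong[OF refl refl, THEN iffD1, rotated])
    show "(Re \<circ> ?f) s = ?g s" if "s \<in> {0<..}" for s using eq[OF that] by (simp only: o_apply Re_complex_of_real)
  qed
  have "((\<lambda>s. complex_of_real (?g s)) has_integral of_real (integral {0<..} ?g)) {0<..}"
    by (intro has_integral_of_real integrable_integral set_lebesgue_integral_eq_integral(1) g)
  then have "(?f has_integral of_real (integral {0<..} ?g)) {0<..}"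
    by (rule has_integral_eq[rotated]) (rule eq[symmetric])
  then show "of_real (integral {0<..} ?g) = terminant n 0 (of_real \<nu>)"
    unfolding terminant_def by (simp only: integral_unique)
qed

lemma laplace_re_continuous:
  "continuous_on {0<..} (\<lambda>s. exp (- \<nu> * s) * s powr (tau n - 1) * stieltjes_re n s)"
proof -
  have "continuous_on {0<..} (\<lambda>s. stieltjes n (of_real s))"
    by (rule continuous_on_compose2[OF holomorphic_on_imp_continuous_on[OF stieltjes_holomorphic]])
       (auto intro!: continuous_intros)
  then show ?thesis unfolding stieltjes_re_def by (intro continuous_intros) auto
qed

end

lemma bessel_density_laplace:
  assumes \<nu>: "0 < \<nu>"
  defines "h \<equiv> \<lambda>s. exp (- \<nu> * s) * bessel_density s"
  shows "h absolutely_integrable_on {0<..}" "continuous_on {0<..} h"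
    "of_real (integral {0<..} h) = ((\<Sum>n<N. of_real (sine_coeff n * moment n * (Gamma (tau n) / \<nu> powr tau n)))
      + (\<Sum>n\<in>{N, N + 1, N + 2}. of_real (sine_coeff n) * terminant n 0 (of_real \<nu>))) / 3"
proof -
  let ?u = "\<lambda>n s. s powr (tau n - 1) * exp (- \<nu> * s)"
  let ?l = "\<lambda>n s. exp (- \<nu> * s) * s powr (tau n - 1) * stieltjes_re n s"
  let ?h = "\<lambda>N s. (1/3) * ((\<Sum>n<N. sine_coeff n * moment n * ?u n s) + (\<Sum>n\<in>{N, N + 1, N + 2}. sine_coeff n * ?l n s))"
  have eq: "h s = ?h N s" if "s \<in> {0<..}" for s N
  proof -
    let ?A = "\<Sum>n<N. sine_coeff n * moment n * s powr (tau n - 1)"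
    let ?B = "\<Sum>n\<in>{N, N + 1, N + 2}. sine_coeff n * (s powr (tau n - 1) * stieltjes_re n s)"
    have "h s = (1/3) * (exp (- \<nu> * s) * ?A + exp (- \<nu> * s) * ?B)"
    proof -
      have "e * ((A + B) / 3) = (1/3) * (e * A + e * B)" for e A B :: real by (simp add: distrib_left)
      moreover have "bessel_density s = (?A + ?B) / 3" using that by (intro bessel_density_expansion) simp
      ultimately show ?thesis unfolding h_def by (simp only:)
    qed
    also have "exp (- \<nu> * s) * ?A = (\<Sum>n<N. sine_coeff n * moment n * ?u n s)"
      unfolding sum_distrib_left by (intro sum.cong refl) (simp only: mult_ac)
    also have "exp (- \<nu> * s) * ?B = (\<Sum>n\<in>{N, N + 1, N + 2}. sine_coeff n * ?l n s)"
      unfolding sum_distrib_left by (intro sum.cong refl) (simp only: mult_ac)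
    finally show ?thesis .
  qed
  \<comment> \<open>Integrability and continuity concern h itself; the expansion with N = 0 exhibits
    h as a combination of three Laplace integrands.\<close>
  have "?h 0 absolutely_integrable_on {0<..}"
    by (intro set_integrable_mult_right set_integral_add(1) absolutely_integrable_sum laplace_re_integrable \<nu>) auto
  then show "h absolutely_integrable_on {0<..}"
    by (rule set_integrable_cong[THEN iffD1, rotated 3]) (auto simp: eq[of _ 0])
  have "continuous_on {0<..} (?h 0)"
  proof -
    have "continuous_on {0<..} (?u n)" for n by (intro continuous_intros) auto
    then show ?thesis
      by (intro continuous_on_mult_left continuous_on_add continuous_on_sum laplace_re_continuous \<nu>)
  qed
  then show "continuous_on {0<..} h"
    by (rule continuous_on_cong[THEN iffD1, OF refl, rotated]) (simp add: eq[of _ 0])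
  have hi: "(?h N has_integral (1/3) * ((\<Sum>n<N. sine_coeff n * moment n * (Gamma (tau n) / \<nu> powr tau n))
      + (\<Sum>n\<in>{N, N + 1, N + 2}. sine_coeff n * integral {0<..} (?l n)))) {0<..}"
    by (intro has_integral_mult_right has_integral_add has_integral_sum has_absolute_integral_Gamma(1) tau_pos \<nu>
        integrable_integral set_lebesgue_integral_eq_integral(1) laplace_re_integrable) auto
  have "integral {0<..} h = (1/3) * ((\<Sum>n<N. sine_coeff n * moment n * (Gamma (tau n) / \<nu> powr tau n))
      + (\<Sum>n\<in>{N, N + 1, N + 2}. sine_coeff n * integral {0<..} (?l n)))"
    by (intro trans[OF integral_cong[OF eq] integral_unique[OF hi]])
  then show "of_real (integral {0<..} h) = ((\<Sum>n<N. of_real (sine_coeff n * moment n * (Gamma (tau n) / \<nu> powr tau n)))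
      + (\<Sum>n\<in>{N, N + 1, N + 2}. of_real (sine_coeff n) * terminant n 0 (of_real \<nu>))) / 3"
    by (simp only: of_real_mult of_real_add of_real_sum of_real_divide laplace_re_integral[OF \<nu>]) simp
qed

text \<open>Along the path e^(\<nu> phase) is real and the imaginary part of dt is dv, so both
  integrals have the same derivative in v and \<open>D\<close> is constant. At v = 0 both vanish,
  since P is real at 0. Comparing the limits at v = \<pi> gives the identity.\<close>

lemma bessel_J_laplace:
  assumes \<nu>: "0 < \<nu>" "\<nu> < 1"
  shows "bessel_J (of_real \<nu>) (of_real \<nu>) = of_real (integral {0<..} (\<lambda>s. exp (- \<nu> * s) * bessel_density s) / pi)"
proof -
  let ?h = "\<lambda>s. exp (- \<nu> * s) * bessel_density s"
  let ?k = "\<lambda>t. exp (of_real \<nu> * (sinh t - t))"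
  obtain P where P: "\<And>t. (P has_field_derivative ?k t) (at t)" "\<And>t. P (cnj t) = cnj (P t)"
  proof (rule entire_real_primitive)
    show "?k holomorphic_on UNIV" by (auto intro!: holomorphic_intros simp: sinh_field_def)
    show "?k (cnj t) = cnj (?k t)" for t by (simp add: exp_cnj cnj_sinh)
  qed (rule that)
  obtain J where J: "bessel_J (of_real \<nu>) (of_real \<nu>) = of_real J" "((\<lambda>X. Im (P (Complex X pi)) / pi) \<longlongrightarrow> J) at_top"
    using bessel_J_tendsto[OF \<nu> P] by blast
  obtain G where G: "(G \<longlongrightarrow> 0) (at_right 0)" "(G \<longlongrightarrow> integral {0<..} ?h) at_top"
    "\<And>x. x > 0 \<Longrightarrow> (G has_vector_derivative ?h x) (at x)"
    using half_line_primitive[OF bessel_density_laplace(1,2)[OF \<nu>(1)]] by blast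
  define D where "D v = G (sd_height v) - Im (P (sd v))" for v
  have Dd: "(D has_real_derivative 0) (at v)" if v: "0 < v" "v < pi" for v
  proof -
    obtain d s' where d: "(sd has_vector_derivative Complex d 1) (at v)"
      "(sd_height has_real_derivative s') (at v)" "Complex d 1 = - of_real s' / (cosh (sd v) - 1)"
      using sd_DERIV[OF v] by metis
    have "(G has_real_derivative ?h (sd_height v)) (at (sd_height v))"
      using G(3)[OF sd_height_pos[OF v]] by (simp add: has_real_derivative_iff_has_vector_derivative)
    from DERIV_chain2[OF this d(2)]
    have 1: "((\<lambda>v. G (sd_height v)) has_real_derivative ?h (sd_height v) * s') (at v)" .
    have h: "?h (sd_height v) * s' = exp (- \<nu> * sd_height v)"
      using bessel_density_sd[OF v d(3)] by (simp add: mult.assoc)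
    have "((\<lambda>v. P (sd v)) has_vector_derivative Complex d 1 * ?k (sd v)) (at v)"
      using field_vector_diff_chain_at[OF d(1) P(1)] by (simp add: o_def)
    from bounded_linear.has_vector_derivative[OF bounded_linear_Im this]
    have 2: "((\<lambda>v. Im (P (sd v))) has_real_derivative Im (Complex d 1 * ?k (sd v))) (at v)"
      by (simp add: has_real_derivative_iff_has_vector_derivative)
    have "?k (sd v) = of_real (exp (- \<nu> * sd_height v))"
      using phase_sd[OF v] unfolding phase_def by (simp flip: exp_of_real)
    then have i: "Im (Complex d 1 * ?k (sd v)) = exp (- \<nu> * sd_height v)" by simp
    from DERIV_diff[OF 1 2] show ?thesis unfolding D_def[abs_def] by (simp only: h i diff_self)
  qed
  have "\<exists>c. \<forall>v\<in>{0<..<pi}. D v = c"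
    by (rule has_field_derivative_zero_constant) (auto intro: has_field_derivative_at_within Dd)
  then obtain c where c: "\<And>v. 0 < v \<Longrightarrow> v < pi \<Longrightarrow> D v = c" by auto
  have Pcont: "isCont P t" for t using P(1) by (rule DERIV_isCont)
  have ev0: "\<forall>\<^sub>F v in at_right 0. 0 < v \<and> v < pi"
    using eventually_at_right_real[OF pi_gt_zero] by eventually_elim auto
  have evpi: "\<forall>\<^sub>F v in at_left pi. pi / 2 < v \<and> v < pi"
    using eventually_at_left_real[of "pi/2" pi] by (auto elim: eventually_mono)
  have c0: "c = 0"
  proof -
    have "((\<lambda>v::real. sin v / v) \<longlongrightarrow> 1) (at_right 0)"
    proof -
      have "(sin has_real_derivative cos 0) (at (0::real))" by (rule DERIV_sin)
      then have "((\<lambda>x::real. sin x / x) \<longlongrightarrow> 1) (at 0)" by (simp add: has_field_derivative_iff)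
      then show ?thesis by (rule tendsto_mono[rotated]) (simp add: at_within_le_at)
    qed
    from tendsto_inverse[OF this] have r: "((\<lambda>v::real. v / sin v) \<longlongrightarrow> 1) (at_right 0)" by simp
    have "((\<lambda>v::real. arcosh (v / sin v)) \<longlongrightarrow> arcosh 1) (at_right 0)"
    proof (rule tendsto_arcosh_strong[OF r])
      show "\<forall>\<^sub>F v::real in at_right 0. 1 \<le> v / sin v"
        using ev0 by eventually_elim (use sd_ratio in \<open>auto intro: less_imp_le\<close>)
    qed simp
    then have "((\<lambda>v. sd v) \<longlongrightarrow> Complex 0 0) (at_right 0)"
      unfolding sd_def by (intro tendsto_Complex tendsto_ident_at) simp
    then have sd0: "(sd \<longlongrightarrow> 0) (at_right 0)" by (simp add: Complex_eq)
    have "isCont phase 0" using DERIV_phase by (rule DERIV_isCont)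
    from isCont_tendsto_compose[OF this sd0]
    have "((\<lambda>v. - Re (phase (sd v))) \<longlongrightarrow> - Re (phase 0)) (at_right 0)" by (intro tendsto_intros)
    then have "(sd_height \<longlongrightarrow> 0) (at_right 0)" by (simp add: sd_height_def[abs_def] phase_def)
    moreover have "\<forall>\<^sub>F v in at_right 0. sd_height v > 0"
      using ev0 by eventually_elim (use sd_height_pos in auto)
    ultimately have "filterlim sd_height (at_right 0) (at_right 0)"
      unfolding filterlim_at by (auto elim: eventually_mono)
    from filterlim_compose[OF G(1) this] have "((\<lambda>v. G (sd_height v)) \<longlongrightarrow> 0) (at_right 0)" .
    moreover have "((\<lambda>v. Im (P (sd v))) \<longlongrightarrow> Im (P 0)) (at_right 0)"
      by (intro tendsto_intros isCont_tendsto_compose[OF Pcont sd0])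
    moreover have "Im (P 0) = 0" using P(2)[of 0] by (simp add: complex_eq_iff)
    ultimately have "(D \<longlongrightarrow> 0) (at_right 0)" unfolding D_def by (auto intro: tendsto_eq_intros)
    moreover have "(D \<longlongrightarrow> c) (at_right 0)"
      by (rule tendsto_eventually) (use ev0 in \<open>eventually_elim, use c in auto\<close>)
    ultimately show ?thesis using tendsto_unique[of "at_right (0::real)"] by force
  qed
  let ?X = "\<lambda>v::real. arcosh (v / sin v)"
  have Xtop: "filterlim ?X at_top (at_left pi)"
  proof (rule filterlim_compose[OF arcosh_real_at_top])
    have "filterlim sin (at_right 0) (at_left pi)"
      unfolding filterlim_at
    proof
      show "\<forall>\<^sub>F v in at_left pi. sin v \<in> {0<..} \<and> sin v \<noteq> (0::real)"
        using evpi
      proof eventually_elim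
        case (elim v)
        then have "sin v > 0" using pi_gt_zero by (intro sin_gt_zero) linarith+
        then show ?case by simp
      qed
      have "(sin \<longlongrightarrow> sin pi) (at_left pi)" by (intro tendsto_intros)
      then show "(sin \<longlongrightarrow> 0) (at_left pi)" by simp
    qed
    from filterlim_compose[OF filterlim_inverse_at_top_right this]
    have "filterlim (\<lambda>v::real. inverse (sin v)) at_top (at_left pi)" .
    from filterlim_tendsto_pos_mult_at_top[OF tendsto_ident_at pi_gt_zero this]
    show "filterlim (\<lambda>v::real. v / sin v) at_top (at_left pi)" by (simp add: divide_inverse)
  qed
  have "filterlim sd_height at_top (at_left pi)"
  proof (rule filterlim_at_top_mono[OF Xtop])
    show "\<forall>\<^sub>F v in at_left pi. ?X v \<le> sd_height v"
      using evpi
    proof eventually_elim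
      case (elim v)
      then have "cos v \<le> 0" using cos_lt_zero_pi[of v] pi_gt_zero by auto
      moreover have "sinh (?X v) \<ge> 0" using sd_ratio[of v] elim pi_gt_zero by simp
      ultimately have "sinh (?X v) * cos v \<le> 0" by (simp add: mult_nonneg_nonpos)
      then show ?case by (simp add: sd_height_def Re_phase)
    qed
  qed
  then have lim1: "((\<lambda>v. G (sd_height v)) \<longlongrightarrow> integral {0<..} ?h) (at_left pi)"
    by (rule filterlim_compose[OF G(2)])
  have lim2: "((\<lambda>v. Im (P (Complex (?X v) pi))) \<longlongrightarrow> J * pi) (at_left pi)"
    using tendsto_mult_right[OF filterlim_compose[OF J(2) Xtop], of pi] by simp
  \<comment> \<open>Schlaefli's endpoint lies on the line Im t = \<pi>, which the path only
    approaches. On the vertical gap of length \<pi> - v the cosine is not positive, so the phase has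
    real part at most 0 and the integrand modulus at most 1.\<close>
  have "((\<lambda>v. Im (P (sd v)) - Im (P (Complex (?X v) pi))) \<longlongrightarrow> 0) (at_left pi)"
  proof (rule Lim_null_comparison)
    show "\<forall>\<^sub>F v in at_left pi. norm (Im (P (sd v)) - Im (P (Complex (?X v) pi))) \<le> pi - v"
      using evpi
    proof eventually_elim
      case (elim v)
      then have v: "0 < v" "v < pi" using pi_gt_zero by linarith+
      have "norm (P (sd v) - P (Complex (?X v) pi)) \<le> 1 * norm (sd v - Complex (?X v) pi)"
      proof (rule norm_primitive_diff_le[OF P(1)])
        fix t assume "t \<in> closed_segment (Complex (?X v) pi) (sd v)"
        then have t: "Re t = ?X v" "v \<le> Im t" "Im t \<le> pi"
          using closed_segment_vertical[of t "?X v" pi v] v by (auto simp: sd_def)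
        have "cos (Im t) \<le> 0"
          using t elim cos_monotone_0_pi_le[of "pi/2" "Im t"] pi_gt_zero by simp
        moreover have "sinh (Re t) \<ge> 0" "Re t \<ge> 0" using t(1) sd_ratio[OF v] by auto
        ultimately have "Re (phase t) \<le> 0"
          unfolding Re_phase by (smt (verit) mult_nonneg_nonpos)
        then have "\<nu> * Re (phase t) \<le> 0" using \<nu> by (simp add: mult_nonneg_nonpos)
        then show "norm (?k t) \<le> 1" by (simp add: phase_def)
      qed
      also have "sd v - Complex (?X v) pi = \<i> * of_real (v - pi)" by (simp add: sd_def complex_eq_iff)
      also have "1 * norm (\<i> * complex_of_real (v - pi)) = pi - v"
        unfolding norm_mult norm_of_real using v by simp
      finally have "norm (P (sd v) - P (Complex (?X v) pi)) \<le> pi - v" .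
      then show ?case using abs_Im_le_cmod[of "P (sd v) - P (Complex (?X v) pi)"] by simp
    qed
    have "((\<lambda>v. pi - v) \<longlongrightarrow> pi - pi) (at_left pi)" by (intro tendsto_intros)
    then show "((\<lambda>v. pi - v) \<longlongrightarrow> 0) (at_left pi)" by simp
  qed
  from tendsto_add[OF this lim2] have "((\<lambda>v. Im (P (sd v))) \<longlongrightarrow> J * pi) (at_left pi)" by simp
  from tendsto_diff[OF lim1 this] have "(D \<longlongrightarrow> integral {0<..} ?h - J * pi) (at_left pi)"
    unfolding D_def .
  moreover have "(D \<longlongrightarrow> 0) (at_left pi)"
    by (rule tendsto_eventually) (use evpi in \<open>eventually_elim, use c c0 pi_gt_zero in force\<close>)
  ultimately have "integral {0<..} ?h - J * pi = 0" using tendsto_unique[of "at_left pi"] by force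
  then have "J = integral {0<..} ?h / pi" by (simp add: field_simps)
  then show ?thesis using J(1) by simp
qed


section \<open>From the interval (0, 1) to the slit plane\<close>

lemma tau_eq: "tau n = real (2 * n + 1) / 3"
  by (simp add: tau_def)

lemma B0_eq_moment: "of_real (6 powr (real (2 * n + 1) / 3)) * B0 (2 * n) = of_real ((- 1) ^ n * moment n)"
proof -
  have "complex_of_real ((- 1) ^ n * moment n) = (- 1) ^ n * ((- 1) ^ n * (of_real (6 powr (real (2 * n + 1) / 3)) * B0 (2 * n)))"
    by (simp only: of_real_mult moment_eq of_real_power of_real_minus of_real_1)
  also have "\<dots> = of_real (6 powr (real (2 * n + 1) / 3)) * B0 (2 * n)"
    by (simp only: mult.assoc[symmetric] power_mult_distrib[symmetric]) simp
  finally show ?thesis by simp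
qed

lemma remainder_J_unit_interval:
  assumes \<nu>: "0 < \<nu>" "\<nu> < 1"
  shows "remainder_J N (of_real \<nu>) =
    1 / (3 * of_real pi) * (\<Sum>n\<in>{N, N + 1, N + 2}. of_real (sine_coeff n) * terminant n 0 (of_real \<nu>))"
proof -
  let ?S = "\<Sum>n<N. complex_of_real (sine_coeff n * moment n * (Gamma (tau n) / \<nu> powr tau n))"
  let ?T = "\<Sum>n\<in>{N, N + 1, N + 2}. of_real (sine_coeff n) * terminant n 0 (of_real \<nu>)"
  have "bessel_J (of_real \<nu>) (of_real \<nu>) = (?S + ?T) / 3 / of_real pi"
    by (simp only: bessel_J_laplace[OF \<nu>] of_real_divide bessel_density_laplace(3)[OF \<nu>(1), of N])
  moreover have "(\<Sum>n<N. of_real (6 powr (real (2 * n + 1) / 3)) * B0 (2 * n)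
            * of_real (sin (real (2 * n + 1) * pi / 3))
            * (of_real (Gamma (real (2 * n + 1) / 3)) / of_real \<nu> powr (of_nat (2 * n + 1) / 3))) = ?S"
  proof (rule sum.cong[OF refl])
    fix n
    have "complex_of_real \<nu> powr (of_nat (2 * n + 1) / 3) = complex_of_real \<nu> powr of_real (tau n)"
      by (simp add: tau_eq)
    also have "\<dots> = of_real (\<nu> powr tau n)" using \<nu> by (simp only: powr_of_real less_imp_le)
    finally have p: "complex_of_real \<nu> powr (of_nat (2 * n + 1) / 3) = of_real (\<nu> powr tau n)" .
    show "of_real (6 powr (real (2 * n + 1) / 3)) * B0 (2 * n)
            * of_real (sin (real (2 * n + 1) * pi / 3))
            * (of_real (Gamma (real (2 * n + 1) / 3)) / of_real \<nu> powr (of_nat (2 * n + 1) / 3))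
        = complex_of_real (sine_coeff n * moment n * (Gamma (tau n) / \<nu> powr tau n))"
      unfolding B0_eq_moment p unfolding tau_eq[symmetric] of_real_mult[symmetric] of_real_divide[symmetric] sine_coeff_def
      by (simp only: mult_ac)
  qed
  ultimately have "remainder_J N (of_real \<nu>) = (?S + ?T) / 3 / of_real pi - 1 / (3 * of_real pi) * ?S"
    unfolding remainder_J_def by (simp only:)
  also have "\<dots> = 1 / (3 * of_real pi) * ?T"
    by (simp add: add_divide_distrib)
  finally show ?thesis .
qed

text \<open>Once k exceeds m >= R, the functional equation divides 1 / Gamma only by factors of
  modulus at least 1, so the value at k = m is a bound. The finitely many smaller k are handled by
  compactness.\<close>

lemma rGamma_shift_bounded:
  assumes "R \<ge> 0"
  obtains C where "\<And>k (\<nu>::complex). norm \<nu> \<le> R \<Longrightarrow> norm (rGamma (\<nu> + of_nat k + 1)) \<le> C"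
proof -
  have "\<exists>C. \<forall>\<nu>\<in>cball (0::complex) R. norm (rGamma (\<nu> + of_nat k + 1)) \<le> C" for k
  proof -
    have "continuous_on (cball 0 R) (\<lambda>\<nu>::complex. rGamma (\<nu> + of_nat k + 1))"
      by (intro holomorphic_on_imp_continuous_on holomorphic_intros)
    then have "bounded ((\<lambda>\<nu>::complex. rGamma (\<nu> + of_nat k + 1)) ` cball 0 R)"
      by (intro compact_imp_bounded compact_continuous_image compact_cball)
    then show ?thesis by (auto simp: bounded_iff)
  qed
  then obtain C where C: "\<And>k (\<nu>::complex). norm \<nu> \<le> R \<Longrightarrow> norm (rGamma (\<nu> + of_nat k + 1)) \<le> C k"
    by (metis mem_cball_0)
  have C0: "C k \<ge> 0" for k using C[of 0 k] assms norm_ge_zero order_trans by (metis norm_zero)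
  define m where "m = nat \<lceil>R\<rceil>"
  have m: "R \<le> real m" unfolding m_def by linarith
  have "norm (rGamma (\<nu> + of_nat k + 1)) \<le> (\<Sum>i\<le>m. C i)" if \<nu>: "norm \<nu> \<le> R" for k and \<nu> :: complex
  proof (cases "k \<le> m")
    case True
    then show ?thesis using C[OF \<nu>, of k] C0 member_le_sum[of k "{..m}" C] by force
  next
    case False
    have "rGamma (\<nu> + of_nat m + 1) = pochhammer (\<nu> + of_nat m + 1) (k - m) * rGamma (\<nu> + of_nat m + 1 + of_nat (k - m))"
      by (rule pochhammer_rGamma)
    also have "\<nu> + of_nat m + 1 + of_nat (k - m) = \<nu> + of_nat k + 1" using False by (simp add: of_nat_diff)
    finally have eq: "norm (rGamma (\<nu> + of_nat m + 1)) = norm (pochhammer (\<nu> + of_nat m + 1) (k - m)) * norm (rGamma (\<nu> + of_nat k + 1))"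
      by (simp add: norm_mult)
    have "norm (pochhammer (\<nu> + of_nat m + 1) j) \<ge> 1" for j
    proof -
      have "norm (\<nu> + of_nat m + 1 + of_nat i) \<ge> 1" for i
      proof -
        have "1 + real i \<le> real m + 1 + real i - norm \<nu>" using m \<nu> by simp
        also have "real m + 1 + real i = norm (of_nat (m + 1 + i) :: complex)" by (subst norm_of_nat) simp
        also have "\<dots> - norm \<nu> \<le> norm (of_nat (m + 1 + i) + \<nu>)" by (metis norm_diff_ineq)
        also have "of_nat (m + 1 + i) + \<nu> = \<nu> + of_nat m + 1 + of_nat i" by simp
        finally show ?thesis by simp
      qed
      then show ?thesis unfolding pochhammer_prod prod_norm[symmetric] by (intro prod_ge_1) auto
    qed
    then have "1 * norm (rGamma (\<nu> + of_nat k + 1)) \<le> norm (rGamma (\<nu> + of_nat m + 1))"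
      unfolding eq by (intro mult_right_mono) auto
    also have "\<dots> \<le> C m" by (rule C[OF \<nu>])
    also have "\<dots> \<le> (\<Sum>i\<le>m. C i)" using C0 by (intro member_le_sum) auto
    finally show ?thesis by simp
  qed
  then show ?thesis using that by blast
qed

lemma slit_plane: "{z::complex. z \<notin> \<real>\<^sub>\<le>\<^sub>0} = - (complex_of_real ` {..0})"
  by (auto simp: complex_nonpos_Reals_iff complex_eq_iff image_iff)

lemma open_slit_plane: "open {z::complex. z \<notin> \<real>\<^sub>\<le>\<^sub>0}"
  using closed_nonpos_Reals_complex by (simp add: open_closed Collect_neg_eq)

lemma connected_slit_plane: "connected {z::complex. z \<notin> \<real>\<^sub>\<le>\<^sub>0}"
  unfolding slit_plane by (intro starlike_imp_connected starlike_slotted_complex_plane_left)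

lemma bessel_J_holomorphic: "(\<lambda>\<nu>. bessel_J \<nu> \<nu>) holomorphic_on {z. z \<notin> \<real>\<^sub>\<le>\<^sub>0}"
proof -
  let ?f = "\<lambda>k \<nu>::complex. (- 1) ^ k * (\<nu>\<^sup>2 / 4) ^ k * rGamma (\<nu> + of_nat k + 1) / fact k"
  have "(\<lambda>\<nu>. \<Sum>k. ?f k \<nu>) holomorphic_on UNIV"
  proof (rule holomorphic_uniform_sequence[OF open_UNIV])
    show "(\<lambda>\<nu>. \<Sum>k<n. ?f k \<nu>) holomorphic_on UNIV" for n
      by (intro holomorphic_intros) auto
    fix z :: complex
    define R where "R = norm z + 1"
    have "R \<ge> 0" by (simp add: R_def)
    then obtain C where C: "\<And>k (\<nu>::complex). norm \<nu> \<le> R \<Longrightarrow> norm (rGamma (\<nu> + of_nat k + 1)) \<le> C"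
      using rGamma_shift_bounded by blast
    have "uniform_limit (cball z 1) (\<lambda>n \<nu>. \<Sum>k<n. ?f k \<nu>) (\<lambda>\<nu>. \<Sum>k. ?f k \<nu>) sequentially"
    proof (rule Weierstrass_m_test)
      show "summable (\<lambda>k. (inverse (fact k) * (R\<^sup>2 / 4) ^ k) * C)"
        by (intro summable_mult2 summable_exp)
      fix k \<nu> assume "\<nu> \<in> cball z 1"
      then have n: "norm \<nu> \<le> R"
        using norm_triangle_ineq2[of \<nu> z] by (simp add: R_def dist_norm norm_minus_commute)
      have "norm (?f k \<nu>) = ((norm \<nu>)\<^sup>2 / 4) ^ k * norm (rGamma (\<nu> + of_nat k + 1)) / fact k"
        by (simp add: norm_mult norm_divide norm_power)
      also have "\<dots> \<le> (R\<^sup>2 / 4) ^ k * C / fact k"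
        using n C[OF n] by (intro divide_right_mono mult_mono power_mono) (auto intro: power_mono)
      finally show "norm (?f k \<nu>) \<le> (inverse (fact k) * (R\<^sup>2 / 4) ^ k) * C"
        by (simp only: divide_inverse mult_ac)
    qed
    then show "\<exists>d>0. cball z d \<subseteq> UNIV \<and> uniform_limit (cball z d) (\<lambda>n \<nu>. \<Sum>k<n. ?f k \<nu>) (\<lambda>\<nu>. \<Sum>k. ?f k \<nu>) sequentially"
      by (intro exI[of _ 1]) auto
  qed
  then have "(\<lambda>\<nu>. \<Sum>k. ?f k \<nu>) holomorphic_on {z. z \<notin> \<real>\<^sub>\<le>\<^sub>0}" by (rule holomorphic_on_subset) auto
  moreover have "z / 2 \<notin> \<real>\<^sub>\<le>\<^sub>0" if "z \<notin> \<real>\<^sub>\<le>\<^sub>0" for z :: complex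
    using that by (auto simp: complex_nonpos_Reals_iff)
  ultimately show ?thesis unfolding bessel_J_def by (intro holomorphic_intros) auto
qed

lemma remainder_J_holomorphic: "remainder_J N holomorphic_on {z. z \<notin> \<real>\<^sub>\<le>\<^sub>0}"
proof -
  have "z \<noteq> 0" if "z \<notin> \<real>\<^sub>\<le>\<^sub>0" for z :: complex using that by auto
  then show ?thesis
    unfolding remainder_J_def[abs_def] by (intro holomorphic_intros bessel_J_holomorphic) auto
qed

lemma Re_mult_cis: "Re (\<nu> * cis (- \<alpha>)) = norm \<nu> * cos (Arg \<nu> - \<alpha>)"
proof (cases "\<nu> = 0")
  case False
  then have "\<nu> = of_real (norm \<nu>) * cis (Arg \<nu>)"
    using Arg_eq[of \<nu>] by (simp add: cis_conv_exp mult.commute)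
  then have "\<nu> * cis (- \<alpha>) = of_real (norm \<nu>) * cis (Arg \<nu> - \<alpha>)"
    using cis_mult[of "Arg \<nu>" "- \<alpha>"] by (metis ab_group_add_class.ab_diff_conv_add_uminus mult.assoc)
  then show ?thesis by simp
qed simp

lemma Arg_slit_plane:
  assumes "\<nu> \<notin> \<real>\<^sub>\<le>\<^sub>0"
  shows "\<bar>Arg \<nu>\<bar> < pi"
proof -
  have "Arg \<nu> \<noteq> pi" using assms Arg_eq_pi[of \<nu>] by (auto simp: complex_nonpos_Reals_iff)
  then show ?thesis using Arg_bounded[of \<nu>] by (auto simp: abs_less_iff)
qed

text \<open>Half the argument is a rotation that works for every \<nu>: both \<alpha> and Arg \<nu>
  - \<alpha> equal Arg \<nu> / 2, which is below \<pi>/2 in modulus.\<close>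

lemma half_Arg_pos:
  assumes "\<nu> \<notin> \<real>\<^sub>\<le>\<^sub>0"
  shows "cos (Arg \<nu> / 2) > 0" "Re (\<nu> * cis (- (Arg \<nu> / 2))) > 0"
proof -
  show c: "cos (Arg \<nu> / 2) > 0"
    using Arg_slit_plane[OF assms] by (intro cos_gt_zero_pi) auto
  have "\<nu> \<noteq> 0" using assms by auto
  then show "Re (\<nu> * cis (- (Arg \<nu> / 2))) > 0" using c unfolding Re_mult_cis by simp
qed

text \<open>Near each point w the angle may be frozen at Arg w / 2, where the integral is
  holomorphic in \<nu>; by \<open>terminant_rotate\<close> freezing it does not change the
  value.\<close>

lemma terminant_half_Arg_holomorphic:
  "(\<lambda>\<nu>. terminant n (Arg \<nu> / 2) \<nu>) holomorphic_on {z. z \<notin> \<real>\<^sub>\<le>\<^sub>0}"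
proof -
  let ?S = "{z::complex. z \<notin> \<real>\<^sub>\<le>\<^sub>0}"
  let ?U = "\<lambda>w. ?S \<inter> {\<nu>. Re (\<nu> * cis (- (Arg w / 2))) > 0}"
  have "(\<lambda>\<nu>. terminant n (Arg \<nu> / 2) \<nu>) holomorphic_on (\<Union>w\<in>?S. ?U w)"
  proof (rule holomorphic_on_UN_open)
    fix w assume w: "w \<in> ?S"
    have "terminant n (Arg w / 2) holomorphic_on ?U w"
      by (rule holomorphic_on_subset[OF terminant_holomorphic]) (use half_Arg_pos(1)[of w] w in auto)
    then show "(\<lambda>\<nu>. terminant n (Arg \<nu> / 2) \<nu>) holomorphic_on ?U w"
    proof (rule holomorphic_transform)
      fix \<nu> assume "\<nu> \<in> ?U w"
      then show "terminant n (Arg w / 2) \<nu> = terminant n (Arg \<nu> / 2) \<nu>"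
        using half_Arg_pos[of w] half_Arg_pos[of \<nu>] w by (intro terminant_rotate) auto
    qed
    have "open {\<nu>. Re (\<nu> * cis (- (Arg w / 2))) > 0}" by (intro open_Collect_less continuous_intros)
    then show "open (?U w)" by (intro open_Int open_slit_plane)
  qed
  also have "(\<Union>w\<in>?S. ?U w) = ?S" using half_Arg_pos(2) by auto
  finally show ?thesis .
qed

text \<open>Both sides are holomorphic on the connected slit plane and agree on (0, 1), which
  accumulates at the interior point 1/2.\<close>

theorem remainder_J_eq_terminants:
  assumes "\<nu> \<notin> \<real>\<^sub>\<le>\<^sub>0"
  shows "remainder_J N \<nu> =
    1 / (3 * of_real pi) * (\<Sum>n\<in>{N, N + 1, N + 2}. of_real (sine_coeff n) * terminant n (Arg \<nu> / 2) \<nu>)"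
proof -
  let ?S = "{z::complex. z \<notin> \<real>\<^sub>\<le>\<^sub>0}"
  let ?g = "\<lambda>\<nu>. remainder_J N \<nu> -
    1 / (3 * of_real pi) * (\<Sum>n\<in>{N, N + 1, N + 2}. of_real (sine_coeff n) * terminant n (Arg \<nu> / 2) \<nu>)"
  have "?g \<nu> = 0"
  proof (rule analytic_continuation[where f="?g" and S="?S" and U="complex_of_real ` {0<..<1}" and \<xi>="of_real (1/2)"])
    show "?g holomorphic_on ?S"
      by (intro holomorphic_intros remainder_J_holomorphic terminant_half_Arg_holomorphic) auto
    show "complex_of_real ` {0<..<1} \<subseteq> ?S" "complex_of_real (1/2) \<in> ?S"
      by (auto simp: complex_nonpos_Reals_iff)
    show "complex_of_real (1/2) islimpt complex_of_real ` {0<..<1}"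
      unfolding islimpt_sequential
    proof (intro exI conjI allI)
      let ?x = "\<lambda>n. 1/2 - 1 / (real n + 3)"
      show "complex_of_real (?x n) \<in> complex_of_real ` {0<..<1} - {complex_of_real (1/2)}" for n
      proof -
        have "?x n \<in> {0<..<1}" "?x n \<noteq> 1/2" by (auto simp: field_simps)
        then show ?thesis by (metis DiffI imageI of_real_eq_iff singletonD)
      qed
      have "(\<lambda>n. 1 / (real n + 3)) \<longlonglongrightarrow> 0"
        using LIMSEQ_ignore_initial_segment[OF lim_1_over_n, of 3] by simp
      then have "(\<lambda>n. ?x n) \<longlonglongrightarrow> 1/2 - 0" by (intro tendsto_intros)
      then show "(\<lambda>n. complex_of_real (?x n)) \<longlonglongrightarrow> complex_of_real (1/2)" by (intro tendsto_of_real) simp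
    qed
    show "?g z = 0" if z: "z \<in> complex_of_real ` {0<..<1}" for z
    proof -
      obtain x where x: "z = of_real x" "0 < x" "x < 1" using z by auto
      then have "Arg z = 0" by (simp add: Arg_of_real)
      then show ?thesis using remainder_J_unit_interval[OF x(2,3), of N] x(1) by simp
    qed
  qed (use assms open_slit_plane connected_slit_plane in auto)
  then show ?thesis by simp
qed

section \<open>Error bounds\<close>

lemma b_eq_moment: "b n \<nu> = moment n * (Gamma (tau n) / norm \<nu> powr tau n)"
proof -
  have "6 powr (real (2 * n + 1) / 3) * norm (B0 (2 * n)) = norm (of_real (6 powr (real (2 * n + 1) / 3)) * B0 (2 * n))"
    unfolding norm_mult norm_of_real by simp
  also have "\<dots> = moment n" unfolding B0_eq_moment norm_of_real using moment_nonneg[of n] by (simp add: abs_mult)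
  finally show ?thesis unfolding b_def tau_eq[symmetric] by simp
qed

lemma b_nonneg: "b n \<nu> \<ge> 0"
  unfolding b_eq_moment using moment_nonneg[of n] Gamma_real_pos[OF tau_pos[of n]]
  by (intro mult_nonneg_nonneg divide_nonneg_nonneg) auto

lemma norm_one_plus_ray_square:
  assumes "r > 0"
  shows "(norm (1 + (of_real \<sigma> * cis (- \<alpha>) / of_real r)\<^sup>2))\<^sup>2 =
    (1 + (\<sigma> / r)\<^sup>2 * cos (2 * \<alpha>))\<^sup>2 + ((\<sigma> / r)\<^sup>2 * sin (2 * \<alpha>))\<^sup>2"
proof -
  have "(of_real \<sigma> * cis (- \<alpha>) / complex_of_real r)\<^sup>2 = of_real ((\<sigma> / r)\<^sup>2) * cis (2 * (- \<alpha>))"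
    unfolding power_divide power_mult_distrib Complex.DeMoivre by simp
  then show ?thesis by (simp add: cmod_power2)
qed

text \<open>As t = (\<sigma>/r)^2 varies, 1 + t e^(- 2 i \<alpha>) runs along a ray starting at 1.
  It does not come closer to 0 than 1 if cos (2 \<alpha>) >= 0; in any case it keeps the distance
  |sin (2 \<alpha>)| of the whole line from 0.\<close>

lemma norm_stieltjes_ray_le:
  assumes "\<sigma> > 0" "cos \<alpha> > 0"
  shows "cos (2 * \<alpha>) \<ge> 0 \<Longrightarrow> norm (stieltjes n (of_real \<sigma> * cis (- \<alpha>))) \<le> moment n"
    "sin (2 * \<alpha>) \<noteq> 0 \<Longrightarrow> norm (stieltjes n (of_real \<sigma> * cis (- \<alpha>))) \<le> moment n * \<bar>1 / sin (2 * \<alpha>)\<bar>"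
proof -
  have re: "Re (of_real \<sigma> * cis (- \<alpha>)) > 0" using assms by simp
  {
    assume c: "cos (2 * \<alpha>) \<ge> 0"
    have "norm (stieltjes n (of_real \<sigma> * cis (- \<alpha>))) \<le> moment n / 1"
    proof (rule norm_stieltjes_le[OF re zero_less_one])
      fix r :: real assume r: "r > 0"
      have "1 \<le> 1 + (\<sigma> / r)\<^sup>2 * cos (2 * \<alpha>)" using c by simp
      then have "1\<^sup>2 \<le> (1 + (\<sigma> / r)\<^sup>2 * cos (2 * \<alpha>))\<^sup>2" by (intro power_mono) auto
      then have "1\<^sup>2 \<le> (norm (1 + (of_real \<sigma> * cis (- \<alpha>) / of_real r)\<^sup>2))\<^sup>2"
        unfolding norm_one_plus_ray_square[OF r] by (intro order_trans[OF _ le_add_same_cancel1[THEN iffD2]]) auto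
      then show "1 \<le> norm (1 + (of_real \<sigma> * cis (- \<alpha>) / of_real r)\<^sup>2)" by (rule power2_le_imp_le) simp
    qed
    then show "norm (stieltjes n (of_real \<sigma> * cis (- \<alpha>))) \<le> moment n" by simp
  }
  {
    assume s: "sin (2 * \<alpha>) \<noteq> 0"
    have "norm (stieltjes n (of_real \<sigma> * cis (- \<alpha>))) \<le> moment n / \<bar>sin (2 * \<alpha>)\<bar>"
    proof (rule norm_stieltjes_le[OF re])
      fix r :: real assume r: "r > 0"
      define t where "t = (\<sigma> / r)\<^sup>2"
      \<comment> \<open>The last summand vanishes by sin^2 + cos^2 = 1; written this way the
        equation is a polynomial identity.\<close>
      have "(1 + t * cos (2 * \<alpha>))\<^sup>2 + (t * sin (2 * \<alpha>))\<^sup>2 = (t + cos (2 * \<alpha>))\<^sup>2 + (sin (2 * \<alpha>))\<^sup>2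
          + (1 - t\<^sup>2) * (1 - (sin (2 * \<alpha>))\<^sup>2 - (cos (2 * \<alpha>))\<^sup>2)" by algebra
      also have "1 - (sin (2 * \<alpha>))\<^sup>2 - (cos (2 * \<alpha>))\<^sup>2 = 0" by (simp add: cos_squared_eq)
      finally have "\<bar>sin (2 * \<alpha>)\<bar>\<^sup>2 \<le> (norm (1 + (of_real \<sigma> * cis (- \<alpha>) / of_real r)\<^sup>2))\<^sup>2"
        unfolding norm_one_plus_ray_square[OF r] t_def[symmetric] by simp
      then show "\<bar>sin (2 * \<alpha>)\<bar> \<le> norm (1 + (of_real \<sigma> * cis (- \<alpha>) / of_real r)\<^sup>2)" by (rule power2_le_imp_le) simp
    qed (use s in simp)
    then show "norm (stieltjes n (of_real \<sigma> * cis (- \<alpha>))) \<le> moment n * \<bar>1 / sin (2 * \<alpha>)\<bar>" by simp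
  }
qed

text \<open>With \<alpha> = Arg \<nu> - \<phi> the decay rate on the turned ray is |\<nu>| cos
  \<phi>, which yields the power of cos \<phi> in the error terms; \<open>k\<close> is what the
  rotation costs in the bound for \<open>stieltjes\<close>.\<close>

lemma norm_terminant_half_Arg_le:
  assumes \<nu>: "\<nu> \<notin> \<real>\<^sub>\<le>\<^sub>0" and c: "cos \<alpha> > 0" "cos (Arg \<nu> - \<alpha>) > 0"
    and k: "\<And>\<sigma>. \<sigma> > 0 \<Longrightarrow> norm (stieltjes n (of_real \<sigma> * cis (- \<alpha>))) \<le> moment n * k"
  shows "norm (terminant n (Arg \<nu> / 2) \<nu>) \<le> k / cos (Arg \<nu> - \<alpha>) powr tau n * b n \<nu>"
proof -
  have n0: "norm \<nu> > 0" using \<nu> by auto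
  have re: "Re (\<nu> * cis (- \<alpha>)) > 0" using n0 c by (simp only: Re_mult_cis) simp
  have "terminant n (Arg \<nu> / 2) \<nu> = terminant n \<alpha> \<nu>"
    using half_Arg_pos[OF \<nu>] c(1) re by (intro terminant_rotate)
  then have "norm (terminant n (Arg \<nu> / 2) \<nu>) \<le> moment n * k * (Gamma (tau n) / Re (\<nu> * cis (- \<alpha>)) powr tau n)"
    using norm_terminant_le[OF c(1) re k] by simp
  also have "Re (\<nu> * cis (- \<alpha>)) powr tau n = norm \<nu> powr tau n * cos (Arg \<nu> - \<alpha>) powr tau n"
    unfolding Re_mult_cis using n0 c by (intro powr_mult)
  also have "moment n * k * (Gamma (tau n) / (norm \<nu> powr tau n * cos (Arg \<nu> - \<alpha>) powr tau n))
      = k / cos (Arg \<nu> - \<alpha>) powr tau n * b n \<nu>"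
    unfolding b_eq_moment by (simp add: mult_ac)
  finally show ?thesis .
qed

text \<open>Up to sign the sine depends only on n modulo 3, and for residue 1 its argument is a
  multiple of \<pi>.\<close>

lemma abs_sine_coeff: "\<bar>sine_coeff n\<bar> = (if n mod 3 = 1 then 0 else sqrt 3 / 2)"
proof -
  define k r where "k = n div 3" and "r = n mod 3"
  have n: "n = 3 * k + r" by (simp add: k_def r_def)
  have "sin (real (2 * n + 1) * pi / 3) = sin (real (2 * r + 1) * pi / 3 + real (2 * k) * pi)"
    by (simp add: n field_simps)
  also have "\<dots> = sin (real (2 * r + 1) * pi / 3)"
    by (simp add: sin_add cos_npi sin_npi)
  finally have "\<bar>sine_coeff n\<bar> = \<bar>sin (real (2 * r + 1) * pi / 3)\<bar>"
    by (simp add: sine_coeff_def abs_mult)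
  moreover have "r = 0 \<or> r = 1 \<or> r = 2" by (auto simp: r_def)
  moreover have "sin (5 * pi / 3) = - (sqrt 3 / 2)"
  proof -
    have "sin (5 * pi / 3) = sin (2 * pi - pi / 3)" by (intro arg_cong[of _ _ sin]) simp
    then show ?thesis by (simp only: sin_2pi_minus sin_60)
  qed
  ultimately show ?thesis unfolding r_def[symmetric] by (auto simp: sin_60)
qed

text \<open>Common to both estimates, which differ only in the factor \<open>X n\<close>. The index
  that is 1 modulo 3 drops out, and the case distinction on N records which of the three it
  is.\<close>

lemma norm_remainder_J_le:
  assumes \<nu>: "\<nu> \<notin> \<real>\<^sub>\<le>\<^sub>0" and X: "\<And>n. n \<in> {N, N + 1, N + 2} \<Longrightarrow> norm (terminant n (Arg \<nu> / 2) \<nu>) \<le> X n * b n \<nu>"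
  defines "E \<equiv> \<lambda>n. X n * (b n \<nu> / (2 * sqrt 3 * pi))"
  shows "N mod 3 = 0 \<Longrightarrow> norm (remainder_J N \<nu>) \<le> E N + E (N + 2)"
    "N mod 3 = 1 \<Longrightarrow> norm (remainder_J N \<nu>) \<le> E (N + 1) + E (N + 2)"
    "N mod 3 = 2 \<Longrightarrow> norm (remainder_J N \<nu>) \<le> E N + E (N + 1)"
proof -
  have "norm (remainder_J N \<nu>) \<le> 1 / (3 * pi) * (\<Sum>n\<in>{N, N + 1, N + 2}. \<bar>sine_coeff n\<bar> * (X n * b n \<nu>))"
  proof -
    have "norm (\<Sum>n\<in>{N, N + 1, N + 2}. complex_of_real (sine_coeff n) * terminant n (Arg \<nu> / 2) \<nu>)
        \<le> (\<Sum>n\<in>{N, N + 1, N + 2}. \<bar>sine_coeff n\<bar> * (X n * b n \<nu>))"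
    proof (rule sum_norm_le)
      fix n assume "n \<in> {N, N + 1, N + 2}"
      then show "norm (complex_of_real (sine_coeff n) * terminant n (Arg \<nu> / 2) \<nu>) \<le> \<bar>sine_coeff n\<bar> * (X n * b n \<nu>)"
        unfolding norm_mult norm_of_real by (intro mult_left_mono X) auto
    qed
    moreover have "norm (1 / (3 * complex_of_real pi)) = 1 / (3 * pi)" by (simp add: norm_divide norm_mult)
    ultimately show ?thesis
      unfolding remainder_J_eq_terminants[OF \<nu>, of N] norm_mult by (intro mult_mono) auto
  qed
  also have "\<dots> = (\<Sum>n\<in>{N, N + 1, N + 2}. if n mod 3 = 1 then 0 else E n)"
  proof -
    have "1 / (3 * pi) * (\<bar>sine_coeff n\<bar> * (X n * b n \<nu>)) = (if n mod 3 = 1 then 0 else E n)" for n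
    proof -
      have "sqrt 3 / 2 / (3 * pi) = 1 / (2 * sqrt 3 * pi)" by (simp add: divide_simps)
      then have "sqrt 3 / 2 / (3 * pi) * (X n * b n \<nu>) = 1 / (2 * sqrt 3 * pi) * (X n * b n \<nu>)" by (simp only:)
      then show ?thesis unfolding abs_sine_coeff E_def by simp
    qed
    then show ?thesis unfolding sum_distrib_left by (intro sum.cong) auto
  qed
  finally have R: "norm (remainder_J N \<nu>) \<le> (\<Sum>n\<in>{N, N + 1, N + 2}. if n mod 3 = 1 then 0 else E n)" .
  show "norm (remainder_J N \<nu>) \<le> E N + E (N + 2)" if "N mod 3 = 0"
  proof -
    have "(N + 1) mod 3 = 1" "(N + 2) mod 3 = 2" using that by presburger+
    then show ?thesis using R that by simp
  qed
  show "norm (remainder_J N \<nu>) \<le> E (N + 1) + E (N + 2)" if "N mod 3 = 1"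
  proof -
    have "(N + 1) mod 3 = 2" "(N + 2) mod 3 = 0" using that by presburger+
    then show ?thesis using R that by simp
  qed
  show "norm (remainder_J N \<nu>) \<le> E N + E (N + 1)" if "N mod 3 = 2"
  proof -
    have "(N + 1) mod 3 = 0" "(N + 2) mod 3 = 1" using that by presburger+
    then show ?thesis using R that by simp
  qed
qed

section \<open>The critical angles\<close>

lemma I_pos:
  assumes "pi / 4 < \<theta>" "\<theta> < pi"
  shows "I \<theta> = {max 0 (\<theta> - pi / 2)<..<min (pi / 2) (\<theta> - pi / 4)}"
  using assms pi_gt_zero unfolding I_def by (auto simp: max_def min_def)

lemma I_minus:
  assumes "pi / 4 < \<theta>" "\<theta> < pi"
  shows "I (- \<theta>) = uminus ` I \<theta>"
  using assms pi_gt_zero unfolding I_def by (auto simp: algebra_simps)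

text \<open>With K = 3 \<tau> the right side is 6 sin (2(\<theta> - \<phi>)) cos \<phi> times 2 cot
  (2(\<theta> - \<phi>)) + \<tau> tan \<phi>. The latter is the logarithmic derivative of 1 / (sin
  (2(\<theta> - \<phi>)) cos^\<tau> \<phi>).\<close>

lemma critical_equation_eq:
  "(K + 6) * cos (3 * \<phi> - 2 * \<theta>) - (K - 6) * cos (\<phi> - 2 * \<theta>)
    = 12 * (cos (2 * (\<theta> - \<phi>)) * cos \<phi>) + 2 * K * (sin (2 * (\<theta> - \<phi>)) * sin \<phi>)" for K :: real
proof -
  have "3 * \<phi> - 2 * \<theta> = - (2 * (\<theta> - \<phi>) - \<phi>)" "\<phi> - 2 * \<theta> = - (2 * (\<theta> - \<phi>) + \<phi>)" by simp_all
  then show ?thesis by (simp only: cos_minus cos_diff cos_add) (simp add: algebra_simps)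
qed

text \<open>On the interval \<theta> - \<phi> lies between \<pi>/4 and \<pi>/2, and \<phi> between 0
  and \<pi>/2. So 6 cot (2(\<theta> - \<phi>)) + K tan \<phi> is strictly increasing, which gives
  uniqueness. For existence the form without denominators is used, as it is continuous up to the
  endpoints and changes sign.\<close>

lemma critical_unique_pos:
  assumes \<theta>: "pi / 4 < \<theta>" "\<theta> < pi" and K: "K > (0::real)"
  shows "\<exists>\<phi>. {\<phi> \<in> I \<theta>. (K + 6) * cos (3 * \<phi> - 2 * \<theta>) = (K - 6) * cos (\<phi> - 2 * \<theta>)} = {\<phi>}
    \<and> cos \<phi> > 0 \<and> cos (\<theta> - \<phi>) > 0 \<and> sin (2 * (\<theta> - \<phi>)) \<noteq> 0"
proof -
  define lo hi where "lo = max 0 (\<theta> - pi / 2)" and "hi = min (pi / 2) (\<theta> - pi / 4)"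
  have I: "I \<theta> = {lo<..<hi}" unfolding lo_def hi_def by (rule I_pos[OF \<theta>])
  have lohi: "0 \<le> lo" "lo < hi" "hi \<le> pi / 2" using \<theta> by (auto simp: lo_def hi_def max_def min_def)
  define f where "f \<phi> = 12 * (cos (2 * (\<theta> - \<phi>)) * cos \<phi>) + 2 * K * (sin (2 * (\<theta> - \<phi>)) * sin \<phi>)" for \<phi>
  have f: "(K + 6) * cos (3 * \<phi> - 2 * \<theta>) = (K - 6) * cos (\<phi> - 2 * \<theta>) \<longleftrightarrow> f \<phi> = 0" for \<phi>
    using critical_equation_eq[of K \<phi> \<theta>] unfolding f_def by linarith
  have range: "cos \<phi> > 0" "pi / 4 < \<theta> - \<phi>" "\<theta> - \<phi> < pi / 2" "sin (2 * (\<theta> - \<phi>)) > 0" "cos (\<theta> - \<phi>) > 0" "0 < \<phi>" "\<phi> < pi / 2"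
    if "\<phi> \<in> {lo<..<hi}" for \<phi>
  proof -
    show p: "0 < \<phi>" "\<phi> < pi / 2" using that lohi by auto
    show a: "pi / 4 < \<theta> - \<phi>" "\<theta> - \<phi> < pi / 2" using that by (auto simp: lo_def hi_def)
    show "cos \<phi> > 0" using p by (intro cos_gt_zero) auto
    show "sin (2 * (\<theta> - \<phi>)) > 0" using a pi_gt_zero by (intro sin_gt_zero) auto
    show "cos (\<theta> - \<phi>) > 0" using a pi_gt_zero by (intro cos_gt_zero_pi) auto
  qed
  have flo: "f lo < 0"
  proof (cases "\<theta> \<le> pi / 2")
    case True
    then have "lo = 0" by (simp add: lo_def)
    moreover have "cos (2 * \<theta>) < 0"
    proof -
      have "cos (2 * \<theta>) < cos (pi / 2)" using True \<theta> by (intro cos_monotone_0_pi) auto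
      then show ?thesis by simp
    qed
    ultimately show ?thesis by (simp add: f_def)
  next
    case False
    then have "lo = \<theta> - pi / 2" by (simp add: lo_def)
    moreover have "cos (\<theta> - pi / 2) > 0" using False \<theta> by (intro cos_gt_zero_pi) auto
    ultimately show ?thesis by (simp add: f_def)
  qed
  have fhi: "f hi > 0"
  proof (cases "\<theta> \<ge> 3 * pi / 4")
    case True
    then have h: "hi = pi / 2" by (simp add: hi_def min_def)
    have "sin (2 * (\<theta> - pi / 2)) > 0" using True \<theta> by (intro sin_gt_zero) auto
    then have "2 * K * sin (2 * (\<theta> - pi / 2)) > 0" using K by (intro mult_pos_pos) auto
    then show ?thesis unfolding f_def h by (simp only: cos_pi_half sin_pi_half mult_zero_right mult_1_right add_0)
  next
    case False
    then have h: "hi = \<theta> - pi / 4" by (simp add: hi_def)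
    have h2: "2 * (\<theta> - hi) = pi / 2" by (simp add: h)
    have "sin hi > 0" unfolding h using \<theta> by (intro sin_gt_zero) auto
    then show ?thesis unfolding f_def h2 using K by simp
  qed
  have "\<exists>x\<ge>lo. x \<le> hi \<and> f x = 0"
    by (rule IVT') (use flo fhi lohi in \<open>auto simp: f_def intro!: continuous_intros\<close>)
  then obtain \<phi> where \<phi>: "lo \<le> \<phi>" "\<phi> \<le> hi" "f \<phi> = 0" by blast
  then have in_I: "\<phi> \<in> {lo<..<hi}" using flo fhi by (metis greaterThanLessThan_iff less_irrefl order_le_less)
  have no: False if "x \<in> {lo<..<hi}" "y \<in> {lo<..<hi}" "x < y" "f x = 0" "f y = 0" for x y
  proof -
    \<comment> \<open>The cotangent is written as the tangent of the complementary angle, so that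
      monotonicity of the tangent handles both terms.\<close>
    have z: "6 * tan (pi / 2 - 2 * (\<theta> - t)) + K * tan t = 0" if "t \<in> {lo<..<hi}" "f t = 0" for t
    proof -
      note r = range[OF that(1)]
      have "tan (pi / 2 - 2 * (\<theta> - t)) = cos (2 * (\<theta> - t)) / sin (2 * (\<theta> - t))"
        unfolding tan_cot unfolding tan_def by simp
      moreover have "f t = 2 * (sin (2 * (\<theta> - t)) * cos t) * (6 * (cos (2 * (\<theta> - t)) / sin (2 * (\<theta> - t))) + K * (sin t / cos t))"
        using r(1,4) by (simp add: f_def field_simps)
      ultimately show ?thesis using that(2) r(1,4) by (simp add: tan_def)
    qed
    have "tan (pi / 2 - 2 * (\<theta> - x)) < tan (pi / 2 - 2 * (\<theta> - y))"
      using range(2,3)[OF that(1)] range(2,3)[OF that(2)] that(3) by (intro tan_monotone) auto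
    moreover have "tan x < tan y"
      using range(6,7)[OF that(1)] range(6,7)[OF that(2)] that(3) by (intro tan_monotone) auto
    then have "K * tan x < K * tan y" using K by simp
    ultimately show False using z[OF that(1,4)] z[OF that(2,5)] by linarith
  qed
  have "{\<phi> \<in> I \<theta>. (K + 6) * cos (3 * \<phi> - 2 * \<theta>) = (K - 6) * cos (\<phi> - 2 * \<theta>)} = {\<phi>}"
  proof -
    have "x = \<phi>" if "x \<in> {lo<..<hi}" "f x = 0" for x
      using no[OF that(1) in_I _ that(2) \<phi>(3)] no[OF in_I that(1) _ \<phi>(3) that(2)] by (metis linorder_less_linear)
    then show ?thesis unfolding f I using in_I \<phi>(3) by blast
  qed
  then show ?thesis using range[OF in_I] by (intro exI[of _ \<phi>]) auto
qed

lemma critical_unique: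
  assumes \<theta>: "pi / 4 < \<bar>\<theta>\<bar>" "\<bar>\<theta>\<bar> < pi" and K: "K > (0::real)"
  shows "\<exists>\<phi>. {\<phi> \<in> I \<theta>. (K + 6) * cos (3 * \<phi> - 2 * \<theta>) = (K - 6) * cos (\<phi> - 2 * \<theta>)} = {\<phi>}
    \<and> cos \<phi> > 0 \<and> cos (\<theta> - \<phi>) > 0 \<and> sin (2 * (\<theta> - \<phi>)) \<noteq> 0"
proof (cases "\<theta> > 0")
  case True
  then show ?thesis using critical_unique_pos[OF _ _ K] \<theta> by simp
next
  case False
  define \<eta> where "\<eta> = - \<theta>"
  have \<eta>: "pi / 4 < \<eta>" "\<eta> < pi" "\<theta> = - \<eta>" using False \<theta> by (auto simp: \<eta>_def)
  obtain \<phi> where \<phi>: "{\<phi> \<in> I \<eta>. (K + 6) * cos (3 * \<phi> - 2 * \<eta>) = (K - 6) * cos (\<phi> - 2 * \<eta>)} = {\<phi>}"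
    "cos \<phi> > 0" "cos (\<eta> - \<phi>) > 0" "sin (2 * (\<eta> - \<phi>)) \<noteq> 0"
    using critical_unique_pos[OF \<eta>(1,2) K] by blast
  have "3 * (- x) - 2 * \<theta> = - (3 * x - 2 * \<eta>)" "- x - 2 * \<theta> = - (x - 2 * \<eta>)" for x
    by (simp_all add: \<eta>(3))
  then have e: "cos (3 * (- x) - 2 * \<theta>) = cos (3 * x - 2 * \<eta>)" "cos (- x - 2 * \<theta>) = cos (x - 2 * \<eta>)" for x
    by (simp_all only: cos_minus)
  have "{\<phi> \<in> I \<theta>. (K + 6) * cos (3 * \<phi> - 2 * \<theta>) = (K - 6) * cos (\<phi> - 2 * \<theta>)}
      = uminus ` {\<phi> \<in> I \<eta>. (K + 6) * cos (3 * \<phi> - 2 * \<eta>) = (K - 6) * cos (\<phi> - 2 * \<eta>)}"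
    using I_minus[OF \<eta>(1,2)] unfolding \<eta>(3)[symmetric] by (auto simp: e image_iff)
  then have "{\<phi> \<in> I \<theta>. (K + 6) * cos (3 * \<phi> - 2 * \<theta>) = (K - 6) * cos (\<phi> - 2 * \<theta>)} = {- \<phi>}"
    unfolding \<phi>(1) by simp
  moreover have "\<theta> - (- \<phi>) = - (\<eta> - \<phi>)" by (simp add: \<eta>(3))
  then have "cos (\<theta> - (- \<phi>)) = cos (\<eta> - \<phi>)" "sin (2 * (\<theta> - (- \<phi>))) = - sin (2 * (\<eta> - \<phi>))"
    by (simp_all only: cos_minus mult_minus_right sin_minus)
  ultimately show ?thesis using \<phi> by (intro exI[of _ "- \<phi>"]) auto
qed

text \<open>For x = 1/m it says that (1 + 1/m)^(m+1) is at most e (1 + 1/(2m)). Both sides agree at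
  0; the derivatives compare by ln (1 + y) <= ln (1 + y/2) + y / (2 + y), again an equality at 0,
  and there the derivatives differ by y / ((1 + y)(2 + y)^2).\<close>

lemma ln_inequality:
  assumes "x \<ge> (0::real)"
  shows "(1 + x) * ln (1 + x) \<le> x + x * ln (1 + x / 2)"
proof -
  have d: "ln (1 + y) \<le> ln (1 + y / 2) + y / (2 + y)" if y: "y \<ge> 0" for y :: real
  proof -
    let ?g = "\<lambda>y::real. ln (1 + y / 2) + y / (2 + y) - ln (1 + y)"
    have "?g 0 \<le> ?g y"
    proof (rule DERIV_nonneg_imp_nondecreasing[OF y])
      fix t :: real assume t: "0 \<le> t"
      have "((\<lambda>y. ln (1 + y / 2)) has_real_derivative (1/2) / (1 + t / 2)) (at t)"
        "((\<lambda>y. ln (1 + y)) has_real_derivative 1 / (1 + t)) (at t)"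
        using t by (auto intro!: derivative_eq_intros)
      moreover have "((\<lambda>y. y / (2 + y)) has_real_derivative (1 * (2 + t) - t * 1) / ((2 + t) * (2 + t))) (at t)"
        using t by (intro DERIV_divide) (auto intro!: derivative_eq_intros)
      ultimately have "(?g has_real_derivative (1/2) / (1 + t / 2) + (1 * (2 + t) - t * 1) / ((2 + t) * (2 + t)) - 1 / (1 + t)) (at t)"
        by (intro DERIV_add DERIV_diff)
      moreover have "(1/2) / (1 + t / 2) + (1 * (2 + t) - t * 1) / ((2 + t) * (2 + t)) - 1 / (1 + t) = t / ((1 + t) * (2 + t)\<^sup>2)"
      proof -
        define u where "u = 2 + t"
        have u: "u \<noteq> 0" "u - 1 \<noteq> 0" "t = u - 2" using t by (auto simp: u_def)
        have "(1/2) / (1 + t / 2) = 1 / u" using u by (simp add: field_simps)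
        moreover have "1 / u + 2 / (u * u) - 1 / (u - 1) = (u - 2) / ((u - 1) * u\<^sup>2)"
          using u by (simp add: divide_simps power2_eq_square) (simp add: algebra_simps)
        ultimately show ?thesis by (simp add: u(3))
      qed
      moreover have "t / ((1 + t) * (2 + t)\<^sup>2) \<ge> 0" using t by simp
      ultimately show "\<exists>D. (?g has_real_derivative D) (at t) \<and> 0 \<le> D" by (intro exI conjI) auto
    qed
    then show ?thesis by simp
  qed
  let ?f = "\<lambda>x::real. x + x * ln (1 + x / 2) - (1 + x) * ln (1 + x)"
  have "?f 0 \<le> ?f x"
  proof (rule DERIV_nonneg_imp_nondecreasing[OF assms])
    fix t :: real assume t: "0 \<le> t"
    have "(?f has_real_derivative 1 + (ln (1 + t / 2) + t * ((1/2) / (1 + t / 2))) - (ln (1 + t) + (1 + t) * (1 / (1 + t)))) (at t)"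
      using t by (auto intro!: derivative_eq_intros)
    moreover have "t * ((1/2) / (1 + t / 2)) = t / (2 + t)" using t by (simp add: divide_simps)
    moreover have "(1 + t) * (1 / (1 + t)) = 1" using t by simp
    ultimately show "\<exists>D. (?f has_real_derivative D) (at t) \<and> 0 \<le> D"
      using d[OF t] by (intro exI conjI) (assumption, simp)
  qed
  then show ?thesis by simp
qed

text \<open>2 sin \<phi> cos^m \<phi> is largest where tan^2 \<phi> = 1/m. Its reciprocal there is
  half the square root of m (1 + 1/m)^(m+1), and \<open>ln_inequality\<close> bounds the radicand by
  e (m + 1/2). With m = \<tau> + 1 this is where the constants 11/2, 15/2 and 19/2 come
  from.\<close>

lemma optimal_rotation_bound:
  assumes m: "m > (0::real)"
  defines "\<phi> \<equiv> arctan (1 / sqrt m)"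
  shows "1 / (sin (2 * \<phi>) * cos \<phi> powr (m - 1)) \<le> 1 / 2 * sqrt (exp 1 * (m + 1 / 2))"
proof -
  have q: "1 + (1 / sqrt m)\<^sup>2 = (m + 1) / m" using m by (simp add: power_divide field_simps)
  have inv_sqrt: "1 / sqrt x = exp (- (1/2) * ln x)" if "x > 0" for x :: real
  proof -
    have "sqrt x = exp (1/2 * ln x)" using powr_half_sqrt[of x] that by (simp add: powr_def)
    then show ?thesis using exp_minus[of "1/2 * ln x"] by (simp only: mult_minus_left inverse_eq_divide)
  qed
  define L where "L = ln ((m + 1) / m)"
  have "cos \<phi> = 1 / sqrt ((m + 1) / m)" unfolding \<phi>_def cos_arctan q ..
  then have c: "cos \<phi> = exp (- (1/2) * L)" using inv_sqrt[of "(m + 1) / m"] m by (simp only: L_def divide_pos_pos zero_less_one add_pos_pos)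
  have c0: "cos \<phi> > 0" unfolding c by simp
  have "sin \<phi> = (1 / sqrt m) * cos \<phi>" unfolding \<phi>_def sin_arctan cos_arctan by simp
  then have s: "sin \<phi> = exp (- (1/2) * ln m) * cos \<phi>" by (simp only: inv_sqrt[OF m])
  have "sin (2 * \<phi>) * cos \<phi> powr (m - 1) = 2 * sin \<phi> * (cos \<phi> powr 1 * cos \<phi> powr (m - 1))"
    using c0 by (simp add: sin_double)
  also have "cos \<phi> powr 1 * cos \<phi> powr (m - 1) = cos \<phi> powr m" unfolding powr_add[symmetric] by simp
  also have "cos \<phi> powr m = exp (m * (- (1/2) * L))" unfolding c powr_def by simp
  also have "2 * sin \<phi> * exp (m * (- (1/2) * L)) = 2 * exp (- (1/2) * ln m + - (1/2) * L + m * (- (1/2) * L))"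
    unfolding s c by (simp only: exp_add mult.assoc)
  also have "- (1/2) * ln m + - (1/2) * L + m * (- (1/2) * L) = - ((ln m + (1 + m) * L) / 2)" by (simp add: field_simps)
  finally have "1 / (sin (2 * \<phi>) * cos \<phi> powr (m - 1)) = 1 / (2 * exp (- ((ln m + (1 + m) * L) / 2)))" by (simp only:)
  then have e: "1 / (sin (2 * \<phi>) * cos \<phi> powr (m - 1)) = 1/2 * exp ((ln m + (1 + m) * ln ((m + 1) / m)) / 2)"
    by (simp only: exp_minus L_def divide_inverse inverse_mult_distrib inverse_inverse_eq mult_1_left)
  have "(1 + 1 / m) * ln (1 + 1 / m) \<le> 1 / m + 1 / m * ln (1 + 1 / m / 2)"
    using m by (intro ln_inequality) auto
  then have "m * ((1 + 1 / m) * ln (1 + 1 / m)) \<le> m * (1 / m + 1 / m * ln (1 + 1 / m / 2))"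
    using m by (intro mult_left_mono) auto
  moreover have "m * ((1 + 1 / m) * ln (1 + 1 / m)) = (1 + m) * ln ((m + 1) / m)"
  proof -
    have "1 + 1 / m = (m + 1) / m" using m by (simp add: field_simps)
    moreover have "m * ((m + 1) / m * L) = (1 + m) * L" for L using m by simp
    ultimately show ?thesis by (simp only:)
  qed
  moreover have "m * (1 / m + 1 / m * ln (1 + 1 / m / 2)) = 1 + ln (1 + 1 / m / 2)"
    using m by (simp add: distrib_left)
  moreover have "ln m + ln (1 + 1 / m / 2) = ln (m + 1 / 2)"
  proof -
    have "ln m + ln (1 + 1 / m / 2) = ln (m * (1 + 1 / m / 2))" by (rule ln_mult_pos[OF m, symmetric]) (use m in \<open>intro add_pos_pos, auto\<close>)
    also have "m * (1 + 1 / m / 2) = m + 1 / 2" using m by (simp add: distrib_left)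
    finally show ?thesis .
  qed
  ultimately have "ln m + (1 + m) * ln ((m + 1) / m) \<le> 1 + ln (m + 1 / 2)" by linarith
  then have "exp ((ln m + (1 + m) * ln ((m + 1) / m)) / 2) \<le> exp ((1 + ln (m + 1 / 2)) / 2)" by simp
  also have "\<dots> = sqrt (exp (1 + ln (m + 1 / 2)))"
  proof -
    have "exp (1 + ln (m + 1 / 2)) = (exp ((1 + ln (m + 1 / 2)) / 2))\<^sup>2" by (simp add: power2_eq_square exp_add[symmetric])
    then show ?thesis by simp
  qed
  also have "exp (1 + ln (m + 1 / 2)) = exp 1 * (m + 1 / 2)" using m by (simp add: exp_add)
  finally show ?thesis unfolding e by simp
qed

text \<open>The angle \<psi> that is optimal for |\<theta>| = \<pi>/2 is used for all \<theta>. If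
  the remaining turn \<alpha> has cos (2 \<alpha>) >= 0, \<open>stieltjes\<close> is bounded by its
  moment. Otherwise 2 |\<alpha>| lies between \<pi>/2 and \<pi> - 2 \<psi>, so sin (2 |\<alpha>|) >=
  sin (2 \<psi>).\<close>

lemma norm_terminant_le_sqrt:
  assumes \<nu>: "\<nu> \<notin> \<real>\<^sub>\<le>\<^sub>0" and \<theta>: "pi / 4 < \<bar>Arg \<nu>\<bar>" "\<bar>Arg \<nu>\<bar> \<le> pi / 2"
  shows "norm (terminant n (Arg \<nu> / 2) \<nu>) \<le> 1 / 2 * sqrt (exp 1 * (tau n + 3 / 2)) * b n \<nu>"
proof -
  define m where "m = tau n + 1"
  have m: "m > 1" using tau_pos[of n] by (simp add: m_def)
  define \<psi> where "\<psi> = arctan (1 / sqrt m)"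
  define \<theta> where "\<theta> = Arg \<nu>"
  have \<psi>: "0 < \<psi>" "\<psi> < pi / 4"
  proof -
    show "0 < \<psi>" unfolding \<psi>_def using m by (simp add: zero_less_arctan_iff)
    have "1 / sqrt m < 1" using m by simp
    then have "arctan (1 / sqrt m) < arctan 1" by (simp only: arctan_less_iff)
    then show "\<psi> < pi / 4" by (simp add: \<psi>_def arctan_one)
  qed
  define \<phi> where "\<phi> = (if \<theta> > 0 then \<psi> else - \<psi>)"
  define \<alpha> where "\<alpha> = \<theta> - \<phi>"
  have abs: "\<bar>\<alpha>\<bar> = \<bar>\<theta>\<bar> - \<psi>" using \<theta> \<psi> unfolding \<theta>_def[symmetric] by (auto simp: \<alpha>_def \<phi>_def)
  then have a: "0 < \<bar>\<alpha>\<bar>" "\<bar>\<alpha>\<bar> \<le> pi / 2 - \<psi>" using \<theta> \<psi> unfolding \<theta>_def[symmetric] by linarith+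
  have ca: "cos \<alpha> > 0" using a \<psi> by (intro cos_gt_zero_pi) auto
  have cp: "cos (Arg \<nu> - \<alpha>) = cos \<psi>" by (simp add: \<alpha>_def \<phi>_def \<theta>_def)
  have cpsi: "cos \<psi> > 0" using \<psi> by (intro cos_gt_zero) auto
  have s2: "sin (2 * \<psi>) > 0" using \<psi> by (intro sin_gt_zero) auto
  have "norm (stieltjes n (of_real \<sigma> * cis (- \<alpha>))) \<le> moment n * (1 / sin (2 * \<psi>))" if \<sigma>: "\<sigma> > 0" for \<sigma>
  proof (cases "cos (2 * \<alpha>) \<ge> 0")
    case True
    have "moment n * 1 \<le> moment n * (1 / sin (2 * \<psi>))"
      using moment_nonneg[of n] s2 by (intro mult_left_mono) auto
    then show ?thesis using norm_stieltjes_ray_le(1)[OF \<sigma> ca True, of n] by linarith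
  next
    case False
    have "2 * \<bar>\<alpha>\<bar> > pi / 2"
    proof (rule ccontr)
      assume "\<not> 2 * \<bar>\<alpha>\<bar> > pi / 2"
      then have "cos (2 * \<alpha>) \<ge> 0" by (intro cos_ge_zero) (auto simp: abs_if split: if_splits)
      then show False using False by simp
    qed
    then have "sin (pi - 2 * \<bar>\<alpha>\<bar>) \<ge> sin (2 * \<psi>)"
      using a \<psi> by (intro sin_monotone_2pi_le) auto
    then have ge: "sin (2 * \<bar>\<alpha>\<bar>) \<ge> sin (2 * \<psi>)" by (simp only: sin_pi_minus)
    have "\<bar>sin (2 * \<alpha>)\<bar> = sin (2 * \<bar>\<alpha>\<bar>)"
      using ge s2 by (cases "\<alpha> \<ge> 0") auto
    then have "\<bar>1 / sin (2 * \<alpha>)\<bar> \<le> 1 / sin (2 * \<psi>)" "sin (2 * \<alpha>) \<noteq> 0"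
      using ge s2 by (auto intro!: divide_left_mono mult_pos_pos)
    then show ?thesis
      using norm_stieltjes_ray_le(2)[OF \<sigma> ca, of n] moment_nonneg[of n] by (meson mult_left_mono order_trans)
  qed
  then have "norm (terminant n (Arg \<nu> / 2) \<nu>) \<le> (1 / sin (2 * \<psi>)) / cos (Arg \<nu> - \<alpha>) powr tau n * b n \<nu>"
    using ca cp cpsi by (intro norm_terminant_half_Arg_le[OF \<nu>]) auto
  also have "\<dots> = 1 / (sin (2 * \<psi>) * cos \<psi> powr (m - 1)) * b n \<nu>" unfolding cp by (simp add: m_def)
  also have "\<dots> \<le> 1 / 2 * sqrt (exp 1 * (m + 1 / 2)) * b n \<nu>"
    unfolding \<psi>_def using m by (intro mult_right_mono optimal_rotation_bound b_nonneg) auto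
  finally show ?thesis by (simp add: m_def add.assoc)
qed

lemma slit_plane_Arg:
  assumes "\<nu> \<noteq> 0" "\<bar>Arg \<nu>\<bar> < pi"
  shows "\<nu> \<notin> \<real>\<^sub>\<le>\<^sub>0"
proof
  assume "\<nu> \<in> \<real>\<^sub>\<le>\<^sub>0"
  then have "Arg \<nu> = pi"
    using assms(1) by (auto simp: Arg_eq_pi complex_nonpos_Reals_iff complex_is_Real_iff complex_eq_iff)
  then show False using assms(2) by simp
qed

lemma remainder_J_bound_critical:
  assumes \<nu>: "\<nu> \<notin> \<real>\<^sub>\<le>\<^sub>0" and \<theta>: "pi / 4 < \<bar>Arg \<nu>\<bar>"
  obtains \<phi> where
    "\<And>n. {x \<in> I (Arg \<nu>). (2 * real n + 7) * cos (3 * x - 2 * Arg \<nu>) = (2 * real n - 5) * cos (x - 2 * Arg \<nu>)} = {\<phi> n}"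
    "\<And>n. norm (terminant n (Arg \<nu> / 2) \<nu>)
      \<le> \<bar>1 / sin (2 * (Arg \<nu> - \<phi> n))\<bar> / cos (\<phi> n) powr tau n * b n \<nu>"
proof -
  \<comment> \<open>K = 2n + 1 = 3 \<tau> in the critical equation.\<close>
  let ?P = "\<lambda>n x. {x \<in> I (Arg \<nu>). (2 * real n + 1 + 6) * cos (3 * x - 2 * Arg \<nu>) = (2 * real n + 1 - 6) * cos (x - 2 * Arg \<nu>)} = {x}
      \<and> cos x > 0 \<and> cos (Arg \<nu> - x) > 0 \<and> sin (2 * (Arg \<nu> - x)) \<noteq> 0"
  have "\<exists>x. ?P n x" for n by (rule critical_unique[OF \<theta> Arg_slit_plane[OF \<nu>]]) simp
  then obtain \<phi> where \<phi>: "\<And>n. ?P n (\<phi> n)" by metis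
  have "{x \<in> I (Arg \<nu>). (2 * real n + 7) * cos (3 * x - 2 * Arg \<nu>) = (2 * real n - 5) * cos (x - 2 * Arg \<nu>)} = {\<phi> n}" for n
  proof -
    have "2 * real n + 1 + 6 = 2 * real n + 7" "2 * real n + 1 - 6 = 2 * real n - 5" by simp_all
    then show ?thesis using \<phi>[of n] by (simp only:)
  qed
  moreover have "norm (terminant n (Arg \<nu> / 2) \<nu>)
      \<le> \<bar>1 / sin (2 * (Arg \<nu> - \<phi> n))\<bar> / cos (\<phi> n) powr tau n * b n \<nu>" for n
  proof -
    have \<phi>n: "cos (\<phi> n) > 0" "cos (Arg \<nu> - \<phi> n) > 0" "sin (2 * (Arg \<nu> - \<phi> n)) \<noteq> 0" using \<phi>[of n] by auto
    have e: "Arg \<nu> - (Arg \<nu> - \<phi> n) = \<phi> n" by simp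
    have "norm (terminant n (Arg \<nu> / 2) \<nu>)
      \<le> \<bar>1 / sin (2 * (Arg \<nu> - \<phi> n))\<bar> / cos (Arg \<nu> - (Arg \<nu> - \<phi> n)) powr tau n * b n \<nu>"
      by (rule norm_terminant_half_Arg_le[OF \<nu> \<phi>n(2) _ norm_stieltjes_ray_le(2)[OF _ \<phi>n(2,3)]]) (use \<phi>n(1) e in auto)
    then show ?thesis unfolding e .
  qed
  ultimately show ?thesis using that by blast
qed

theorem mainTheorem9:
  fixes N :: nat and \<nu> :: complex and \<theta> :: real
  assumes "\<nu> \<noteq> 0" and "\<theta> = Arg \<nu>"
  shows
    "(pi / 4 < \<bar>\<theta>\<bar> \<and> \<bar>\<theta>\<bar> < pi \<longrightarrow>
       (\<exists>\<phi>1 \<phi>2 \<phi>3.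
          {\<phi> \<in> I \<theta>. (2 * real N + 7) * cos (3 * \<phi> - 2 * \<theta>) = (2 * real N - 5) * cos (\<phi> - 2 * \<theta>)} = {\<phi>1} \<and>
          {\<phi> \<in> I \<theta>. (2 * real N + 9) * cos (3 * \<phi> - 2 * \<theta>) = (2 * real N - 3) * cos (\<phi> - 2 * \<theta>)} = {\<phi>2} \<and>
          {\<phi> \<in> I \<theta>. (2 * real N + 11) * cos (3 * \<phi> - 2 * \<theta>) = (2 * real N - 1) * cos (\<phi> - 2 * \<theta>)} = {\<phi>3} \<and>
          (let E1 = \<bar>1 / sin (2 * (\<theta> - \<phi>1))\<bar> / cos \<phi>1 powr ((2 * real N + 1) / 3)
                      * (b N \<nu> / (2 * sqrt 3 * pi));
               E2 = \<bar>1 / sin (2 * (\<theta> - \<phi>2))\<bar> / cos \<phi>2 powr ((2 * real N + 3) / 3)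
                      * (b (N + 1) \<nu> / (2 * sqrt 3 * pi));
               E3 = \<bar>1 / sin (2 * (\<theta> - \<phi>3))\<bar> / cos \<phi>3 powr ((2 * real N + 5) / 3)
                      * (b (N + 2) \<nu> / (2 * sqrt 3 * pi))
           in (N mod 3 = 0 \<longrightarrow> norm (remainder_J N \<nu>) \<le> E1 + E3) \<and>
              (N mod 3 = 1 \<longrightarrow> norm (remainder_J N \<nu>) \<le> E2 + E3) \<and>
              (N mod 3 = 2 \<longrightarrow> norm (remainder_J N \<nu>) \<le> E1 + E2))))
     \<and>
     (pi / 4 < \<bar>\<theta>\<bar> \<and> \<bar>\<theta>\<bar> \<le> pi / 2 \<and> N \<ge> 4 \<longrightarrow>
       (let F1 = 1 / 2 * sqrt (exp 1 / 3 * (2 * real N + 11 / 2)) * (b N \<nu> / (2 * sqrt 3 * pi));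
            F2 = 1 / 2 * sqrt (exp 1 / 3 * (2 * real N + 15 / 2)) * (b (N + 1) \<nu> / (2 * sqrt 3 * pi));
            F3 = 1 / 2 * sqrt (exp 1 / 3 * (2 * real N + 19 / 2)) * (b (N + 2) \<nu> / (2 * sqrt 3 * pi))
        in (N mod 3 = 0 \<longrightarrow> norm (remainder_J N \<nu>) \<le> F1 + F3) \<and>
           (N mod 3 = 1 \<longrightarrow> norm (remainder_J N \<nu>) \<le> F2 + F3) \<and>
           (N mod 3 = 2 \<longrightarrow> norm (remainder_J N \<nu>) \<le> F1 + F2)))"
proof (intro conjI impI)
  assume "pi / 4 < \<bar>\<theta>\<bar> \<and> \<bar>\<theta>\<bar> < pi"
  then have \<nu>: "\<nu> \<notin> \<real>\<^sub>\<le>\<^sub>0" and \<theta>: "pi / 4 < \<bar>Arg \<nu>\<bar>"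
    using slit_plane_Arg[of \<nu>] assms by auto
  obtain \<phi> where unique: "\<And>n. {x \<in> I (Arg \<nu>). (2 * real n + 7) * cos (3 * x - 2 * Arg \<nu>) = (2 * real n - 5) * cos (x - 2 * Arg \<nu>)} = {\<phi> n}"
    and bound: "\<And>n. norm (terminant n (Arg \<nu> / 2) \<nu>) \<le> \<bar>1 / sin (2 * (Arg \<nu> - \<phi> n))\<bar> / cos (\<phi> n) powr tau n * b n \<nu>"
    by (rule remainder_J_bound_critical[OF \<nu> \<theta>]) (rule that)
  have t: "tau N = (2 * real N + 1) / 3" "tau (N + 1) = (2 * real N + 3) / 3" "tau (N + 2) = (2 * real N + 5) / 3"
    by (simp_all add: tau_def)
  \<comment> \<open>The three equations of the statement are the instances n = N, N + 1, N + 2 of a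
    single one.\<close>
  have c: "2 * real (N + 1) + 7 = 2 * real N + 9" "2 * real (N + 1) - 5 = 2 * real N - 3"
    "2 * real (N + 2) + 7 = 2 * real N + 11" "2 * real (N + 2) - 5 = 2 * real N - 1"
    by simp_all
  note R = norm_remainder_J_le[OF \<nu> bound, of N, unfolded t]
  show "\<exists>\<phi>1 \<phi>2 \<phi>3.
          {\<phi> \<in> I \<theta>. (2 * real N + 7) * cos (3 * \<phi> - 2 * \<theta>) = (2 * real N - 5) * cos (\<phi> - 2 * \<theta>)} = {\<phi>1} \<and>
          {\<phi> \<in> I \<theta>. (2 * real N + 9) * cos (3 * \<phi> - 2 * \<theta>) = (2 * real N - 3) * cos (\<phi> - 2 * \<theta>)} = {\<phi>2} \<and>
          {\<phi> \<in> I \<theta>. (2 * real N + 11) * cos (3 * \<phi> - 2 * \<theta>) = (2 * real N - 1) * cos (\<phi> - 2 * \<theta>)} = {\<phi>3} \<and>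
          (let E1 = \<bar>1 / sin (2 * (\<theta> - \<phi>1))\<bar> / cos \<phi>1 powr ((2 * real N + 1) / 3)
                      * (b N \<nu> / (2 * sqrt 3 * pi));
               E2 = \<bar>1 / sin (2 * (\<theta> - \<phi>2))\<bar> / cos \<phi>2 powr ((2 * real N + 3) / 3)
                      * (b (N + 1) \<nu> / (2 * sqrt 3 * pi));
               E3 = \<bar>1 / sin (2 * (\<theta> - \<phi>3))\<bar> / cos \<phi>3 powr ((2 * real N + 5) / 3)
                      * (b (N + 2) \<nu> / (2 * sqrt 3 * pi))
           in (N mod 3 = 0 \<longrightarrow> norm (remainder_J N \<nu>) \<le> E1 + E3) \<and>
              (N mod 3 = 1 \<longrightarrow> norm (remainder_J N \<nu>) \<le> E2 + E3) \<and>
              (N mod 3 = 2 \<longrightarrow> norm (remainder_J N \<nu>) \<le> E1 + E2))"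
    unfolding Let_def assms(2)
    by (intro exI[of _ "\<phi> N"] exI[of _ "\<phi> (N + 1)"] exI[of _ "\<phi> (N + 2)"] conjI impI
        unique unique[of "N + 1", unfolded c] unique[of "N + 2", unfolded c] R)
next
  assume "pi / 4 < \<bar>\<theta>\<bar> \<and> \<bar>\<theta>\<bar> \<le> pi / 2 \<and> N \<ge> 4"
  then have \<nu>: "\<nu> \<notin> \<real>\<^sub>\<le>\<^sub>0" and \<theta>: "pi / 4 < \<bar>Arg \<nu>\<bar>" "\<bar>Arg \<nu>\<bar> \<le> pi / 2"
    using slit_plane_Arg[of \<nu>] assms pi_gt_zero by auto
  have t: "exp 1 * (tau N + 3 / 2) = exp 1 / 3 * (2 * real N + 11 / 2)"
    "exp 1 * (tau (N + 1) + 3 / 2) = exp 1 / 3 * (2 * real N + 15 / 2)"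
    "exp 1 * (tau (N + 2) + 3 / 2) = exp 1 / 3 * (2 * real N + 19 / 2)"
    by (simp_all add: tau_def field_simps)
  note R = norm_remainder_J_le[OF \<nu> norm_terminant_le_sqrt[OF \<nu> \<theta>], of N, unfolded t]
  show "let F1 = 1 / 2 * sqrt (exp 1 / 3 * (2 * real N + 11 / 2)) * (b N \<nu> / (2 * sqrt 3 * pi));
            F2 = 1 / 2 * sqrt (exp 1 / 3 * (2 * real N + 15 / 2)) * (b (N + 1) \<nu> / (2 * sqrt 3 * pi));
            F3 = 1 / 2 * sqrt (exp 1 / 3 * (2 * real N + 19 / 2)) * (b (N + 2) \<nu> / (2 * sqrt 3 * pi))
        in (N mod 3 = 0 \<longrightarrow> norm (remainder_J N \<nu>) \<le> F1 + F3) \<and>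
           (N mod 3 = 1 \<longrightarrow> norm (remainder_J N \<nu>) \<le> F2 + F3) \<and>
           (N mod 3 = 2 \<longrightarrow> norm (remainder_J N \<nu>) \<le> F1 + F2)"
    unfolding Let_def by (intro conjI impI R)
qed

end
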